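(* Let $\zeta\ge 60$ and $\theta>0$ be constants. For each $n$ let $\lambda=\lambda_n=\frac1{\zeta n}$, let $p=p_n\in(0,1)$ satisfy $p\sqrt n\to\theta$ as $n\to\infty$, and let $$q:=p+\frac{\mathbb{E}|M|}{\binom n2}(1-p),$$ where $\mathbb{E}|M|$ is the expected size of $M\sim\mu_\lambda$. Let $c=1-\frac12\left(\sqrt{\zeta^2+4\zeta}-\zeta\right)\in(0,1)$. Let $\mathcal{P}_\lambda$ be the planted matching model and $\mathcal{Q}=G(n,q)$. Define the threshold test $\varphi_n':\{0,1\}^{\binom{[n]}{2}}\to\{0,1\}$ by $$\varphi_n'(A)=\mathbf{1}\left\{\frac{\check{P_2}(A)}{\sqrt{3\binom n3 q^2(1-q^2)}}\ \le\ -\frac{c^2}{2\sqrt2\,\theta}\right\},\qquad \check{P_2}(A)=\sum_{j\in[n]}\ \sum_{\{i,k\}\in\binom{[n]\setminus\{j\}}{2}}(A_{ij}-q)(A_{jk}-q).$$ Then, as $n\to\infty$, $$\mathbb{P}_{A\sim\mathcal{P}_\lambda}[\varphi_n'(A)=0]+\mathbb{P}_{A\sim\mathcal{Q}}[\varphi_n'(A)=1]\ \longrightarrow\ 2\,\Phi\left(-\frac{c^2}{2\sqrt2\,\theta}\right).$$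
   Context: A matching in a graph is a set of pairwise non-adjacent (vertex-disjoint) edges; the empty set is a matching. For a simple graph $G$ and $\lambda>0$, the monomer-dimer Gibbs measure on matchings $M$ of $G$ is $\mu_{\lambda,G}(M)=\lambda^{|M|}/Z_G(\lambda)$ with $Z_G(\lambda)=\sum_{M\subset G}\lambda^{|M|}$ (sum over all matchings $M$ in $G$, where $|M|$ is the number of edges). Write $\mu_\lambda=\mu_{\lambda,K_n}$, where $K_n$ is the complete graph on $[n]=\{1,\dots,n\}$. The planted matching model $\mathcal{P}_\lambda$ (with parameters $n,p,\lambda$) is the law of the adjacency matrix $A$ of a random graph on $[n]$ generated as follows: sample $M\sim\mu_\lambda$; conditionally on $M$, set $A_{ij}=1$ if $\{i,j\}\in M$, and let $A_{ij}\sim\mathrm{Bernoulli}(p)$ independently for $\{i,j\}\notin M$. The null model $\mathcal{Q}=G(n,q)$ is the Erdős–Rényi random graph on $[n]$, with all edges independent $\mathrm{Bernoulli}(q)$. Graphs are identified with elements of $\{0,1\}^{\binom{[n]}{2}}$. $\Phi$ denotes the standard Gaussian cumulative distribution function. *)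

theory Defs
  imports "HOL-Probability.Probability" "HOL-Library.Ramsey" "HOL-Library.Disjoint_Sets"
begin

text \<open>A simple graph is given by its set of edges, an edge being a two-element set of vertices.\<close>

definition complete_edges :: "nat \<Rightarrow> nat set set" where
  "complete_edges n = nsets {1..n} 2"

definition matchings :: "'a set set \<Rightarrow> 'a set set set" where
  "matchings E = {M. M \<subseteq> E \<and> disjoint M}"

definition partition_function :: "real \<Rightarrow> 'a set set \<Rightarrow> real" where
  "partition_function lam E = (\<Sum>M\<in>matchings E. lam ^ card M)"

definition monomer_dimer :: "real \<Rightarrow> 'a set set \<Rightarrow> 'a set set pmf" where
  "monomer_dimer lam E =
     embed_pmf (\<lambda>M. if M \<in> matchings E then lam ^ card M / partition_function lam E else 0)"

text \<open>The weights passed to \<^const>\<open>embed_pmf\<close> do form a probability mass function.\<close>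

lemma pmf_monomer_dimer:
  assumes "finite E" and "lam \<ge> 0"
  shows "pmf (monomer_dimer lam E) M =
    (if M \<in> matchings E then lam ^ card M / partition_function lam E else 0)"
proof -
  let ?f = "\<lambda>M. if M \<in> matchings E then lam ^ card M / partition_function lam E else 0"
  have fin: "finite (matchings E)"
    by (rule finite_subset[of _ "Pow E"]) (auto simp: matchings_def assms(1))
  have "{} \<in> matchings E"
    by (simp add: matchings_def disjoint_def)
  then have "lam ^ card ({} :: 'a set set) \<le> partition_function lam E"
    unfolding partition_function_def
    by (intro member_le_sum[where f = "\<lambda>M. lam ^ card M"] fin) (use assms in auto)
  then have Z: "partition_function lam E > 0"
    by simp
  have nonneg: "?f M \<ge> 0" for M
    using Z assms(2) by simp
  have "(\<integral>\<^sup>+ M. ennreal (?f M) \<partial>count_space UNIV) = (\<Sum>M\<in>matchings E. ennreal (?f M))"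
    by (rule nn_integral_count_space'[OF fin]) auto
  also have "\<dots> = ennreal (\<Sum>M\<in>matchings E. ?f M)"
    by (rule sum_ennreal) (rule nonneg)
  also have "(\<Sum>M\<in>matchings E. ?f M) = 1"
    using Z by (simp add: partition_function_def flip: sum_divide_distrib)
  finally have "(\<integral>\<^sup>+ M. ennreal (?f M) \<partial>count_space UNIV) = 1"
    by simp
  then show ?thesis
    unfolding monomer_dimer_def by (rule pmf_embed_pmf[where f = ?f, OF nonneg])
qed

definition expected_matching_size :: "real \<Rightarrow> nat \<Rightarrow> real" where
  "expected_matching_size lam n =
     measure_pmf.expectation (monomer_dimer lam (complete_edges n)) (\<lambda>M. real (card M))"

text \<open>
  A random graph on \<open>{1..n}\<close> is a random indicator function on \<open>complete_edges n\<close>;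
  \<^const>\<open>Pi_pmf\<close> fixes the value \<^const>\<open>False\<close> outside that set.
\<close>

definition erdos_renyi :: "nat \<Rightarrow> real \<Rightarrow> (nat set \<Rightarrow> bool) pmf" where
  "erdos_renyi n q = Pi_pmf (complete_edges n) False (\<lambda>_. bernoulli_pmf q)"

definition planted_matching :: "nat \<Rightarrow> real \<Rightarrow> real \<Rightarrow> (nat set \<Rightarrow> bool) pmf" where
  "planted_matching n p lam =
     bind_pmf (monomer_dimer lam (complete_edges n))
       (\<lambda>M. Pi_pmf (complete_edges n) False
              (\<lambda>e. if e \<in> M then return_pmf True else bernoulli_pmf p))"

definition adj :: "(nat set \<Rightarrow> bool) \<Rightarrow> nat \<Rightarrow> nat \<Rightarrow> real" where
  "adj A i j = of_bool (A {i, j})"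

text \<open>
  In the inner sum \<open>S\<close> is the unordered pair \<open>{i, k}\<close> of endpoints of a path centred at \<open>j\<close>,
  so the product is \<open>(A\<^sub>i\<^sub>j - q) (A\<^sub>j\<^sub>k - q)\<close>.
\<close>

definition signed_wedge_count :: "nat \<Rightarrow> real \<Rightarrow> (nat set \<Rightarrow> bool) \<Rightarrow> real" where
  "signed_wedge_count n q A =
     (\<Sum>j\<in>{1..n}. \<Sum>S\<in>nsets ({1..n} - {j}) 2. \<Prod>i\<in>S. (adj A i j - q))"

definition wedge_test :: "nat \<Rightarrow> real \<Rightarrow> real \<Rightarrow> (nat set \<Rightarrow> bool) \<Rightarrow> nat" where
  "wedge_test n q t A =
     of_bool (signed_wedge_count n q A / sqrt (3 * real (n choose 3) * q\<^sup>2 * (1 - q\<^sup>2)) \<le> t)"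

end

theory Submission
  imports Defs "HOL-Real_Asymp.Real_Asymp"
begin

text \<open>
  The signed wedge count is a quadratic form \<open>W\<close> in the centred edge indicators \<open>x\<^sub>e\<close>. For
  \<open>G(n, p)\<close> with \<open>p \<surd>n \<rightarrow> \<theta>\<close> its central limit theorem follows from Stein's method for
  characteristic functions: with \<open>L\<^sub>e\<close> the sum of \<open>x\<^sub>f\<close> over edges \<open>f\<close> adjacent to \<open>e\<close>, one has
  \<open>W = \<Sum>x\<^sub>e L\<^sub>e / 2\<close>, and expanding in \<open>x\<^sub>e\<close>, which is independent of \<open>L\<^sub>e\<close>, shows that the
  characteristic function of the normalised form almost satisfies \<open>\<phi>' t = - t \<phi> t\<close>, because
  \<open>\<Sum>L\<^sub>e\<^sup>2\<close> concentrates.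

  A planted graph is \<open>A \<union> M\<close> with \<open>A\<close> drawn from \<open>G(n, p)\<close> independently of \<open>M\<close>. Its wedge count is that
  of \<open>A\<close>, plus terms of variance \<open>o(n\<^sup>2)\<close>, plus a function of \<open>|M|\<close> alone. A double count of pairs
  \<open>(M, e)\<close> with \<open>e \<in> M\<close> shows that \<open>|M|\<close> is within \<open>O(\<surd>n)\<close> of \<open>c n / 2\<close>, so this function is
  \<open>- c\<^sup>2 n / 2 + o(n)\<close>. After normalisation the planted law is the null law shifted by twice the threshold,
  and both errors tend to the same Gaussian tail.
\<close>

section \<open>Functions of independent coordinates\<close>

text \<open>The choice of \<open>q\<close> equates the expected edge counts of the two models, so
  the edge count carries no shift and the signal has to come from wedges. Two edges of
  \<open>M\<close> never share a vertex, so the centred planted part has no wedges inside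
  \<open>M\<close> to balance its negative terms. With \<open>m\<close> about \<open>c / n\<close>,
  it consists of \<open>m^2\<close> times about \<open>n^3 / 2\<close> wedges, which is about
  \<open>c^2 n / 2\<close>, minus \<open>2 m n |M|\<close>, which is about \<open>c^2 n\<close>. The
  coefficient of \<open>|M|\<close> has constant order, hence deviations of order \<surd>n in
  \<open>|M|\<close> are harmless against a standard deviation of order \<open>n\<close>.

  The obstacle in the central limit theorem is that \<open>v = p (1 - p)\<close> tends to 0: the
  fourth moment of a centred indicator is of order \<open>v\<close>, not \<open>v^2\<close>. The
  moment bounds therefore keep track of every power of \<open>v\<close>. The errors caused by
  sparsity are governed by \<open>1 / (v n^2)\<close> and \<open>1 / (v^2 n^3)\<close>, and these
  vanish when \<open>v\<close> is of order \<open>1 / \<surd>n\<close>. At this scale the standard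
  deviation is about \<open>\<theta> n / \<surd>2\<close>, which is the origin of the constant
  \<open>2 \<surd>2 \<theta>\<close> in the threshold.\<close>

lemma expectation_pair_pmf_finite:
  fixes H :: "'a \<times> 'b \<Rightarrow> 'c::{banach,second_countable_topology}"
  assumes P: "finite (set_pmf P)" and R: "finite (set_pmf R)"
  shows "measure_pmf.expectation (pair_pmf P R) H =
    measure_pmf.expectation P (\<lambda>y. measure_pmf.expectation R (\<lambda>f. H (y, f)))"
proof -
  have inner: "measure_pmf.expectation R (\<lambda>f. H (y, f)) = (\<Sum>f\<in>set_pmf R. pmf R f *\<^sub>R H (y, f))" for y
    by (rule integral_measure_pmf[OF R]) simp
  have "measure_pmf.expectation (pair_pmf P R) H =
      (\<Sum>z\<in>set_pmf P \<times> set_pmf R. pmf (pair_pmf P R) z *\<^sub>R H z)"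
    by (rule integral_measure_pmf) (use P R in auto)
  also have "\<dots> = (\<Sum>y\<in>set_pmf P. pmf P y *\<^sub>R (\<Sum>f\<in>set_pmf R. pmf R f *\<^sub>R H (y, f)))"
    by (subst sum.cartesian_product') (simp add: pmf_pair scaleR_sum_right)
  also have "\<dots> = measure_pmf.expectation P (\<lambda>y. measure_pmf.expectation R (\<lambda>f. H (y, f)))"
    unfolding inner by (rule integral_measure_pmf[OF P, symmetric]) simp
  finally show ?thesis .
qed

locale iid_coordinates =
  fixes E :: "'e set" and d :: 'b and P :: "'b pmf"
  assumes finite_index: "finite E" and finite_support: "finite (set_pmf P)"
begin

abbreviation Om :: "('e \<Rightarrow> 'b) pmf" where "Om \<equiv> Pi_pmf E d (\<lambda>_. P)"

abbreviation expec :: "(('e \<Rightarrow> 'b) \<Rightarrow> 'c::{banach,second_countable_topology}) \<Rightarrow> 'c" where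
  "expec F \<equiv> measure_pmf.expectation Om F"

lemma finite_set_Om: "finite (set_pmf Om)"
  using finite_index finite_support by (simp add: set_Pi_pmf finite_PiE_dflt)

lemma integrable_Om [simp]:
  "integrable (measure_pmf Om) (F :: _ \<Rightarrow> 'c::{banach,second_countable_topology})"
  by (rule integrable_measure_pmf_finite[OF finite_set_Om])

text \<open>Independence of \<open>G\<close> from coordinate \<open>e\<close> is expressed as
  invariance under \<open>A(e := y)\<close>. Splitting off this coordinate turns \<open>Om\<close>
  into a product measure, on which the expectation factors. \<open>G\<close> is vector-valued
  because it will contain complex exponentials.\<close>

lemma expec_coordinate:
  fixes G :: "('e \<Rightarrow> 'b) \<Rightarrow> 'c::{banach,second_countable_topology}"
  assumes e: "e \<in> E" and G: "\<And>A y. G (A(e := y)) = G A"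
  shows "expec (\<lambda>A. u (A e) *\<^sub>R G A) = measure_pmf.expectation P u *\<^sub>R expec G"
proof -
  let ?R = "Pi_pmf (E - {e}) d (\<lambda>_. P)"
  have E: "E = insert e (E - {e})"
    using e by auto
  have Om: "Om = map_pmf (\<lambda>(y, f). f(e := y)) (pair_pmf P ?R)"
    by (subst E, subst Pi_pmf_insert) (use finite_index in auto)
  have finR: "finite (set_pmf ?R)"
    using finite_index finite_support by (simp add: set_Pi_pmf finite_PiE_dflt)
  note pair = expectation_pair_pmf_finite[OF finite_support finR]
  have GR: "expec G = measure_pmf.expectation ?R G"
    unfolding Om integral_map_pmf by (subst pair) (simp add: G)
  have "expec (\<lambda>A. u (A e) *\<^sub>R G A) =
      measure_pmf.expectation P (\<lambda>y. u y *\<^sub>R measure_pmf.expectation ?R G)"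
    unfolding Om integral_map_pmf by (subst pair) (simp add: G)
  also have "\<dots> = measure_pmf.expectation P u *\<^sub>R measure_pmf.expectation ?R G"
    by (rule integral_scaleR_left) (rule integrable_measure_pmf_finite[OF finite_support])
  finally show ?thesis
    using GR by simp
qed

lemma expec_coordinate_real:
  assumes "e \<in> E" and "\<And>A y. G (A(e := y)) = G A"
  shows "expec (\<lambda>A. u (A e) * (G A :: real)) = measure_pmf.expectation P u * expec G"
  using expec_coordinate[of e G u] assms by simp

lemma expec_linear:
  fixes b :: "'e \<Rightarrow> real" and u :: "'b \<Rightarrow> real"
  assumes "F \<subseteq> E" and "measure_pmf.expectation P u = 0"
  shows "expec (\<lambda>A. \<Sum>f\<in>F. b f * u (A f)) = 0"
proof -
  have "expec (\<lambda>A. b f * u (A f)) = 0" if "f \<in> F" for f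
    using expec_coordinate_real[of f "\<lambda>_. b f" u] assms that by (auto simp: mult.commute)
  then have "(\<Sum>f\<in>F. expec (\<lambda>A. b f * u (A f))) = 0"
    by (rule sum.neutral[OF ballI])
  moreover have "expec (\<lambda>A. \<Sum>f\<in>F. b f * u (A f)) = (\<Sum>f\<in>F. expec (\<lambda>A. b f * u (A f)))"
    by (rule Bochner_Integration.integral_sum) (rule integrable_Om)
  ultimately show ?thesis
    by (rule trans[rotated])
qed

lemma expec_linear_square:
  fixes b :: "'e \<Rightarrow> real" and u :: "'b \<Rightarrow> real"
  assumes F: "F \<subseteq> E" and u: "measure_pmf.expectation P u = 0"
  shows "expec (\<lambda>A. (\<Sum>f\<in>F. b f * u (A f))\<^sup>2) =
    measure_pmf.expectation P (\<lambda>y. (u y)\<^sup>2) * (\<Sum>f\<in>F. (b f)\<^sup>2)"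
  using finite_subset[OF F finite_index] F
proof (induction F rule: finite_induct)
  case (insert e F)
  let ?L = "\<lambda>A. \<Sum>f\<in>F. b f * u (A f)"
  have inv: "?L (A(e := y)) = ?L A" for A y
    using insert by (intro sum.cong) auto
  have 1: "expec (\<lambda>A. (u (A e))\<^sup>2 * (b e)\<^sup>2) = measure_pmf.expectation P (\<lambda>y. (u y)\<^sup>2) * (b e)\<^sup>2"
    using expec_coordinate_real[of e "\<lambda>_. (b e)\<^sup>2" "\<lambda>y. (u y)\<^sup>2"] insert by simp
  have 2: "expec (\<lambda>A. u (A e) * (2 * b e * ?L A)) = 0"
    using expec_coordinate_real[of e "\<lambda>A. 2 * b e * ?L A" u] insert u inv by simp
  have "expec (\<lambda>A. (\<Sum>f\<in>insert e F. b f * u (A f))\<^sup>2) =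
      expec (\<lambda>A. (?L A)\<^sup>2 + (u (A e))\<^sup>2 * (b e)\<^sup>2 + u (A e) * (2 * b e * ?L A))"
    using insert by (intro arg_cong[where f = expec] ext) (simp add: power2_eq_square algebra_simps)
  also have "\<dots> = expec (\<lambda>A. (?L A)\<^sup>2) + expec (\<lambda>A. (u (A e))\<^sup>2 * (b e)\<^sup>2) + expec (\<lambda>A. u (A e) * (2 * b e * ?L A))"
    by simp
  also have "\<dots> = measure_pmf.expectation P (\<lambda>y. (u y)\<^sup>2) * (\<Sum>f\<in>F. (b f)\<^sup>2)
      + measure_pmf.expectation P (\<lambda>y. (u y)\<^sup>2) * (b e)\<^sup>2 + 0"
    unfolding 1 2 by (subst insert.IH) (use insert.prems in auto)
  finally show ?case
    using insert.hyps by (simp add: algebra_simps)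
qed simp

text \<open>Induction on \<open>F\<close>, expanding the fourth power in the new coordinate. The
  terms with odd powers of it vanish, the cubic one because the remaining linear form has mean 0.
  The Gaussian term \<open>3 (v \<Sum>b^2)^2\<close> absorbs the mixed term with factor 6, while
  \<bar>u\<bar> \<le> 1 bounds the fourth moment of \<open>u\<close> by \<open>v\<close> and
  produces the second summand, which is the one that matters for small \<open>v\<close>.\<close>

lemma expec_linear_fourth:
  fixes v :: real and b :: "'e \<Rightarrow> real" and u :: "'b \<Rightarrow> real"
  assumes F: "F \<subseteq> E" and u: "measure_pmf.expectation P u = 0"
    and v: "measure_pmf.expectation P (\<lambda>y. (u y)\<^sup>2) = v" and bound: "\<And>y. \<bar>u y\<bar> \<le> 1"
  shows "expec (\<lambda>A. (\<Sum>f\<in>F. b f * u (A f)) ^ 4) \<le>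
    3 * (v * (\<Sum>f\<in>F. (b f)\<^sup>2))\<^sup>2 + v * (\<Sum>f\<in>F. b f ^ 4)"
  using finite_subset[OF F finite_index] F
proof (induction F rule: finite_induct)
  case (insert e F)
  let ?L = "\<lambda>A. \<Sum>f\<in>F. b f * u (A f)"
  have inv: "?L (A(e := y)) = ?L A" for A y
    using insert by (intro sum.cong) auto
  have u4: "measure_pmf.expectation P (\<lambda>y. u y ^ 4) \<le> v"
    unfolding v[symmetric]
  proof (intro integral_mono integrable_measure_pmf_finite finite_support)
    fix y
    have "(u y)\<^sup>2 * (u y)\<^sup>2 \<le> (u y)\<^sup>2 * 1"
      using bound[of y] by (intro mult_left_mono) (auto simp: abs_square_le_1)
    then show "u y ^ 4 \<le> (u y)\<^sup>2"
      by (simp add: power4_eq_xxxx power2_eq_square mult.assoc)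
  qed
  have 1: "expec (\<lambda>A. u (A e) * (4 * b e * (?L A) ^ 3)) = 0"
    using expec_coordinate_real[of e "\<lambda>A. 4 * b e * (?L A) ^ 3" u] insert u inv by simp
  have 2: "expec (\<lambda>A. (u (A e))\<^sup>2 * (6 * (b e)\<^sup>2 * (?L A)\<^sup>2)) = 6 * (b e)\<^sup>2 * v * (v * (\<Sum>f\<in>F. (b f)\<^sup>2))"
    using expec_coordinate_real[of e "\<lambda>A. 6 * (b e)\<^sup>2 * (?L A)\<^sup>2" "\<lambda>y. (u y)\<^sup>2"] insert u inv v
      expec_linear_square[of F u b] by simp
  have 3: "expec (\<lambda>A. u (A e) ^ 3 * (4 * b e ^ 3 * ?L A)) = 0"
    using expec_coordinate_real[of e "\<lambda>A. 4 * b e ^ 3 * ?L A" "\<lambda>y. u y ^ 3"] insert u inv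
      expec_linear[of F u b] by simp
  have "expec (\<lambda>A. u (A e) ^ 4 * b e ^ 4) = measure_pmf.expectation P (\<lambda>y. u y ^ 4) * b e ^ 4"
    using expec_coordinate_real[of e "\<lambda>_. b e ^ 4" "\<lambda>y. u y ^ 4"] insert by simp
  also have "\<dots> \<le> v * b e ^ 4"
    by (intro mult_right_mono u4) simp
  finally have 4: "expec (\<lambda>A. u (A e) ^ 4 * b e ^ 4) \<le> v * b e ^ 4" .
  have "expec (\<lambda>A. (\<Sum>f\<in>insert e F. b f * u (A f)) ^ 4) =
      expec (\<lambda>A. (?L A) ^ 4 + u (A e) * (4 * b e * (?L A) ^ 3)
        + (u (A e))\<^sup>2 * (6 * (b e)\<^sup>2 * (?L A)\<^sup>2) + u (A e) ^ 3 * (4 * b e ^ 3 * ?L A)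
        + u (A e) ^ 4 * b e ^ 4)"
    using insert by (intro arg_cong[where f = expec] ext) (simp, algebra)
  also have "\<dots> = expec (\<lambda>A. (?L A) ^ 4) + expec (\<lambda>A. u (A e) * (4 * b e * (?L A) ^ 3))
        + expec (\<lambda>A. (u (A e))\<^sup>2 * (6 * (b e)\<^sup>2 * (?L A)\<^sup>2)) + expec (\<lambda>A. u (A e) ^ 3 * (4 * b e ^ 3 * ?L A))
        + expec (\<lambda>A. u (A e) ^ 4 * b e ^ 4)"
    by simp
  also have "\<dots> \<le> 3 * (v * (\<Sum>f\<in>F. (b f)\<^sup>2))\<^sup>2 + v * (\<Sum>f\<in>F. b f ^ 4)
      + 6 * (b e)\<^sup>2 * v * (v * (\<Sum>f\<in>F. (b f)\<^sup>2)) + v * b e ^ 4"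
    using insert 1 2 3 4 by simp
  \<comment> \<open>The two sides differ by exactly \<open>3 (v (b e)^2)^2\<close>.\<close>
  also have "\<dots> \<le> 3 * (v * (\<Sum>f\<in>insert e F. (b f)\<^sup>2))\<^sup>2 + v * (\<Sum>f\<in>insert e F. b f ^ 4)"
  proof -
    have "3 * (v * (x + y))\<^sup>2 + v * (z + w) - (3 * (v * y)\<^sup>2 + v * w + 6 * x * v * (v * y) + v * z)
        = 3 * (v * x)\<^sup>2" for x y z w
      by algebra
    from this[of "(b e)\<^sup>2" "\<Sum>f\<in>F. (b f)\<^sup>2" "b e ^ 4" "\<Sum>f\<in>F. b f ^ 4"]
    moreover have "0 \<le> 3 * (v * (b e)\<^sup>2)\<^sup>2"
      by simp
    ultimately show ?thesis
      unfolding sum.insert[OF insert.hyps] by linarith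
  qed
  finally show ?case .
qed simp

text \<open>A new coordinate \<open>e\<close> adds \<open>2 u (A e)\<close> times a linear form in
  the others; a zero diagonal means that no square of \<open>u (A e)\<close> appears in the form.
  Products over distinct unordered pairs are thus orthogonal, and the factor 2 arises because the
  double sum runs over ordered pairs.\<close>

lemma expec_quadratic_square:
  fixes b :: "'e \<Rightarrow> 'e \<Rightarrow> real" and u :: "'b \<Rightarrow> real"
  assumes F: "F \<subseteq> E" and u: "measure_pmf.expectation P u = 0"
    and sym: "\<And>e f. b e f = b f e" and diag: "\<And>e. b e e = (0::real)"
  shows "expec (\<lambda>A. (\<Sum>e\<in>F. \<Sum>f\<in>F. b e f * u (A e) * u (A f))\<^sup>2) =
    2 * (measure_pmf.expectation P (\<lambda>y. (u y)\<^sup>2))\<^sup>2 * (\<Sum>e\<in>F. \<Sum>f\<in>F. (b e f)\<^sup>2)"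
  using finite_subset[OF F finite_index] F
proof (induction F rule: finite_induct)
  case (insert e F)
  let ?v = "measure_pmf.expectation P (\<lambda>y. (u y)\<^sup>2)"
  let ?Q = "\<lambda>A. \<Sum>g\<in>F. \<Sum>f\<in>F. b g f * u (A g) * u (A f)"
  let ?L = "\<lambda>A. \<Sum>f\<in>F. b e f * u (A f)"
  have inv: "?L (A(e := y)) = ?L A" "?Q (A(e := y)) = ?Q A" for A y
    using insert by (intro sum.cong; auto)+
  have 1: "expec (\<lambda>A. (u (A e))\<^sup>2 * (4 * (?L A)\<^sup>2)) = 4 * ?v * (?v * (\<Sum>f\<in>F. (b e f)\<^sup>2))"
    using expec_coordinate_real[of e "\<lambda>A. 4 * (?L A)\<^sup>2" "\<lambda>y. (u y)\<^sup>2"] insert u inv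
      expec_linear_square[of F u "b e"] by simp
  have 2: "expec (\<lambda>A. u (A e) * (4 * ?L A * ?Q A)) = 0"
    using expec_coordinate_real[of e "\<lambda>A. 4 * ?L A * ?Q A" u] insert u inv by simp
  have expand: "(\<Sum>g\<in>insert e F. \<Sum>f\<in>insert e F. b g f * u (A g) * u (A f)) = ?Q A + 2 * u (A e) * ?L A" for A
  proof -
    have "(\<Sum>g\<in>F. b g e * u (A g) * u (A e)) = u (A e) * ?L A"
      by (simp add: sum_distrib_left sym[of _ e] mult_ac)
    moreover have "(\<Sum>f\<in>F. b e f * u (A e) * u (A f)) = u (A e) * ?L A"
      by (simp add: sum_distrib_left mult_ac)
    ultimately show ?thesis
      using insert diag by (simp add: sum.distrib)
  qed
  have "expec (\<lambda>A. (\<Sum>g\<in>insert e F. \<Sum>f\<in>insert e F. b g f * u (A g) * u (A f))\<^sup>2) =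
      expec (\<lambda>A. (?Q A)\<^sup>2 + (u (A e))\<^sup>2 * (4 * (?L A)\<^sup>2) + u (A e) * (4 * ?L A * ?Q A))"
    unfolding expand by (intro arg_cong[where f = expec] ext) algebra
  also have "\<dots> = expec (\<lambda>A. (?Q A)\<^sup>2) + expec (\<lambda>A. (u (A e))\<^sup>2 * (4 * (?L A)\<^sup>2)) + expec (\<lambda>A. u (A e) * (4 * ?L A * ?Q A))"
    by simp
  also have "\<dots> = 2 * ?v\<^sup>2 * (\<Sum>g\<in>F. \<Sum>f\<in>F. (b g f)\<^sup>2) + 4 * ?v * (?v * (\<Sum>f\<in>F. (b e f)\<^sup>2)) + 0"
    unfolding 1 2 by (subst insert.IH) (use insert.prems in auto)
  also have "\<dots> = 2 * ?v\<^sup>2 * (\<Sum>g\<in>insert e F. \<Sum>f\<in>insert e F. (b g f)\<^sup>2)"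
    using insert by (simp add: sum.distrib diag sym[of _ e]) (simp add: power2_eq_square algebra_simps)
  finally show ?case .
qed simp

lemma expec_Cauchy_Schwarz:
  fixes F G :: "('e \<Rightarrow> 'b) \<Rightarrow> real"
  shows "expec (\<lambda>A. F A * G A) \<le> sqrt (expec (\<lambda>A. (F A)\<^sup>2) * expec (\<lambda>A. (G A)\<^sup>2))"
proof -
  have sums: "expec H = (\<Sum>A\<in>set_pmf Om. pmf Om A * H A)" for H :: "_ \<Rightarrow> real"
    by (subst integral_measure_pmf[OF finite_set_Om]) auto
  let ?s = "\<lambda>A. sqrt (pmf Om A)"
  have "(\<Sum>A\<in>set_pmf Om. (?s A * F A) * (?s A * G A))\<^sup>2 \<le>
      (\<Sum>A\<in>set_pmf Om. (?s A * F A)\<^sup>2) * (\<Sum>A\<in>set_pmf Om. (?s A * G A)\<^sup>2)"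
    by (rule Cauchy_Schwarz_ineq_sum)
  moreover have "(?s A * F A) * (?s A * G A) = pmf Om A * (F A * G A)" for A
  proof -
    have "?s A * ?s A = pmf Om A"
      by simp
    then show ?thesis
      by (metis mult.assoc mult.left_commute)
  qed
  ultimately have "(expec (\<lambda>A. F A * G A))\<^sup>2 \<le> expec (\<lambda>A. (F A)\<^sup>2) * expec (\<lambda>A. (G A)\<^sup>2)"
    unfolding sums by (simp add: power_mult_distrib)
  then show ?thesis
    using real_le_rsqrt by blast
qed

end

section \<open>Gaussian approximation of quadratic forms\<close>

lemma norm_iexp_minus_1: "cmod (iexp y - 1) \<le> \<bar>y\<bar>"
  using iexp_approx1[of y 0] by simp

lemma norm_iexp_minus_linear: "cmod (iexp y - (1 + \<i> * y)) \<le> y\<^sup>2 / 2"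
  using iexp_approx1[of y 1] by (simp add: power2_eq_square)

lemma norm_iexp_add_minus_linear: "cmod (iexp (z + y) - iexp z * (1 + \<i> * y)) \<le> y\<^sup>2 / 2"
proof -
  have "iexp (z + y) - iexp z * (1 + \<i> * y) = iexp z * (iexp y - (1 + \<i> * y))"
    by (simp add: ring_distribs flip: exp_add)
  then show ?thesis
    using norm_iexp_minus_linear[of y] by (simp only: norm_mult norm_exp_i_times mult_1)
qed

lemma norm_iexp_minus_iexp_add: "cmod (iexp z - iexp (z + y)) \<le> \<bar>y\<bar>"
proof -
  have "iexp (z + y) - iexp z = iexp z * (iexp y - 1)"
    by (simp add: ring_distribs flip: exp_add)
  then show ?thesis
    using norm_iexp_minus_1[of y] by (subst norm_minus_commute) (simp only: norm_mult norm_exp_i_times mult_1)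
qed

text \<open>The zero diagonal makes each row of the form independent of its own coordinate. The
  uniform bound on \<open>x\<close> is what lets a surplus power of \<bar>x\<bar> be dropped while a
  factor \<open>v\<close> is kept.\<close>

locale quadratic_form = iid_coordinates E d P
  for E :: "'e set" and d :: 'b and P :: "'b pmf" +
  fixes x :: "'b \<Rightarrow> real" and v :: real and a :: "'e \<Rightarrow> 'e \<Rightarrow> real"
  assumes mean: "measure_pmf.expectation P x = 0"
    and var: "measure_pmf.expectation P (\<lambda>y. (x y)\<^sup>2) = v"
    and bound: "\<bar>x y\<bar> \<le> 1"
    and sym: "a e f = a f e" and diag: "a e e = 0"
begin

definition row_form :: "'e \<Rightarrow> ('e \<Rightarrow> 'b) \<Rightarrow> real" where
  "row_form e A = (\<Sum>f\<in>E. a e f * x (A f))"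

definition quad_form :: "('e \<Rightarrow> 'b) \<Rightarrow> real" where
  "quad_form A = (\<Sum>e\<in>E. \<Sum>f\<in>E. a e f * x (A e) * x (A f)) / 2"

lemma quad_form_eq: "quad_form A = (\<Sum>e\<in>E. x (A e) * row_form e A) / 2"
  by (simp add: quad_form_def row_form_def sum_distrib_left mult_ac)

lemma row_form_upd: "row_form e (A(e := y)) = row_form e A"
  unfolding row_form_def by (intro sum.cong) (auto simp: diag)

lemma v_nonneg: "v \<ge> 0"
  unfolding var[symmetric] by simp

text \<open>Deleting \<open>x (A e) * row_form e A\<close> leaves precisely the terms over pairs
  that avoid \<open>e\<close>. The coefficient is 1 because the pairs \<open>(e, f)\<close> and
  \<open>(f, e)\<close> both contribute and cancel the division by 2 in
  \<open>quad_form\<close>.\<close>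

lemma quad_form_remainder_upd:
  assumes e: "e \<in> E"
  shows "quad_form (A(e := y)) - x y * row_form e A = quad_form A - x (A e) * row_form e A"
proof -
  define R where "R A = (\<Sum>g\<in>E - {e}. \<Sum>f\<in>E - {e}. a g f * x (A g) * x (A f)) / 2" for A
  have quad_form: "quad_form A = R A + x (A e) * row_form e A" for A
  proof -
    have s: "sum h E = h e + sum h (E - {e})" for h :: "'e \<Rightarrow> real"
      using sum.remove[OF finite_index e, of h] .
    have "(\<Sum>g\<in>E - {e}. a g e * x (A g) * x (A e)) = x (A e) * (\<Sum>g\<in>E - {e}. a e g * x (A g))"
      by (simp add: sum_distrib_left sym[of _ e] mult_ac)
    moreover have "(\<Sum>g\<in>E - {e}. a e g * x (A e) * x (A g)) = x (A e) * (\<Sum>g\<in>E - {e}. a e g * x (A g))"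
      by (simp add: sum_distrib_left mult_ac)
    ultimately show ?thesis
      unfolding quad_form_def row_form_def R_def s by (simp add: sum.distrib diag)
  qed
  have "R (A(e := y)) = R A"
    unfolding R_def by (intro arg_cong2[where f = "(/)"] sum.cong) auto
  then show ?thesis
    by (simp add: quad_form row_form_upd)
qed

text \<open>
  The form with coordinate \<open>e\<close> deleted is independent of that coordinate, so Taylor expansion of the
  exponential around it acts as Gaussian integration by parts in \<open>e\<close>.
\<close>

lemma stein_edge:
  assumes e: "e \<in> E"
  shows "cmod (expec (\<lambda>A. x (A e) * row_form e A * iexp (t * quad_form A)) - \<i> * t * v * expec (\<lambda>A. (row_form e A)\<^sup>2 * iexp (t * quad_form A)))
    \<le> 3 / 2 * t\<^sup>2 * v * expec (\<lambda>A. \<bar>row_form e A\<bar> ^ 3)"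
proof -
  define Z where "Z A = quad_form A - x (A e) * row_form e A" for A
  have Z_upd: "Z (A(e := y)) = Z A" for A y
    using quad_form_remainder_upd[OF e] by (simp add: Z_def row_form_upd)
  \<comment> \<open>The difference is split by the kind of error. \<open>T1\<close> is the
    zeroth-order Taylor term and vanishes by \<open>mean\<close>; \<open>T2\<close> replaces the
    square of \<open>x (A e)\<close> by \<open>v\<close> and vanishes by \<open>var\<close>;
    \<open>T3\<close> is the Taylor remainder; \<open>T4\<close> puts the deleted coordinate back
    into the exponential of the main term.\<close>
  define T1 :: "_ \<Rightarrow> complex" where "T1 A = x (A e) *\<^sub>R (row_form e A * iexp (t * Z A))" for A
  define T2 :: "_ \<Rightarrow> complex" where "T2 A = ((x (A e))\<^sup>2 - v) *\<^sub>R (\<i> * t * (row_form e A)\<^sup>2 * iexp (t * Z A))" for A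
  define T3 :: "_ \<Rightarrow> complex" where "T3 A = x (A e) * row_form e A * (iexp (t * quad_form A) - iexp (t * Z A) * (1 + \<i> * (t * (x (A e) * row_form e A))))" for A
  define T4 :: "_ \<Rightarrow> complex" where "T4 A = \<i> * t * v * (row_form e A)\<^sup>2 * (iexp (t * Z A) - iexp (t * quad_form A))" for A
  have e1: "expec T1 = 0"
    unfolding T1_def using expec_coordinate[of e "\<lambda>A. complex_of_real (row_form e A) * iexp (t * Z A)" x, OF e]
    by (simp add: row_form_upd Z_upd mean)
  have "measure_pmf.expectation P (\<lambda>y. (x y)\<^sup>2 - v) = 0"
    using var by (subst Bochner_Integration.integral_diff) (auto intro: integrable_measure_pmf_finite finite_support)
  then have e2: "expec T2 = 0"
    unfolding T2_def using expec_coordinate[of e "\<lambda>A. \<i> * t * (row_form e A)\<^sup>2 * iexp (t * Z A)" "\<lambda>y. (x y)\<^sup>2 - v", OF e]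
    by (simp add: row_form_upd Z_upd)
  have quad_form: "t * quad_form A = t * Z A + t * (x (A e) * row_form e A)" for A
    by (simp add: Z_def algebra_simps)
  \<comment> \<open>Of the three powers of \<bar>x\<bar> only one is discarded by
    \<open>bound\<close>. The remaining square is integrated at the end and supplies the factor
    \<open>v\<close>, so that \<open>T3\<close> contributes 1/2 and \<open>T4\<close> contributes 1
    to the constant 3/2.\<close>
  have n3: "cmod (T3 A) \<le> t\<^sup>2 / 2 * ((x (A e))\<^sup>2 * \<bar>row_form e A\<bar> ^ 3)" for A
  proof -
    have "cmod (T3 A) = \<bar>x (A e) * row_form e A\<bar> * cmod (iexp (t * Z A + t * (x (A e) * row_form e A))
        - iexp (t * Z A) * (1 + \<i> * (t * (x (A e) * row_form e A))))"
      unfolding T3_def quad_form by (simp only: norm_mult norm_of_real abs_mult of_real_mult)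
    also have "\<dots> \<le> \<bar>x (A e) * row_form e A\<bar> * ((t * (x (A e) * row_form e A))\<^sup>2 / 2)"
      using norm_iexp_add_minus_linear[of "t * Z A" "t * (x (A e) * row_form e A)"]
      by (intro mult_left_mono) simp_all
    also have "\<dots> = t\<^sup>2 / 2 * ((x (A e))\<^sup>2 * \<bar>row_form e A\<bar> ^ 3) * \<bar>x (A e)\<bar>"
      by (simp add: abs_mult power_mult_distrib power3_eq_cube power2_eq_square mult_ac)
    also have "\<dots> \<le> t\<^sup>2 / 2 * ((x (A e))\<^sup>2 * \<bar>row_form e A\<bar> ^ 3)"
      using mult_left_mono[OF bound[of "A e"], of "t\<^sup>2 / 2 * ((x (A e))\<^sup>2 * \<bar>row_form e A\<bar> ^ 3)"] by simp
    finally show ?thesis .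
  qed
  have n4: "cmod (T4 A) \<le> t\<^sup>2 * v * \<bar>row_form e A\<bar> ^ 3" for A
  proof -
    have "cmod (T4 A) = \<bar>t\<bar> * v * (row_form e A)\<^sup>2 * cmod (iexp (t * Z A) - iexp (t * Z A + t * (x (A e) * row_form e A)))"
      unfolding T4_def quad_form using v_nonneg
      by (simp only: norm_mult norm_power norm_of_real norm_ii mult_1 abs_of_nonneg abs_power2)
    also have "\<dots> \<le> \<bar>t\<bar> * v * (row_form e A)\<^sup>2 * \<bar>t * (x (A e) * row_form e A)\<bar>"
      using norm_iexp_minus_iexp_add[of "t * Z A" "t * (x (A e) * row_form e A)"] v_nonneg
      by (intro mult_left_mono) simp_all
    also have "\<dots> = t\<^sup>2 * v * \<bar>row_form e A\<bar> ^ 3 * \<bar>x (A e)\<bar>"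
    proof -
      have "\<bar>t\<bar> * v * (\<bar>l\<bar> * \<bar>l\<bar>) * (\<bar>t\<bar> * (\<bar>y\<bar> * \<bar>l\<bar>)) = (\<bar>t\<bar> * \<bar>t\<bar>) * v * (\<bar>l\<bar> * \<bar>l\<bar> * \<bar>l\<bar>) * \<bar>y\<bar>" for l y :: real
        by (simp only: mult_ac)
      from this[of "row_form e A" "x (A e)"] show ?thesis
        by (simp add: abs_mult power3_eq_cube power2_eq_square)
    qed
    also have "\<dots> \<le> t\<^sup>2 * v * \<bar>row_form e A\<bar> ^ 3"
      using mult_left_mono[OF bound[of "A e"], of "t\<^sup>2 * v * \<bar>row_form e A\<bar> ^ 3"] v_nonneg by simp
    finally show ?thesis .
  qed
  have split: "x (A e) * row_form e A * iexp (t * quad_form A) - \<i> * t * v * ((row_form e A)\<^sup>2 * iexp (t * quad_form A)) = T1 A + T2 A + T3 A + T4 A" for A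
    by (simp only: T1_def T2_def T3_def T4_def scaleR_conv_of_real of_real_diff of_real_mult of_real_power) algebra
  have "expec (\<lambda>A. x (A e) * row_form e A * iexp (t * quad_form A)) - \<i> * t * v * expec (\<lambda>A. (row_form e A)\<^sup>2 * iexp (t * quad_form A))
      = expec (\<lambda>A. x (A e) * row_form e A * iexp (t * quad_form A) - \<i> * t * v * ((row_form e A)\<^sup>2 * iexp (t * quad_form A)))"
    by (subst Bochner_Integration.integral_diff) auto
  also have "\<dots> = expec T1 + expec T2 + expec T3 + expec T4"
    unfolding split by simp
  also have "\<dots> = expec T3 + expec T4"
    using e1 e2 by simp
  also have "cmod \<dots> \<le> cmod (expec T3) + cmod (expec T4)"
    by (rule norm_triangle_ineq)
  also have "\<dots> \<le> expec (\<lambda>A. cmod (T3 A)) + expec (\<lambda>A. cmod (T4 A))"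
    by (intro add_mono integral_norm_bound)
  also have "\<dots> \<le> expec (\<lambda>A. t\<^sup>2 / 2 * ((x (A e))\<^sup>2 * \<bar>row_form e A\<bar> ^ 3)) + expec (\<lambda>A. t\<^sup>2 * v * \<bar>row_form e A\<bar> ^ 3)"
    by (intro add_mono integral_mono n3 n4) auto
  also have "\<dots> = t\<^sup>2 / 2 * expec (\<lambda>A. (x (A e))\<^sup>2 * \<bar>row_form e A\<bar> ^ 3) + t\<^sup>2 * v * expec (\<lambda>A. \<bar>row_form e A\<bar> ^ 3)"
    by simp
  also have "expec (\<lambda>A. (x (A e))\<^sup>2 * \<bar>row_form e A\<bar> ^ 3) = v * expec (\<lambda>A. \<bar>row_form e A\<bar> ^ 3)"
    using expec_coordinate_real[of e "\<lambda>A. \<bar>row_form e A\<bar> ^ 3" "\<lambda>y. (x y)\<^sup>2", OF e] by (simp add: row_form_upd var)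
  finally show ?thesis
    by (simp add: algebra_simps)
qed

definition char_fun :: "real \<Rightarrow> complex" where
  "char_fun t = expec (\<lambda>A. iexp (t * quad_form A))"

text \<open>The law has finite support, so the expectation is a finite sum and can be differentiated
  term by term.\<close>

lemma char_fun_deriv: "(char_fun has_vector_derivative expec (\<lambda>A. \<i> * quad_form A * iexp (t * quad_form A))) (at t within S)"
proof -
  have sums: "expec H = (\<Sum>A\<in>set_pmf Om. pmf Om A *\<^sub>R H A)" for H :: "_ \<Rightarrow> complex"
    by (rule integral_measure_pmf[OF finite_set_Om]) simp
  have "((\<lambda>t. iexp (t * w)) has_vector_derivative \<i> * w * iexp (t * w)) (at t within S)" for w
  proof -
    have "((\<lambda>z. exp (\<i> * (z * w))) has_field_derivative exp (\<i> * (t * w)) * (\<i> * w)) (at (complex_of_real t))"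
      by (auto intro!: derivative_eq_intros)
    from has_vector_derivative_real_field[OF this]
    show ?thesis
      by (simp add: mult_ac)
  qed
  then show ?thesis
    unfolding char_fun_def sums
    by (intro has_vector_derivative_sum has_vector_derivative_scaleR[where f' = 0, simplified]) auto
qed

text \<open>Under the normalisation used in \<open>row_defect_bound\<close> the random variable
  \<open>v * (\<Sum>e\<in>E. (row_form e A)\<^sup>2) / 2\<close> has mean 1, and this is its
  standard deviation: the error made when the random Stein coefficient is replaced by that of the
  standard Gaussian.\<close>

definition row_defect :: real where
  "row_defect = sqrt (expec (\<lambda>A. (v * (\<Sum>e\<in>E. (row_form e A)\<^sup>2) / 2 - 1)\<^sup>2))"

text \<open>The Lyapunov-type quantity that collects the Taylor errors of \<open>stein_edge\<close>
  over all coordinates.\<close>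

definition third_moment :: real where
  "third_moment = v * (\<Sum>e\<in>E. expec (\<lambda>A. \<bar>row_form e A\<bar> ^ 3))"

text \<open>Summing \<open>stein_edge\<close> over \<open>e\<close> with the factor \<i>/2 of
  \<open>quad_form_eq\<close> turns \<i> times \<i> t into the drift - t and halves the constant
  3/2. What is left besides the Taylor errors is the deviation of the random coefficient from 1,
  paired with an exponential of modulus 1.\<close>

lemma stein_ode:
  "cmod (expec (\<lambda>A. \<i> * quad_form A * iexp (t * quad_form A)) + t * char_fun t) \<le> \<bar>t\<bar> * row_defect + 3 / 4 * t\<^sup>2 * third_moment"
proof -
  let ?D = "\<lambda>e. expec (\<lambda>A. x (A e) * row_form e A * iexp (t * quad_form A)) - \<i> * t * v * expec (\<lambda>A. (row_form e A)\<^sup>2 * iexp (t * quad_form A))"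
  let ?V = "\<lambda>A. v * (\<Sum>e\<in>E. (row_form e A)\<^sup>2) / 2 - 1"
  have 1: "expec (\<lambda>A. \<i> * quad_form A * iexp (t * quad_form A)) = \<i> / 2 * (\<Sum>e\<in>E. expec (\<lambda>A. x (A e) * row_form e A * iexp (t * quad_form A)))"
  proof -
    have "expec (\<lambda>A. \<i> * quad_form A * iexp (t * quad_form A)) = expec (\<lambda>A. \<i> / 2 * (\<Sum>e\<in>E. x (A e) * row_form e A * iexp (t * quad_form A)))"
      unfolding quad_form_eq[THEN arg_cong[where f = complex_of_real]]
      by (intro arg_cong[where f = expec] ext) (simp add: quad_form_eq sum_distrib_left sum_distrib_right sum_divide_distrib mult_ac)
    also have "\<dots> = \<i> / 2 * (\<Sum>e\<in>E. expec (\<lambda>A. x (A e) * row_form e A * iexp (t * quad_form A)))"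
      by (subst integral_mult_right_zero, subst Bochner_Integration.integral_sum) auto
    finally show ?thesis .
  qed
  have 2: "expec (\<lambda>A. ?V A * iexp (t * quad_form A)) = v / 2 * (\<Sum>e\<in>E. expec (\<lambda>A. (row_form e A)\<^sup>2 * iexp (t * quad_form A))) - char_fun t"
  proof -
    have "expec (\<lambda>A. ?V A * iexp (t * quad_form A)) = expec (\<lambda>A. v / 2 * (\<Sum>e\<in>E. (row_form e A)\<^sup>2 * iexp (t * quad_form A)) - iexp (t * quad_form A))"
      by (intro arg_cong[where f = expec] ext) (simp add: sum_distrib_left sum_distrib_right sum_divide_distrib algebra_simps)
    also have "\<dots> = v / 2 * (\<Sum>e\<in>E. expec (\<lambda>A. (row_form e A)\<^sup>2 * iexp (t * quad_form A))) - char_fun t"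
      unfolding char_fun_def
      by (subst Bochner_Integration.integral_diff, simp, simp, subst integral_mult_right_zero, subst Bochner_Integration.integral_sum) auto
    finally show ?thesis .
  qed
  have 3: "cmod (expec (\<lambda>A. ?V A * iexp (t * quad_form A))) \<le> row_defect"
  proof -
    have "cmod (expec (\<lambda>A. ?V A * iexp (t * quad_form A))) \<le> expec (\<lambda>A. cmod (?V A * iexp (t * quad_form A)))"
      by (rule integral_norm_bound)
    also have "\<dots> = expec (\<lambda>A. \<bar>?V A\<bar> * 1)"
      by (simp only: norm_mult norm_exp_i_times norm_of_real)
    \<comment> \<open>Pairing with the constant 1 passes from the first absolute moment to the
      second moment, which can be computed exactly.\<close>
    also have "\<dots> \<le> sqrt (expec (\<lambda>A. \<bar>?V A\<bar>\<^sup>2) * expec (\<lambda>A. 1\<^sup>2))"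
      by (rule expec_Cauchy_Schwarz)
    also have "\<dots> = row_defect"
      by (simp add: row_defect_def)
    finally show ?thesis .
  qed
  have 4: "cmod (\<Sum>e\<in>E. ?D e) \<le> 3 / 2 * t\<^sup>2 * third_moment"
  proof -
    have "cmod (\<Sum>e\<in>E. ?D e) \<le> (\<Sum>e\<in>E. 3 / 2 * t\<^sup>2 * v * expec (\<lambda>A. \<bar>row_form e A\<bar> ^ 3))"
      by (rule sum_norm_le) (rule stein_edge)
    also have "\<dots> = 3 / 2 * t\<^sup>2 * third_moment"
      by (simp add: third_moment_def sum_distrib_left mult_ac)
    finally show ?thesis .
  qed
  have eq: "expec (\<lambda>A. \<i> * quad_form A * iexp (t * quad_form A)) + t * char_fun t
      = \<i> / 2 * (\<Sum>e\<in>E. ?D e) - t * expec (\<lambda>A. ?V A * iexp (t * quad_form A))"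
  proof -
    have D: "(\<Sum>e\<in>E. ?D e) = (\<Sum>e\<in>E. expec (\<lambda>A. x (A e) * row_form e A * iexp (t * quad_form A)))
        - \<i> * t * v * (\<Sum>e\<in>E. expec (\<lambda>A. (row_form e A)\<^sup>2 * iexp (t * quad_form A)))"
      unfolding sum_subtractf sum_distrib_left ..
    have "\<i> / 2 * y + t * s = \<i> / 2 * (y - \<i> * t * v * z) - t * (complex_of_real (v / 2) * z - s)" for y z s :: complex
    proof -
      have "\<i> / 2 * (\<i> * t * v * z) = - (t * (complex_of_real (v / 2) * z))"
        by (simp add: mult.assoc)
      then show ?thesis
        by (simp add: right_diff_distrib)
    qed
    then show ?thesis
      unfolding 1 2 D .
  qed
  have "cmod (\<i> / 2 * (\<Sum>e\<in>E. ?D e) - t * expec (\<lambda>A. ?V A * iexp (t * quad_form A)))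
      \<le> cmod (\<i> / 2 * (\<Sum>e\<in>E. ?D e)) + cmod (t * expec (\<lambda>A. ?V A * iexp (t * quad_form A)))"
    by (rule norm_triangle_ineq4)
  also have "\<dots> = cmod (\<Sum>e\<in>E. ?D e) / 2 + \<bar>t\<bar> * cmod (expec (\<lambda>A. ?V A * iexp (t * quad_form A)))"
    by (simp only: norm_mult norm_divide norm_ii norm_of_real) simp
  also have "\<dots> \<le> 3 / 4 * t\<^sup>2 * third_moment + \<bar>t\<bar> * row_defect"
    using 4 mult_left_mono[OF 3, of "\<bar>t\<bar>"] by simp
  finally show ?thesis
    unfolding eq by (simp only: add.commute)
qed

lemma row_defect_nonneg: "row_defect \<ge> 0"
  unfolding row_defect_def by (simp add: integral_nonneg)

lemma third_moment_nonneg: "third_moment \<ge> 0"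
  unfolding third_moment_def by (intro mult_nonneg_nonneg v_nonneg sum_nonneg integral_nonneg) simp

text \<open>The integrating factor \<open>exp (s\<^sup>2 / 2)\<close> turns the approximate
  differential equation into a bound on the derivative of \<open>g\<close>. Since
  \<open>g 0 = 1\<close>, the mean value inequality on the segment from 0 to \<open>t\<close> bounds
  \<open>g t - 1\<close>, and multiplication by \<open>exp (- t\<^sup>2 / 2)\<close> returns to
  \<open>char_fun\<close>. The segment is used so that negative \<open>t\<close> is covered as
  well.\<close>

lemma char_fun_bound:
  "cmod (char_fun t - complex_of_real (exp (- t\<^sup>2 / 2))) \<le> \<bar>t\<bar> * exp (t\<^sup>2 / 2) * (\<bar>t\<bar> * row_defect + 3 / 4 * t\<^sup>2 * third_moment)"
proof -
  define g where "g s = complex_of_real (exp (s\<^sup>2 / 2)) * char_fun s" for s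
  let ?g' = "\<lambda>s. complex_of_real (exp (s\<^sup>2 / 2)) * (expec (\<lambda>A. \<i> * quad_form A * iexp (s * quad_form A)) + s * char_fun s)"
  let ?S = "closed_segment 0 t"
  let ?B = "exp (t\<^sup>2 / 2) * (\<bar>t\<bar> * row_defect + 3 / 4 * t\<^sup>2 * third_moment)"
  have der: "(g has_vector_derivative ?g' s) (at s within ?S)" for s
  proof -
    have "((\<lambda>s. complex_of_real (exp (s\<^sup>2 / 2))) has_vector_derivative complex_of_real (exp (s\<^sup>2 / 2) * s)) (at s within ?S)"
      by (intro has_vector_derivative_of_real) (auto intro!: derivative_eq_intros simp: has_real_derivative_iff_has_vector_derivative[symmetric])
    note has_vector_derivative_mult[OF this char_fun_deriv[of s ?S]]
    moreover have "?g' s = complex_of_real (exp (s\<^sup>2 / 2)) * expec (\<lambda>A. \<i> * quad_form A * iexp (s * quad_form A))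
        + complex_of_real (exp (s\<^sup>2 / 2) * s) * char_fun s"
      by (simp only: of_real_mult distrib_left mult.assoc)
    ultimately show ?thesis
      unfolding g_def by simp
  qed
  have bd: "cmod (?g' s) \<le> ?B" if s: "s \<in> ?S" for s
  proof -
    have st: "\<bar>s\<bar> \<le> \<bar>t\<bar>"
      using s by (auto simp: closed_segment_eq_real_ivl split: if_splits)
    then have st2: "s\<^sup>2 \<le> t\<^sup>2"
      by (simp add: abs_le_square_iff)
    have "cmod (?g' s) = exp (s\<^sup>2 / 2) * cmod (expec (\<lambda>A. \<i> * quad_form A * iexp (s * quad_form A)) + s * char_fun s)"
      by (simp only: norm_mult norm_of_real) simp
    also have "\<dots> \<le> exp (s\<^sup>2 / 2) * (\<bar>s\<bar> * row_defect + 3 / 4 * s\<^sup>2 * third_moment)"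
      by (intro mult_left_mono stein_ode) simp
    also have "\<dots> \<le> ?B"
      using st st2 row_defect_nonneg third_moment_nonneg
      by (intro mult_mono add_mono) (auto intro!: add_nonneg_nonneg)
    finally show ?thesis .
  qed
  have "norm (g t - g 0) \<le> ?B * norm (t - 0)"
  proof (rule differentiable_bound[where f' = "\<lambda>s h. h *\<^sub>R ?g' s" and S = ?S])
    show "convex ?S" by (rule convex_closed_segment)
    show "(g has_derivative (\<lambda>h. h *\<^sub>R ?g' s)) (at s within ?S)" for s
      using der[of s] by (simp add: has_vector_derivative_def)
    show "onorm (\<lambda>h. h *\<^sub>R ?g' s) \<le> ?B" if "s \<in> ?S" for s
    proof (rule onorm_le)
      show "norm (h *\<^sub>R ?g' s) \<le> ?B * norm h" for h
        using mult_right_mono[OF bd[OF that], of "norm h"] by (simp only: norm_scaleR real_norm_def abs_ge_zero mult.commute)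
    qed
  qed auto
  moreover have "g 0 = 1"
    by (simp add: g_def char_fun_def)
  moreover have "char_fun t - complex_of_real (exp (- t\<^sup>2 / 2)) = complex_of_real (exp (- t\<^sup>2 / 2)) * (g t - 1)"
  proof -
    have "exp (- t\<^sup>2 / 2) * exp (t\<^sup>2 / 2) = (1::real)"
      by (simp flip: exp_add)
    then have "complex_of_real (exp (- t\<^sup>2 / 2)) * complex_of_real (exp (t\<^sup>2 / 2)) = 1"
      by (metis of_real_1 of_real_mult)
    then show ?thesis
      unfolding g_def by (simp only: right_diff_distrib mult.assoc[symmetric]) simp
  qed
  moreover have "cmod (complex_of_real (exp (- t\<^sup>2 / 2)) * (g t - 1)) \<le> 1 * cmod (g t - 1)"
    unfolding norm_mult by (intro mult_right_mono) auto
  ultimately show ?thesis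
    by (simp add: mult_ac)
qed

section \<open>Moment bounds for the two error terms\<close>

lemma expec_row_form_square: "expec (\<lambda>A. (row_form e A)\<^sup>2) = v * (\<Sum>f\<in>E. (a e f)\<^sup>2)"
  unfolding row_form_def using expec_linear_square[of E x "a e"] by (simp add: mean var)

text \<open>Cauchy-Schwarz is applied twice: in the probability space it bounds the third moment by
  the second and the fourth, and over the coordinates it separates their sums. The normalisation
  makes the sum of the second moments, multiplied by \<open>v\<close>, equal to 2.\<close>

lemma third_moment_bound:
  assumes norm: "v\<^sup>2 * (\<Sum>e\<in>E. \<Sum>f\<in>E. (a e f)\<^sup>2) = 2"
  shows "third_moment \<le> sqrt (2 * (v * (\<Sum>e\<in>E. 3 * (v * (\<Sum>f\<in>E. (a e f)\<^sup>2))\<^sup>2 + v * (\<Sum>f\<in>E. a e f ^ 4))))"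
proof -
  let ?x = "\<lambda>e. expec (\<lambda>A. (row_form e A)\<^sup>2)" and ?y = "\<lambda>e. expec (\<lambda>A. row_form e A ^ 4)"
  have nn: "0 \<le> ?x e" "0 \<le> ?y e" for e
    by simp_all
  have y: "?y e \<le> 3 * (v * (\<Sum>f\<in>E. (a e f)\<^sup>2))\<^sup>2 + v * (\<Sum>f\<in>E. a e f ^ 4)" for e
    unfolding row_form_def by (rule expec_linear_fourth) (use mean var bound in auto)
  have "expec (\<lambda>A. \<bar>row_form e A\<bar> ^ 3) \<le> sqrt (?x e) * sqrt (?y e)" for e
  proof -
    have "expec (\<lambda>A. \<bar>row_form e A\<bar> ^ 3) = expec (\<lambda>A. \<bar>row_form e A\<bar> * (row_form e A)\<^sup>2)"
      by (intro arg_cong[where f = expec] ext) (simp add: power3_eq_cube power2_eq_square mult.assoc)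
    also have "\<dots> \<le> sqrt (expec (\<lambda>A. \<bar>row_form e A\<bar>\<^sup>2) * expec (\<lambda>A. ((row_form e A)\<^sup>2)\<^sup>2))"
      by (rule expec_Cauchy_Schwarz)
    finally show ?thesis
      by (simp add: real_sqrt_mult flip: power_mult)
  qed
  then have "third_moment \<le> v * (\<Sum>e\<in>E. sqrt (?x e) * sqrt (?y e))"
    unfolding third_moment_def by (intro mult_left_mono sum_mono v_nonneg)
  also have "\<dots> \<le> v * sqrt ((\<Sum>e\<in>E. ?x e) * (\<Sum>e\<in>E. ?y e))"
  proof (intro mult_left_mono v_nonneg real_le_rsqrt)
    show "(\<Sum>e\<in>E. sqrt (?x e) * sqrt (?y e))\<^sup>2 \<le> (\<Sum>e\<in>E. ?x e) * (\<Sum>e\<in>E. ?y e)"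
      using Cauchy_Schwarz_ineq_sum[of "\<lambda>e. sqrt (?x e)" "\<lambda>e. sqrt (?y e)" E] nn by simp
  qed
  also have "\<dots> = sqrt ((v * (\<Sum>e\<in>E. ?x e)) * (v * (\<Sum>e\<in>E. ?y e)))"
    using v_nonneg by (simp add: real_sqrt_mult)
  also have "v * (\<Sum>e\<in>E. ?x e) = 2"
    unfolding norm[symmetric] expec_row_form_square by (simp add: sum_distrib_left power2_eq_square[of v] mult_ac)
  also have "sqrt (2 * (v * (\<Sum>e\<in>E. ?y e))) \<le>
      sqrt (2 * (v * (\<Sum>e\<in>E. 3 * (v * (\<Sum>f\<in>E. (a e f)\<^sup>2))\<^sup>2 + v * (\<Sum>f\<in>E. a e f ^ 4))))"
    using y v_nonneg by (intro real_sqrt_le_mono mult_left_mono sum_mono) auto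
  finally show ?thesis .
qed

text \<open>\<open>N\<close> is the Gram matrix of the coefficients, and the sum of the squared rows
  is the quadratic form of \<open>N\<close> in the centred coordinates. Its diagonal becomes a
  linear form in the independent centred squares, its off-diagonal part is again a quadratic form
  with zero diagonal, and \<open>norm\<close> cancels the constant. The two second moments are then
  known exactly.\<close>

lemma row_defect_bound:
  assumes norm: "v\<^sup>2 * (\<Sum>e\<in>E. \<Sum>f\<in>E. (a e f)\<^sup>2) = 2"
  defines "N \<equiv> \<lambda>f g. \<Sum>e\<in>E. a e f * a e g"
  shows "row_defect\<^sup>2 \<le> v ^ 3 / 2 * (\<Sum>f\<in>E. (N f f)\<^sup>2) + v ^ 4 * (\<Sum>f\<in>E. \<Sum>g\<in>E. (if f = g then 0 else (N f g)\<^sup>2))"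
proof -
  let ?u = "\<lambda>y. (x y)\<^sup>2 - v" and ?N0 = "\<lambda>f g. if f = g then 0 else N f g"
  let ?D = "\<lambda>A. \<Sum>f\<in>E. N f f * ?u (A f)" and ?Q = "\<lambda>A. \<Sum>f\<in>E. \<Sum>g\<in>E. ?N0 f g * x (A f) * x (A g)"
  note fin = integrable_measure_pmf_finite[OF finite_support]
  have mean_u: "measure_pmf.expectation P ?u = 0"
    using var by (subst Bochner_Integration.integral_diff) (auto intro: fin)
  have x4: "x y ^ 4 \<le> (x y)\<^sup>2" for y
  proof -
    have "(x y)\<^sup>2 * (x y)\<^sup>2 \<le> (x y)\<^sup>2 * 1"
      using bound[of y] by (intro mult_left_mono) (auto simp: abs_square_le_1)
    then show ?thesis
      by (simp add: power4_eq_xxxx power2_eq_square mult.assoc)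
  qed
  \<comment> \<open>The variance of the squared variable equals its fourth moment minus
    \<open>v^2\<close>, and the fourth moment is at most \<open>v\<close> because \<bar>x\<bar>
    \<le> 1.\<close>
  have "measure_pmf.expectation P (\<lambda>y. (?u y)\<^sup>2) = measure_pmf.expectation P (\<lambda>y. x y ^ 4 + (v\<^sup>2 - 2 * v * (x y)\<^sup>2))"
    by (intro arg_cong[where f = "measure_pmf.expectation P"] ext) algebra
  also have "\<dots> = measure_pmf.expectation P (\<lambda>y. x y ^ 4) + (v\<^sup>2 - 2 * v * v)"
    using var by (subst Bochner_Integration.integral_add; (subst Bochner_Integration.integral_diff)?) (auto intro: fin)
  also have "\<dots> \<le> v + (v\<^sup>2 - 2 * v * v)"
    unfolding var[symmetric] by (intro add_mono integral_mono fin x4) simp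
  finally have var_u: "measure_pmf.expectation P (\<lambda>y. (?u y)\<^sup>2) \<le> v"
    using zero_le_square[of v] unfolding power2_eq_square[of v] by linarith
  have expand: "v * (\<Sum>e\<in>E. (row_form e A)\<^sup>2) / 2 - 1 = v / 2 * (?D A + ?Q A)" for A
  proof -
    have "(\<Sum>e\<in>E. (row_form e A)\<^sup>2) = (\<Sum>e\<in>E. \<Sum>f\<in>E. \<Sum>g\<in>E. a e f * a e g * (x (A f) * x (A g)))"
      by (simp add: row_form_def power2_eq_square sum_product mult_ac)
    also have "\<dots> = (\<Sum>f\<in>E. \<Sum>e\<in>E. \<Sum>g\<in>E. a e f * a e g * (x (A f) * x (A g)))"
      by (rule sum.swap)
    also have "\<dots> = (\<Sum>f\<in>E. \<Sum>g\<in>E. \<Sum>e\<in>E. a e f * a e g * (x (A f) * x (A g)))"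
      by (intro sum.cong refl sum.swap)
    also have "\<dots> = (\<Sum>f\<in>E. \<Sum>g\<in>E. N f g * (x (A f) * x (A g)))"
      by (simp add: N_def sum_distrib_right)
    also have "\<dots> = (\<Sum>f\<in>E. \<Sum>g\<in>E. ?N0 f g * x (A f) * x (A g) + (if f = g then N f f * (x (A f))\<^sup>2 else 0))"
      by (intro sum.cong refl) (auto simp: power2_eq_square)
    also have "\<dots> = ?Q A + (\<Sum>f\<in>E. N f f * (x (A f))\<^sup>2)"
      using finite_index by (simp add: sum.distrib)
    also have "(\<Sum>f\<in>E. N f f * (x (A f))\<^sup>2) = ?D A + v * (\<Sum>f\<in>E. N f f)"
      by (simp add: sum_distrib_left algebra_simps flip: sum.distrib)
    also have "(\<Sum>f\<in>E. N f f) = (\<Sum>e\<in>E. \<Sum>f\<in>E. (a e f)\<^sup>2)"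
      unfolding N_def by (subst sum.swap) (simp add: power2_eq_square)
    finally have "v * (\<Sum>e\<in>E. (row_form e A)\<^sup>2) / 2 - 1 = v / 2 * (?Q A + ?D A)
        + (v\<^sup>2 * (\<Sum>e\<in>E. \<Sum>f\<in>E. (a e f)\<^sup>2) / 2 - 1)"
      by (simp add: field_simps power2_eq_square)
    then show ?thesis
      unfolding norm by simp
  qed
  have "row_defect\<^sup>2 = expec (\<lambda>A. (v / 2 * (?D A + ?Q A))\<^sup>2)"
    unfolding expand[symmetric] by (simp add: row_defect_def)
  also have "\<dots> \<le> expec (\<lambda>A. v\<^sup>2 / 2 * ((?D A)\<^sup>2 + (?Q A)\<^sup>2))"
  proof (intro integral_mono integrable_Om)
    have "(s * (y + z))\<^sup>2 \<le> 2 * s\<^sup>2 * (y\<^sup>2 + z\<^sup>2)" for s y z :: real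
    proof -
      have "0 \<le> s\<^sup>2 * (y - z)\<^sup>2"
        by simp
      then show ?thesis
        by (simp add: power2_eq_square algebra_simps)
    qed
    from this[of "v / 2"] show "(v / 2 * (?D A + ?Q A))\<^sup>2 \<le> v\<^sup>2 / 2 * ((?D A)\<^sup>2 + (?Q A)\<^sup>2)" for A
      by (simp add: power_divide)
  qed
  also have "\<dots> = v\<^sup>2 / 2 * (expec (\<lambda>A. (?D A)\<^sup>2) + expec (\<lambda>A. (?Q A)\<^sup>2))"
    by (subst integral_mult_right_zero, subst Bochner_Integration.integral_add) auto
  also have "expec (\<lambda>A. (?D A)\<^sup>2) = measure_pmf.expectation P (\<lambda>y. (?u y)\<^sup>2) * (\<Sum>f\<in>E. (N f f)\<^sup>2)"
    using expec_linear_square[of E ?u "\<lambda>f. N f f", OF _ mean_u] by simp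
  also have "expec (\<lambda>A. (?Q A)\<^sup>2) = 2 * v\<^sup>2 * (\<Sum>f\<in>E. \<Sum>g\<in>E. (?N0 f g)\<^sup>2)"
    unfolding var[symmetric]
    by (rule expec_quadratic_square) (auto simp: mean N_def mult.commute)
  also have "v\<^sup>2 / 2 * (measure_pmf.expectation P (\<lambda>y. (?u y)\<^sup>2) * (\<Sum>f\<in>E. (N f f)\<^sup>2) + 2 * v\<^sup>2 * (\<Sum>f\<in>E. \<Sum>g\<in>E. (?N0 f g)\<^sup>2))
     \<le> v\<^sup>2 / 2 * (v * (\<Sum>f\<in>E. (N f f)\<^sup>2) + 2 * v\<^sup>2 * (\<Sum>f\<in>E. \<Sum>g\<in>E. (?N0 f g)\<^sup>2))"
    by (intro mult_left_mono add_mono mult_right_mono var_u sum_nonneg order_refl) auto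
  also have "\<dots> = v ^ 3 / 2 * (\<Sum>f\<in>E. (N f f)\<^sup>2) + v ^ 4 * (\<Sum>f\<in>E. \<Sum>g\<in>E. (?N0 f g)\<^sup>2)"
    by (simp add: algebra_simps power2_eq_square power3_eq_cube power4_eq_xxxx)
  also have "(\<Sum>f\<in>E. \<Sum>g\<in>E. (?N0 f g)\<^sup>2) = (\<Sum>f\<in>E. \<Sum>g\<in>E. (if f = g then 0 else (N f g)\<^sup>2))"
    by (intro sum.cong) auto
  finally show ?thesis .
qed

end

section \<open>Adjacency of edges\<close>

definition adjacent :: "'a set \<Rightarrow> 'a set \<Rightarrow> bool" where
  "adjacent e f \<longleftrightarrow> e \<noteq> f \<and> e \<inter> f \<noteq> {}"

lemma adjacent_sym: "adjacent e f = adjacent f e"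
  by (auto simp: adjacent_def)

text \<open>Since edges have two elements, an edge that meets \<open>e\<close> without being equal
  to it has exactly one endpoint in \<open>e\<close>. It is therefore obtained from exactly one pair
  of an endpoint inside \<open>e\<close> and one outside.\<close>

lemma sum_adjacent:
  fixes g :: "'a set \<Rightarrow> 'b::comm_monoid_add"
  assumes V: "finite V" and e: "e \<in> nsets V 2"
  shows "(\<Sum>f\<in>{f \<in> nsets V 2. adjacent e f}. g f) = (\<Sum>x\<in>e. \<Sum>y\<in>V - e. g {x, y})"
proof -
  obtain a b where ab: "e = {a, b}" "a \<in> V" "b \<in> V" "a \<noteq> b"
    using e by (rule nsets2_E)
  have "(\<Sum>x\<in>e. \<Sum>y\<in>V - e. g {x, y}) = (\<Sum>z\<in>e \<times> (V - e). g {fst z, snd z})"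
    using V ab by (subst sum.Sigma) (auto simp: split_def)
  also have "\<dots> = (\<Sum>f\<in>{f \<in> nsets V 2. adjacent e f}. g f)"
  proof (rule sum.reindex_bij_betw)
    show "bij_betw (\<lambda>z. {fst z, snd z}) (e \<times> (V - e)) {f \<in> nsets V 2. adjacent e f}"
    proof (rule bij_betwI')
      show "({fst z, snd z} = {fst z', snd z'}) = (z = z')"
        if "z \<in> e \<times> (V - e)" "z' \<in> e \<times> (V - e)" for z z'
      proof -
        have "fst z \<in> e" "snd z \<notin> e" "fst z' \<in> e" "snd z' \<notin> e"
          using that by auto
        then show ?thesis
          unfolding doubleton_eq_iff prod_eq_iff by metis
      qed
      show "{fst z, snd z} \<in> {f \<in> nsets V 2. adjacent e f}" if "z \<in> e \<times> (V - e)" for z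
      proof -
        have "fst z \<in> e" "fst z \<in> V" "snd z \<in> V" "snd z \<notin> e"
          using that ab by auto
        moreover from this have "fst z \<noteq> snd z"
          by auto
        ultimately show ?thesis
          by (auto simp: adjacent_def)
      qed
      show "\<exists>z\<in>e \<times> (V - e). f = {fst z, snd z}" if f: "f \<in> {f \<in> nsets V 2. adjacent e f}" for f
      proof -
        obtain x y where xy: "f = {x, y}" "x \<in> V" "y \<in> V" "x \<noteq> y"
          using f nsets2_E[of f V] by blast
        have "x \<in> e \<and> y \<notin> e \<or> y \<in> e \<and> x \<notin> e"
          using f xy ab by (auto simp: adjacent_def)
        then have "(x, y) \<in> e \<times> (V - e) \<or> (y, x) \<in> e \<times> (V - e)"
          using xy by blast
        moreover have "f = {fst (x, y), snd (x, y)}" "f = {fst (y, x), snd (y, x)}"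
          using xy by auto
        ultimately show ?thesis
          by blast
      qed
    qed
  qed
  finally show ?thesis
    by simp
qed

lemma card_adjacent:
  assumes V: "finite V" and e: "e \<in> nsets V 2"
  shows "card {f \<in> nsets V 2. adjacent e f} = 2 * (card V - 2)"
proof -
  have "card e = 2" "e \<subseteq> V" "finite e"
    using e by (auto simp: nsets_def)
  then show ?thesis
    using sum_adjacent[OF V e, of "\<lambda>_. 1 :: nat"] V by (simp add: card_Diff_subset)
qed

text \<open>Both sides run over the flags of the complete graph, that is, over the pairs of an edge
  and one of its endpoints. This moves from sums over edges to sums over the centres of
  wedges.\<close>

lemma sum_edge_vertex:
  fixes F :: "'a set \<Rightarrow> 'a \<Rightarrow> 'b::comm_monoid_add"
  assumes V: "finite V"
  shows "(\<Sum>e\<in>nsets V 2. \<Sum>x\<in>e. F e x) = (\<Sum>j\<in>V. \<Sum>i\<in>V - {j}. F {i, j} j)"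
proof -
  have "(\<Sum>j\<in>V. \<Sum>i\<in>V - {j}. F {i, j} j) = (\<Sum>z\<in>(SIGMA j:V. V - {j}). F {snd z, fst z} (fst z))"
    using V by (subst sum.Sigma) (auto simp: split_def)
  also have "\<dots> = (\<Sum>w\<in>(SIGMA e:nsets V 2. e). F (fst w) (snd w))"
  proof -
    have bij: "bij_betw (\<lambda>z. ({snd z, fst z}, fst z)) (SIGMA j:V. V - {j}) (SIGMA e:nsets V 2. e)"
    proof (rule bij_betwI')
      show "(({snd z, fst z}, fst z) = ({snd z', fst z'}, fst z')) = (z = z')" for z z' :: "'a \<times> 'a"
        by (cases z; cases z') (auto simp: doubleton_eq_iff)
      show "({snd z, fst z}, fst z) \<in> (SIGMA e:nsets V 2. e)" if "z \<in> (SIGMA j:V. V - {j})" for z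
        using that by auto
      show "\<exists>z\<in>(SIGMA j:V. V - {j}). w = ({snd z, fst z}, fst z)" if w: "w \<in> (SIGMA e:nsets V 2. e)" for w
      proof -
        obtain e x where ex: "w = (e, x)" "e \<in> nsets V 2" "x \<in> e"
          using w by auto
        from ex(2) obtain a b where ab: "e = {a, b}" "a \<in> V" "b \<in> V" "a \<noteq> b"
          by (rule nsets2_E)
        have "(a, b) \<in> (SIGMA j:V. V - {j})" "(b, a) \<in> (SIGMA j:V. V - {j})"
          using ab by auto
        moreover have "w = ({snd (a, b), fst (a, b)}, fst (a, b)) \<or> w = ({snd (b, a), fst (b, a)}, fst (b, a))"
          using ex ab by auto
        ultimately show ?thesis
          by blast
      qed
    qed
    show ?thesis
      using sum.reindex_bij_betw[OF bij, of "\<lambda>w. F (fst w) (snd w)"] by simp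
  qed
  also have "\<dots> = (\<Sum>e\<in>nsets V 2. \<Sum>x\<in>e. F e x)"
    using V by (subst sum.Sigma) (auto simp: split_def finite_imp_finite_nsets nsets_def)
  finally show ?thesis
    by simp
qed

lemma sum_nsets_2_prod:
  fixes h :: "'a \<Rightarrow> 'b::comm_semiring_1"
  assumes "finite U"
  shows "2 * (\<Sum>S\<in>nsets U 2. \<Prod>i\<in>S. h i) = (\<Sum>i\<in>U. \<Sum>k\<in>U - {i}. h i * h k)"
  using assms
proof (induction U rule: finite_induct)
  case empty
  have "nsets ({}::'a set) 2 = {}"
    by (auto simp: nsets_def)
  then show ?case by simp
next
  case (insert u U)
  have split: "nsets (insert u U) 2 = nsets U 2 \<union> (\<lambda>i. {u, i}) ` U"
  proof (intro equalityI subsetI)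
    fix e assume "e \<in> nsets (insert u U) 2"
    then obtain x y where "e = {x, y}" "x \<in> insert u U" "y \<in> insert u U" "x \<noteq> y"
      by (rule nsets2_E)
    then show "e \<in> nsets U 2 \<union> (\<lambda>i. {u, i}) ` U"
      by (auto simp: nsets_def card_2_iff insert_commute)
  next
    fix e assume "e \<in> nsets U 2 \<union> (\<lambda>i. {u, i}) ` U"
    then show "e \<in> nsets (insert u U) 2"
      using insert.hyps by (auto simp: nsets_def card_2_iff)
  qed
  have "(\<Sum>S\<in>nsets (insert u U) 2. \<Prod>i\<in>S. h i) =
      (\<Sum>S\<in>nsets U 2. \<Prod>i\<in>S. h i) + (\<Sum>S\<in>(\<lambda>i. {u, i}) ` U. \<Prod>i\<in>S. h i)"
    unfolding split using insert.hyps
    by (intro sum.union_disjoint) (auto simp: finite_imp_finite_nsets nsets_def)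
  also have "(\<Sum>S\<in>(\<lambda>i. {u, i}) ` U. \<Prod>i\<in>S. h i) = (\<Sum>i\<in>U. h u * h i)"
  proof (subst sum.reindex)
    show "inj_on (\<lambda>i. {u, i}) U"
      by (auto simp: inj_on_def doubleton_eq_iff)
    show "(\<Sum>i\<in>U. ((\<lambda>S. \<Prod>i\<in>S. h i) \<circ> (\<lambda>i. {u, i})) i) = (\<Sum>i\<in>U. h u * h i)"
    proof (intro sum.cong refl)
      fix i assume "i \<in> U"
      then have "u \<noteq> i"
        using insert.hyps by auto
      then show "((\<lambda>S. \<Prod>i\<in>S. h i) \<circ> (\<lambda>i. {u, i})) i = h u * h i"
        by simp
    qed
  qed
  finally have "2 * (\<Sum>S\<in>nsets (insert u U) 2. \<Prod>i\<in>S. h i) =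
      (\<Sum>i\<in>U. \<Sum>k\<in>U - {i}. h i * h k) + 2 * (\<Sum>i\<in>U. h u * h i)"
    by (simp add: insert.IH distrib_left)
  moreover have "(\<Sum>i\<in>U. \<Sum>k\<in>insert u U - {i}. h i * h k) = (\<Sum>i\<in>U. h i * h u + (\<Sum>k\<in>U - {i}. h i * h k))"
  proof (intro sum.cong refl)
    fix i assume "i \<in> U"
    then have "insert u U - {i} = insert u (U - {i})"
      using insert.hyps by auto
    then show "(\<Sum>k\<in>insert u U - {i}. h i * h k) = h i * h u + (\<Sum>k\<in>U - {i}. h i * h k)"
      using insert.hyps by simp
  qed
  moreover have "insert u U - {u} = U"
    using insert.hyps by auto
  ultimately show ?case
    using insert.hyps by (simp add: sum.distrib mult_2 mult.commute[of _ "h u"] add_ac)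
qed

text \<open>Two adjacent edges share exactly one vertex, the centre of the wedge they form, and each
  wedge arises from two ordered pairs of edges. This is what makes the wedge count a quadratic form
  in the edge indicators.\<close>

lemma sum_wedges:
  fixes g :: "'a set \<Rightarrow> 'b::comm_semiring_1"
  assumes V: "finite V"
  shows "2 * (\<Sum>j\<in>V. \<Sum>S\<in>nsets (V - {j}) 2. \<Prod>i\<in>S. g {i, j}) =
    (\<Sum>e\<in>nsets V 2. \<Sum>f\<in>{f \<in> nsets V 2. adjacent e f}. g e * g f)"
proof -
  have "(\<Sum>e\<in>nsets V 2. \<Sum>f\<in>{f \<in> nsets V 2. adjacent e f}. g e * g f) =
      (\<Sum>e\<in>nsets V 2. \<Sum>x\<in>e. \<Sum>y\<in>V - e. g e * g {x, y})"
    by (intro sum.cong refl sum_adjacent V)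
  also have "\<dots> = (\<Sum>j\<in>V. \<Sum>i\<in>V - {j}. \<Sum>y\<in>V - {i, j}. g {i, j} * g {j, y})"
    by (rule sum_edge_vertex[OF V])
  also have "\<dots> = (\<Sum>j\<in>V. \<Sum>i\<in>V - {j}. \<Sum>k\<in>V - {j} - {i}. g {i, j} * g {k, j})"
    by (intro sum.cong) (auto simp: insert_commute)
  also have "\<dots> = (\<Sum>j\<in>V. 2 * (\<Sum>S\<in>nsets (V - {j}) 2. \<Prod>i\<in>S. g {i, j}))"
    using V by (intro sum.cong refl sum_nsets_2_prod[symmetric]) auto
  finally show ?thesis
    by (simp add: sum_distrib_left)
qed

text \<open>An edge meeting both \<open>f\<close> and \<open>g\<close> either joins a vertex of
  \<open>f\<close> to a vertex of \<open>g\<close>, with at most 4 possibilities, or contains a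
  vertex common to \<open>f\<close> and \<open>g\<close>. A common vertex exists only if
  \<open>f\<close> and \<open>g\<close> are adjacent, it is then unique, and it lies on fewer than
  \<open>card V\<close> edges.\<close>

lemma card_common_adjacent_le:
  assumes V: "finite V" and f: "f \<in> nsets V 2" and g: "g \<in> nsets V 2" and "f \<noteq> g"
  shows "card {e \<in> nsets V 2. adjacent e f \<and> adjacent e g} \<le> 4 + of_bool (adjacent f g) * card V"
proof -
  have c: "card f = 2" "card g = 2" "finite f" "finite g"
    using f g by (auto simp: nsets_def)
  have fg: "card (f \<inter> g) \<le> of_bool (adjacent f g)"
  proof (cases "f \<inter> g = {}")
    case False
    have "\<not> f \<subseteq> g"
      using c \<open>f \<noteq> g\<close> card_subset_eq[of g f] by auto
    then have "card (f \<inter> g) < card f"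
      using c by (intro psubset_card_mono) auto
    then show ?thesis
      using False c \<open>f \<noteq> g\<close> by (simp add: adjacent_def)
  qed simp
  let ?S1 = "(\<lambda>(x, y). {x, y}) ` (f \<times> g)" and ?S2 = "(\<lambda>(x, y). {x, y}) ` ((f \<inter> g) \<times> V)"
  have "{e \<in> nsets V 2. adjacent e f \<and> adjacent e g} \<subseteq> ?S1 \<union> ?S2"
  proof
    fix e assume e: "e \<in> {e \<in> nsets V 2. adjacent e f \<and> adjacent e g}"
    obtain x y where xy: "e = {x, y}" "x \<in> V" "y \<in> V" "x \<noteq> y"
      using e nsets2_E[of e V] by blast
    have "(x \<in> f \<or> y \<in> f) \<and> (x \<in> g \<or> y \<in> g)"
      using e xy by (auto simp: adjacent_def)
    then consider "x \<in> f \<inter> g" | "y \<in> f \<inter> g" | "x \<in> f" "y \<in> g" | "y \<in> f" "x \<in> g"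
      by auto
    then show "e \<in> ?S1 \<union> ?S2"
    proof cases
      case 1 then have "e \<in> ?S2" using xy by (intro image_eqI[of _ _ "(x, y)"]) auto
      then show ?thesis by simp
    next
      case 2 then have "e \<in> ?S2" using xy by (intro image_eqI[of _ _ "(y, x)"]) auto
      then show ?thesis by simp
    next
      case 3 then have "e \<in> ?S1" using xy by (intro image_eqI[of _ _ "(x, y)"]) auto
      then show ?thesis by simp
    next
      case 4 then have "e \<in> ?S1" using xy by (intro image_eqI[of _ _ "(y, x)"]) auto
      then show ?thesis by simp
    qed
  qed
  then have "card {e \<in> nsets V 2. adjacent e f \<and> adjacent e g} \<le> card (?S1 \<union> ?S2)"
    using c V by (intro card_mono) auto
  also have "\<dots> \<le> card ?S1 + card ?S2"
    by (rule card_Un_le)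
  also have "\<dots> \<le> card (f \<times> g) + card ((f \<inter> g) \<times> V)"
    using c V by (intro add_mono card_image_le) auto
  also have "\<dots> \<le> 4 + of_bool (adjacent f g) * card V"
    using c fg by (simp add: card_cartesian_product mult_right_mono)
  finally show ?thesis .
qed

section \<open>The adjacency matrix of the line graph of the complete graph\<close>

definition adj_mat :: "'a set \<Rightarrow> 'a set \<Rightarrow> real" where
  "adj_mat e f = of_bool (adjacent e f)"

lemma adj_mat_sym: "adj_mat e f = adj_mat f e"
  by (simp add: adj_mat_def adjacent_sym)

lemma adj_mat_diag [simp]: "adj_mat e e = 0"
  by (simp add: adj_mat_def adjacent_def)

lemma adj_mat_square [simp]: "(adj_mat e f)\<^sup>2 = adj_mat e f"
  by (simp add: adj_mat_def)

lemma adj_mat_fourth [simp]: "adj_mat e f ^ 4 = adj_mat e f"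
  by (simp add: adj_mat_def)

lemma finite_complete_edges [simp]: "finite (complete_edges n)"
  by (simp add: complete_edges_def finite_imp_finite_nsets)

lemma sum_adj_mat:
  "(\<Sum>f\<in>complete_edges n. adj_mat e f * g f) = (\<Sum>f\<in>{f \<in> complete_edges n. adjacent e f}. g f)"
proof -
  have "(\<Sum>f\<in>complete_edges n. adj_mat e f * g f) = (\<Sum>f\<in>complete_edges n. if adjacent e f then g f else 0)"
    by (intro sum.cong) (auto simp: adj_mat_def)
  then show ?thesis
    by (simp add: sum.If_cases Int_def)
qed

lemma degree_edge:
  assumes "n \<ge> 2" "e \<in> complete_edges n"
  shows "(\<Sum>f\<in>complete_edges n. adj_mat e f) = 2 * (real n - 2)"
proof -
  have "(\<Sum>f\<in>complete_edges n. adj_mat e f) = real (card {f \<in> complete_edges n. adjacent e f})"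
    using sum_adj_mat[where g = "\<lambda>_. 1"] by simp
  then show ?thesis
    using assms card_adjacent[of "{1..n}" e] by (simp add: complete_edges_def of_nat_diff)
qed

lemma card_complete_edges: "real (card (complete_edges n)) = real (n choose 2)"
  by (simp add: complete_edges_def card_nsets)

lemma real_choose_2: "real (n choose 2) = real n * (real n - 1) / 2"
proof (cases n)
  case (Suc m)
  have "2 * (n choose 2) = n * m"
    using binomial_absorption[of 1 n] Suc by (simp add: numeral_2_eq_2)
  then have "2 * real (n choose 2) = real n * real m"
    by (metis of_nat_mult of_nat_numeral)
  then show ?thesis
    by (simp add: Suc)
qed (simp add: binomial_eq_0)

text \<open>The number of wedges in the complete graph: every set of three vertices gives three, one
  for each choice of the centre.\<close>

definition wedges :: "nat \<Rightarrow> real" where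
  "wedges n = 3 * real (n choose 3)"

lemma wedges_eq: "wedges n = real n * (real n - 1) * (real n - 2) / 2"
proof (cases n)
  case (Suc m)
  have "3 * (n choose 3) = n * (m choose 2)"
    using binomial_absorption[of 2 n] Suc by (simp add: numeral_3_eq_3)
  then have "wedges n = real n * real (m choose 2)"
    unfolding wedges_def by (metis of_nat_mult of_nat_numeral)
  then show ?thesis
    by (simp add: real_choose_2 Suc)
qed (simp add: wedges_def)

text \<open>The constant 1/9 gives equality at \<open>n = 3\<close>, whence the factor
  \<open>real n - 3\<close> in the difference of the two sides.\<close>

lemma wedges_ge:
  assumes "n \<ge> 3"
  shows "wedges n \<ge> real n ^ 3 / 9"
proof -
  have "0 \<le> (real n - 3) * (7 * real n - 6)"
    using assms by (intro mult_nonneg_nonneg) auto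
  then have "0 \<le> real n * ((real n - 3) * (7 * real n - 6))"
    by simp
  then show ?thesis
    unfolding wedges_eq by (simp add: power3_eq_cube algebra_simps)
qed

lemma sum_sum_adj_mat:
  assumes "n \<ge> 2"
  shows "(\<Sum>e\<in>complete_edges n. \<Sum>f\<in>complete_edges n. adj_mat e f) = 2 * wedges n"
proof -
  have "(\<Sum>e\<in>complete_edges n. \<Sum>f\<in>complete_edges n. adj_mat e f) = real (n choose 2) * (2 * (real n - 2))"
    using degree_edge[OF assms] card_complete_edges[of n] by simp
  then show ?thesis
    unfolding real_choose_2 wedges_eq by (simp add: field_simps)
qed

lemma signed_wedge_count_eq:
  "signed_wedge_count n q A =
    (\<Sum>e\<in>complete_edges n. \<Sum>f\<in>complete_edges n. adj_mat e f * (of_bool (A e) - q) * (of_bool (A f) - q)) / 2"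
proof -
  let ?g = "\<lambda>e. of_bool (A e) - q"
  have "2 * signed_wedge_count n q A = (\<Sum>e\<in>complete_edges n. \<Sum>f\<in>{f \<in> complete_edges n. adjacent e f}. ?g e * ?g f)"
    unfolding signed_wedge_count_def adj_def complete_edges_def
    using sum_wedges[of "{1..n}" ?g] by simp
  then show ?thesis
    by (simp add: sum_adj_mat[symmetric] mult_ac)
qed

lemma codegree_le:
  assumes "f \<in> complete_edges n" "g \<in> complete_edges n" "f \<noteq> g"
  shows "(\<Sum>e\<in>complete_edges n. adj_mat e f * adj_mat e g) \<le> 4 + adj_mat f g * n"
proof -
  have "(\<Sum>e\<in>complete_edges n. adj_mat e f * adj_mat e g) = real (card {e \<in> complete_edges n. adjacent e f \<and> adjacent e g})"
    by (simp add: adj_mat_def flip: of_bool_conj)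
       (simp add: of_bool_def sum.If_cases Int_def)
  also have "\<dots> \<le> real (4 + of_bool (adjacent f g) * card {1..n})"
    using card_common_adjacent_le[of "{1..n}" f g] assms by (intro of_nat_mono) (simp add: complete_edges_def)
  finally show ?thesis
    by (simp add: adj_mat_def)
qed

text \<open>There are of order \<open>n^4\<close> pairs with bounded codegree and of order
  \<open>n^3\<close> adjacent pairs with codegree of order \<open>n\<close>; the latter dominate
  with \<open>n^5\<close>. This is just below the \<open>n^6\<close> contained in the fourth power
  of the standard deviation.\<close>

lemma sum_codegree_square_le:
  assumes "n \<ge> 3"
  shows "(\<Sum>f\<in>complete_edges n. \<Sum>g\<in>complete_edges n.
      (if f = g then 0 else (\<Sum>e\<in>complete_edges n. adj_mat e f * adj_mat e g)\<^sup>2)) \<le> 10 * real n ^ 5"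
proof -
  let ?E = "complete_edges n"
  have "(\<Sum>f\<in>?E. \<Sum>g\<in>?E. (if f = g then 0 else (\<Sum>e\<in>?E. adj_mat e f * adj_mat e g)\<^sup>2))
      \<le> (\<Sum>f\<in>?E. \<Sum>g\<in>?E. 32 + 2 * real n ^ 2 * adj_mat f g)"
  proof (intro sum_mono)
    fix f g assume fg: "f \<in> ?E" "g \<in> ?E"
    let ?N = "\<Sum>e\<in>?E. adj_mat e f * adj_mat e g"
    show "(if f = g then 0 else ?N\<^sup>2) \<le> 32 + 2 * real n ^ 2 * adj_mat f g"
    proof (cases "f = g")
      case False
      have "0 \<le> ?N"
        by (intro sum_nonneg) (simp add: adj_mat_def)
      then have "?N\<^sup>2 \<le> (4 + adj_mat f g * n)\<^sup>2"
        by (intro power_mono codegree_le fg False)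
      also have "\<dots> \<le> 2 * 4\<^sup>2 + 2 * (adj_mat f g * n)\<^sup>2"
        using zero_le_power2[of "4 - adj_mat f g * n"] by (simp add: power2_eq_square algebra_simps)
      also have "\<dots> = 32 + 2 * real n ^ 2 * adj_mat f g"
        by (simp add: power_mult_distrib)
      finally show ?thesis
        using False by simp
    qed (simp add: adj_mat_def)
  qed
  also have "\<dots> = 32 * (real (n choose 2))\<^sup>2 + 2 * real n ^ 2 * (2 * wedges n)"
    using sum_sum_adj_mat[of n] card_complete_edges[of n] assms
    by (simp add: sum.distrib power2_eq_square flip: sum_distrib_left)
  also have "\<dots> \<le> 32 * (real n ^ 2 / 2)\<^sup>2 + 2 * real n ^ 2 * (real n ^ 3)"
  proof (intro add_mono mult_left_mono power_mono)
    show "real (n choose 2) \<le> real n ^ 2 / 2"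
      by (simp add: real_choose_2 power2_eq_square algebra_simps)
    have "real n * (real n - 1) * (real n - 2) \<le> real n * real n * real n"
      using assms by (intro mult_mono) auto
    then show "2 * wedges n \<le> real n ^ 3"
      by (simp add: wedges_eq power3_eq_cube)
  qed auto
  also have "\<dots> = 8 * real n ^ 4 + 2 * real n ^ 5"
    by (simp add: power2_eq_square power3_eq_cube eval_nat_numeral)
  also have "\<dots> \<le> 8 * real n ^ 5 + 2 * real n ^ 5"
    using assms by (intro add_mono mult_left_mono power_increasing) auto
  finally show ?thesis
    by simp
qed

text \<open>The exact standard deviation of the signed wedge count under
  \<open>erdos_renyi n p\<close>: the products over distinct wedges are uncorrelated, each with
  variance \<open>(p (1 - p))^2\<close>. The test itself normalises slightly differently.\<close>

definition wedge_sd :: "nat \<Rightarrow> real \<Rightarrow> real" where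
  "wedge_sd n p = p * (1 - p) * sqrt (wedges n)"

text \<open>Instance of the general bound for the line graph matrix. The factor 81 contained in
  every constant is the square of the 9 in \<open>wedges_ge\<close>. The term
  \<open>810 / real n\<close> comes from pairs of distinct edges with common neighbours, the other
  term under that root from the diagonal of the codegree matrix.\<close>

lemma char_signed_wedge_count:
  assumes n: "n \<ge> 3" and p: "0 < p" "p < 1"
  defines "v \<equiv> p * (1 - p)"
  shows "cmod (char (distr (measure_pmf (erdos_renyi n p)) borel (\<lambda>A. signed_wedge_count n p A / wedge_sd n p)) t
      - complex_of_real (exp (- t\<^sup>2 / 2)))
    \<le> \<bar>t\<bar> * exp (t\<^sup>2 / 2) * (\<bar>t\<bar> * sqrt (81 / (v * real n ^ 2) + 810 / real n)
        + 3 / 4 * t\<^sup>2 * sqrt (972 / (v * real n ^ 2) + 162 / (v ^ 2 * real n ^ 3)))"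
proof -
  let ?E = "complete_edges n"
  define s where "s = wedge_sd n p"
  \<comment> \<open>Division by the standard deviation makes \<open>quad_form\<close> the
    standardised count and yields the normalisation required by both moment bounds.\<close>
  define a where "a e f = adj_mat e f / s" for e f :: "nat set"
  have v: "v > 0"
    using p by (simp add: v_def)
  have T: "wedges n \<ge> real n ^ 3 / 9"
    by (rule wedges_ge[OF n])
  then have T0: "wedges n > 0"
    using n by (intro less_le_trans[OF _ T]) simp
  have s: "s > 0" "s\<^sup>2 = v\<^sup>2 * wedges n"
    using v T0 by (auto simp: s_def wedge_sd_def v_def power_mult_distrib)
  interpret quadratic_form ?E False "bernoulli_pmf p" "\<lambda>b. of_bool b - p" v a
  proof
    show "finite ?E" by simp
    show "finite (set_pmf (bernoulli_pmf p))" by simp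
    show "measure_pmf.expectation (bernoulli_pmf p) (\<lambda>b. of_bool b - p) = 0"
      using p by (simp add: algebra_simps)
    show "measure_pmf.expectation (bernoulli_pmf p) (\<lambda>b. (of_bool b - p)\<^sup>2) = v"
      using p by (simp add: v_def power2_eq_square algebra_simps)
    show "\<bar>of_bool b - p\<bar> \<le> 1" for b
      using p by (cases b) auto
    show "a e f = a f e" for e f
      by (simp add: a_def adj_mat_sym)
    show "a e e = 0" for e
      by (simp add: a_def)
  qed
  have quad_form: "quad_form A = signed_wedge_count n p A / s" for A
    unfolding quad_form_def signed_wedge_count_eq a_def by (simp add: sum_divide_distrib mult_ac)
  have char: "char (distr (measure_pmf (erdos_renyi n p)) borel (\<lambda>A. signed_wedge_count n p A / wedge_sd n p)) t = char_fun t"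
    unfolding char_def char_fun_def by (subst integral_distr) (auto simp: erdos_renyi_def quad_form s_def)
  have a2: "(a e f)\<^sup>2 = adj_mat e f / s\<^sup>2" and a4: "(a e f) ^ 4 = adj_mat e f / s ^ 4" for e f
    by (simp_all add: a_def power_divide)
  have norm: "v\<^sup>2 * (\<Sum>e\<in>?E. \<Sum>f\<in>?E. (a e f)\<^sup>2) = 2"
    unfolding a2 sum_divide_distrib[symmetric] using n v T0 by (simp add: sum_sum_adj_mat s(2))
  have s4: "s ^ 4 = v ^ 4 * (wedges n)\<^sup>2"
  proof -
    have "s ^ 4 = (s\<^sup>2)\<^sup>2"
      by simp
    then show ?thesis
      unfolding s(2) by (simp add: power_mult_distrib)
  qed
  have T2: "(real n ^ 3 / 9)\<^sup>2 \<le> (wedges n)\<^sup>2"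
    by (intro power_mono T) simp
  have ch2: "real (n choose 2) \<le> real n ^ 2 / 2"
    by (simp add: real_choose_2 power2_eq_square algebra_simps)
  define N where "N f g = (\<Sum>e\<in>?E. a e f * a e g)" for f g
  have N: "N f g = (\<Sum>e\<in>?E. adj_mat e f * adj_mat e g) / s\<^sup>2" for f g
    by (simp add: N_def a_def sum_divide_distrib power2_eq_square)
  have "row_defect\<^sup>2 \<le> v ^ 3 / 2 * (\<Sum>f\<in>?E. (N f f)\<^sup>2) + v ^ 4 * (\<Sum>f\<in>?E. \<Sum>g\<in>?E. (if f = g then 0 else (N f g)\<^sup>2))"
    unfolding N_def by (rule row_defect_bound[OF norm])
  also have "\<dots> \<le> v ^ 3 / 2 * (2 * real n ^ 4 / s ^ 4) + v ^ 4 * (10 * real n ^ 5 / s ^ 4)"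
  proof (intro add_mono mult_left_mono)
    have "(\<Sum>f\<in>?E. (N f f)\<^sup>2) \<le> (\<Sum>f\<in>?E. (2 * real n)\<^sup>2 / s ^ 4)"
    proof (intro sum_mono)
      fix f assume f: "f \<in> ?E"
      have "N f f = (\<Sum>e\<in>?E. adj_mat f e) / s\<^sup>2"
        unfolding N by (simp add: adj_mat_sym[of _ f] flip: power2_eq_square)
      also have "\<dots> = 2 * (real n - 2) / s\<^sup>2"
        using n f by (simp add: degree_edge)
      finally have "(N f f)\<^sup>2 = (2 * (real n - 2))\<^sup>2 / s ^ 4"
        by (simp add: power_divide)
      also have "\<dots> \<le> (2 * real n)\<^sup>2 / s ^ 4"
        using n by (intro divide_right_mono power_mono) auto
      finally show "(N f f)\<^sup>2 \<le> (2 * real n)\<^sup>2 / s ^ 4" .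
    qed
    also have "\<dots> = real (n choose 2) * ((2 * real n)\<^sup>2 / s ^ 4)"
      by (simp add: card_complete_edges)
    also have "\<dots> \<le> real n ^ 2 / 2 * ((2 * real n)\<^sup>2 / s ^ 4)"
      by (intro mult_right_mono ch2) simp
    also have "\<dots> = 2 * real n ^ 4 / s ^ 4"
      by (simp add: power2_eq_square power4_eq_xxxx)
    finally show "(\<Sum>f\<in>?E. (N f f)\<^sup>2) \<le> 2 * real n ^ 4 / s ^ 4" .
    have "(\<Sum>f\<in>?E. \<Sum>g\<in>?E. (if f = g then 0 else (N f g)\<^sup>2)) =
       (\<Sum>f\<in>?E. \<Sum>g\<in>?E. (if f = g then 0 else (\<Sum>e\<in>?E. adj_mat e f * adj_mat e g)\<^sup>2)) / s ^ 4"
    proof -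
      have "(if f = g then 0 else (N f g)\<^sup>2) =
          (if f = g then 0 else (\<Sum>e\<in>?E. adj_mat e f * adj_mat e g)\<^sup>2) / s ^ 4" for f g
        by (simp add: N power_divide)
      then show ?thesis
        by (simp only: sum_divide_distrib)
    qed
    also have "\<dots> \<le> 10 * real n ^ 5 / s ^ 4"
      by (intro divide_right_mono sum_codegree_square_le n) simp
    finally show "(\<Sum>f\<in>?E. \<Sum>g\<in>?E. (if f = g then 0 else (N f g)\<^sup>2)) \<le> 10 * real n ^ 5 / s ^ 4" .
  qed (use v in auto)
  also have "\<dots> = real n ^ 4 / v / (wedges n)\<^sup>2 + 10 * real n ^ 5 / (wedges n)\<^sup>2"
    unfolding s4 using v T0 by (simp add: field_simps power3_eq_cube power4_eq_xxxx)
  also have "\<dots> \<le> real n ^ 4 / v / (real n ^ 3 / 9)\<^sup>2 + 10 * real n ^ 5 / (real n ^ 3 / 9)\<^sup>2"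
    using n v by (intro add_mono divide_left_mono T2) (auto intro!: mult_pos_pos T0 zero_less_power)
  also have "\<dots> = 81 / (v * real n ^ 2) + 810 / real n"
    using n v by (simp add: field_simps power2_eq_square power3_eq_cube eval_nat_numeral)
  finally have "row_defect\<^sup>2 \<le> 81 / (v * real n ^ 2) + 810 / real n" .
  then have row_defect: "row_defect \<le> sqrt (81 / (v * real n ^ 2) + 810 / real n)"
    by (rule real_le_rsqrt)
  have "2 * (v * (\<Sum>e\<in>?E. 3 * (v * (\<Sum>f\<in>?E. (a e f)\<^sup>2))\<^sup>2 + v * (\<Sum>f\<in>?E. a e f ^ 4)))
      \<le> 2 * (v * (\<Sum>e\<in>?E. 3 * (v * (2 * real n / s\<^sup>2))\<^sup>2 + v * (2 * real n / s ^ 4)))"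
  proof -
    have "(\<Sum>f\<in>?E. (a e f)\<^sup>2) \<le> 2 * real n / s\<^sup>2" "(\<Sum>f\<in>?E. a e f ^ 4) \<le> 2 * real n / s ^ 4"
      if "e \<in> ?E" for e
      unfolding a2 a4 sum_divide_distrib[symmetric] using n that
      by (auto simp: degree_edge intro!: divide_right_mono)
    then show ?thesis
      using v by (intro mult_left_mono sum_mono add_mono power_mono mult_nonneg_nonneg sum_nonneg) auto
  qed
  also have "\<dots> = real (n choose 2) * (2 * (v * (3 * (v * (2 * real n / s\<^sup>2))\<^sup>2 + v * (2 * real n / s ^ 4))))"
    by (simp add: card_complete_edges)
  also have "\<dots> \<le> real n ^ 2 / 2 * (2 * (v * (3 * (v * (2 * real n / s\<^sup>2))\<^sup>2 + v * (2 * real n / s ^ 4))))"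
    using v by (intro mult_right_mono ch2) auto
  also have "\<dots> = 12 * real n ^ 4 / v / (wedges n)\<^sup>2 + 2 * real n ^ 3 / v\<^sup>2 / (wedges n)\<^sup>2"
    unfolding s4 s(2) using v T0 by (simp add: field_simps power2_eq_square power3_eq_cube power4_eq_xxxx)
  also have "\<dots> \<le> 12 * real n ^ 4 / v / (real n ^ 3 / 9)\<^sup>2 + 2 * real n ^ 3 / v\<^sup>2 / (real n ^ 3 / 9)\<^sup>2"
    using n v by (intro add_mono divide_left_mono T2) (auto intro!: mult_pos_pos T0 zero_less_power)
  also have "\<dots> = 972 / (v * real n ^ 2) + 162 / (v\<^sup>2 * real n ^ 3)"
    using n v by (simp add: field_simps power2_eq_square power3_eq_cube eval_nat_numeral)
  finally have third_moment: "third_moment \<le> sqrt (972 / (v * real n ^ 2) + 162 / (v\<^sup>2 * real n ^ 3))"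
    by (intro order_trans[OF third_moment_bound[OF norm]] real_sqrt_le_mono)
  have "cmod (char_fun t - complex_of_real (exp (- t\<^sup>2 / 2))) \<le> \<bar>t\<bar> * exp (t\<^sup>2 / 2) * (\<bar>t\<bar> * row_defect + 3 / 4 * t\<^sup>2 * third_moment)"
    by (rule char_fun_bound)
  also have "\<dots> \<le> \<bar>t\<bar> * exp (t\<^sup>2 / 2) * (\<bar>t\<bar> * sqrt (81 / (v * real n ^ 2) + 810 / real n)
        + 3 / 4 * t\<^sup>2 * sqrt (972 / (v * real n ^ 2) + 162 / (v ^ 2 * real n ^ 3)))"
    by (intro mult_left_mono add_mono row_defect third_moment) auto
  finally show ?thesis
    unfolding char .
qed

section \<open>Central limit theorem for the signed wedge count\<close>

lemma isCont_cdf_std_normal: "isCont (cdf std_normal_distribution) x"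
proof -
  interpret real_distribution std_normal_distribution
    by (rule real_dist_normal_dist)
  have "emeasure std_normal_distribution {x} = 0"
    by (subst emeasure_density) (auto simp: nn_integral_0_iff_AE AE_lborel_singleton)
  then show ?thesis
    by (simp add: isCont_cdf measure_def)
qed

text \<open>Symmetry of the Gaussian law together with the absence of atoms. It rewrites the false
  negative probability, which arises as an upper tail, in the same form as the false positive
  one.\<close>

lemma cdf_std_normal_minus: "cdf std_normal_distribution (- x) = 1 - cdf std_normal_distribution x"
proof -
  interpret real_distribution std_normal_distribution
    by (rule real_dist_normal_dist)
  have "distributed std_normal_distribution lborel (\<lambda>x. x) (normal_density 0 1)"
    by (simp add: distributed_def distr_id2)
  from normal_density_affine[OF this, of "-1" 0]
  have "distr std_normal_distribution lborel uminus = std_normal_distribution"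
    by (simp add: distributed_def)
  moreover have "distr std_normal_distribution lborel uminus = distr std_normal_distribution borel uminus"
    by (intro distr_cong) simp_all
  ultimately have symm: "distr std_normal_distribution borel uminus = std_normal_distribution"
    by simp
  have "cdf std_normal_distribution (- x) = measure (distr std_normal_distribution borel uminus) {..-x}"
    by (simp add: cdf_def symm)
  also have "\<dots> = prob {x..}"
    by (subst measure_distr) (auto simp: vimage_def atLeast_def)
  also have "\<dots> = prob {x<..}"
  proof -
    have "prob {x} = 0"
      using isCont_cdf_std_normal[of x] by (simp add: isCont_cdf)
    moreover have "prob ({x} \<union> {x<..}) = prob {x} + prob {x<..}"
      by (rule finite_measure_Union) auto
    moreover have "{x} \<union> {x<..} = {x..}"
      by auto
    ultimately show ?thesis
      by simp
  qed
  also have "{x<..} = space std_normal_distribution - {..x}"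
    by auto
  also have "prob \<dots> = 1 - cdf std_normal_distribution x"
    unfolding cdf_def by (subst prob_compl) auto
  finally show ?thesis .
qed

lemma tendsto_zero_of_sqrt_scaling:
  assumes "(\<lambda>n. p n * sqrt (real n)) \<longlonglongrightarrow> \<theta>"
  shows "p \<longlonglongrightarrow> 0"
proof -
  have "(\<lambda>n. (p n * sqrt (real n)) * (1 / sqrt (real n))) \<longlonglongrightarrow> \<theta> * 0"
    by (intro tendsto_mult assms) real_asymp
  moreover have "eventually (\<lambda>n. (p n * sqrt (real n)) * (1 / sqrt (real n)) = p n) sequentially"
    using eventually_gt_at_top[of 0] by eventually_elim simp
  ultimately show ?thesis
    by (simp add: tendsto_cong)
qed

text \<open>Here \<open>v \<surd>n\<close> tends to \<theta>, so \<open>v n^2\<close> and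
  \<open>v^2 n^3\<close> grow like \<open>n\<close> to the powers 3/2 and 2. All error terms vanish
  for each fixed argument of the characteristic function, and Levy's continuity theorem
  applies.\<close>

lemma signed_wedge_count_CLT:
  assumes \<theta>: "\<theta> > 0" and lim: "(\<lambda>n. p n * sqrt (real n)) \<longlonglongrightarrow> \<theta>"
    and p: "eventually (\<lambda>n. 0 < p n \<and> p n < 1) sequentially"
  shows "(\<lambda>n. measure_pmf.prob (erdos_renyi n (p n)) {A. signed_wedge_count n (p n) A / wedge_sd n (p n) \<le> t})
    \<longlonglongrightarrow> cdf std_normal_distribution t"
proof -
  let ?v = "\<lambda>n. p n * (1 - p n)"
  let ?M = "\<lambda>n. distr (measure_pmf (erdos_renyi n (p n))) borel (\<lambda>A. signed_wedge_count n (p n) A / wedge_sd n (p n))"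
  have p0: "p \<longlonglongrightarrow> 0"
    by (rule tendsto_zero_of_sqrt_scaling[OF lim])
  have "(\<lambda>n. p n * sqrt (real n) * (1 - p n)) \<longlonglongrightarrow> \<theta> * (1 - 0)"
    by (intro tendsto_intros lim p0)
  then have v: "(\<lambda>n. ?v n * sqrt (real n)) \<longlonglongrightarrow> \<theta>"
    by (simp add: mult_ac)
  have e1: "(\<lambda>n. C / (?v n * real n ^ 2)) \<longlonglongrightarrow> 0" for C
  proof -
    have "(\<lambda>n. C / (?v n * sqrt (real n)) * (1 / sqrt (real n) ^ 3)) \<longlonglongrightarrow> C / \<theta> * 0"
      by (intro tendsto_mult tendsto_divide tendsto_const v) (use \<theta> in simp, real_asymp)
    moreover have eq: "C / (?v n * sqrt (real n)) * (1 / sqrt (real n) ^ 3) = C / (?v n * real n ^ 2)" for n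
    proof -
      have "sqrt (real n) * sqrt (real n) ^ 3 = (sqrt (real n) ^ 2) ^ 2"
        by (simp only: power_Suc[symmetric] power_mult[symmetric]) simp
      then have "sqrt (real n) * sqrt (real n) ^ 3 = real n ^ 2"
        by simp
      then show ?thesis
        by (simp add: mult.assoc)
    qed
    ultimately show ?thesis
      unfolding eq by (simp only: mult_zero_right)
  qed
  have e2: "(\<lambda>n. C / (?v n ^ 2 * real n ^ 3)) \<longlonglongrightarrow> 0" for C
  proof -
    have "(\<lambda>n. C / (?v n * sqrt (real n)) ^ 2 * (1 / real n ^ 2)) \<longlonglongrightarrow> C / \<theta> ^ 2 * 0"
      by (intro tendsto_mult tendsto_divide tendsto_const tendsto_power v) (use \<theta> in simp, real_asymp)
    moreover have eq: "C / (?v n * sqrt (real n)) ^ 2 * (1 / real n ^ 2) = C / (?v n ^ 2 * real n ^ 3)" for n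
      by (simp add: power_mult_distrib power2_eq_square power3_eq_cube mult.assoc)
    ultimately show ?thesis
      unfolding eq by (simp only: mult_zero_right)
  qed
  have char: "(\<lambda>n. char (?M n) s) \<longlonglongrightarrow> char std_normal_distribution s" for s
  proof -
    let ?b = "\<lambda>n. \<bar>s\<bar> * exp (s\<^sup>2 / 2) * (\<bar>s\<bar> * sqrt (81 / (?v n * real n ^ 2) + 810 / real n)
        + 3 / 4 * s\<^sup>2 * sqrt (972 / (?v n * real n ^ 2) + 162 / (?v n ^ 2 * real n ^ 3)))"
    have "(\<lambda>n. 810 / real n) \<longlonglongrightarrow> 0"
      by real_asymp
    then have "?b \<longlonglongrightarrow> \<bar>s\<bar> * exp (s\<^sup>2 / 2) * (\<bar>s\<bar> * sqrt (0 + 0) + 3 / 4 * s\<^sup>2 * sqrt (0 + 0))"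
      by (intro tendsto_intros e1 e2)
    then have b0: "?b \<longlonglongrightarrow> 0"
      by simp
    have ev: "eventually (\<lambda>n. norm (char (?M n) s - complex_of_real (exp (- s\<^sup>2 / 2))) \<le> ?b n) sequentially"
      using p eventually_ge_at_top[of 3]
      by eventually_elim (intro char_signed_wedge_count; simp)
    from tendsto_0_le[OF b0, of "\<lambda>n. char (?M n) s - complex_of_real (exp (- s\<^sup>2 / 2))" 1]
    have "(\<lambda>n. char (?M n) s - complex_of_real (exp (- s\<^sup>2 / 2))) \<longlonglongrightarrow> 0"
      using ev by (simp add: eventually_mono)
    then show ?thesis
      unfolding char_std_normal_distribution by (subst (asm) LIM_zero_iff)
  qed
  have "weak_conv_m ?M std_normal_distribution"
  proof (rule levy_continuity[OF _ _ char])
    show "real_distribution (?M n)" for n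
      by (intro prob_space.real_distribution_distr measure_pmf.prob_space_axioms) simp
    show "real_distribution std_normal_distribution"
      by (rule real_dist_normal_dist)
  qed
  moreover have "isCont (cdf std_normal_distribution) t"
    by (rule isCont_cdf_std_normal)
  ultimately have "(\<lambda>n. cdf (?M n) t) \<longlonglongrightarrow> cdf std_normal_distribution t"
    by (simp add: weak_conv_m_def weak_conv_def)
  moreover have "cdf (?M n) t = measure_pmf.prob (erdos_renyi n (p n)) {A. signed_wedge_count n (p n) A / wedge_sd n (p n) \<le> t}" for n
    unfolding cdf_def by (subst measure_distr) (auto simp: vimage_def)
  ultimately show ?thesis
    by simp
qed

section \<open>The size of a monomer-dimer matching\<close>

lemma finite_matchings: "finite E \<Longrightarrow> finite (matchings E)"
  by (rule finite_subset[of _ "Pow E"]) (auto simp: matchings_def)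

lemma set_monomer_dimer:
  assumes "finite E" "lam \<ge> 0"
  shows "set_pmf (monomer_dimer lam E) \<subseteq> matchings E"
  using pmf_monomer_dimer[OF assms] by (auto simp: set_pmf_eq split: if_splits)

lemma expectation_monomer_dimer:
  assumes "finite E" "lam \<ge> 0"
  shows "measure_pmf.expectation (monomer_dimer lam E) F =
    (\<Sum>M\<in>matchings E. lam ^ card M * F M) / (partition_function lam E :: real)"
proof -
  have "measure_pmf.expectation (monomer_dimer lam E) F = (\<Sum>M\<in>matchings E. pmf (monomer_dimer lam E) M *\<^sub>R F M)"
    using set_monomer_dimer[OF assms] by (intro integral_measure_pmf finite_matchings assms) auto
  then show ?thesis
    by (simp add: pmf_monomer_dimer[OF assms] sum_divide_distrib)
qed

lemma matching_subset:
  assumes "M \<in> matchings E" "N \<subseteq> M"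
  shows "N \<in> matchings E"
  using assms by (auto simp: matchings_def intro: pairwise_subset)

lemma card_Union_matching:
  assumes "M \<in> matchings (complete_edges n)"
  shows "card (\<Union>M) = 2 * card M"
proof -
  have "card (\<Union>M) = sum card M"
  proof (rule card_Union_disjoint)
    show "pairwise disjnt M"
      using assms by (auto simp: matchings_def disjoint_def pairwise_def disjnt_def)
    show "finite A" if "A \<in> M" for A
      using assms that by (auto simp: matchings_def complete_edges_def nsets_def)
  qed
  also have "\<dots> = (\<Sum>e\<in>M. 2)"
    using assms by (intro sum.cong) (auto simp: matchings_def complete_edges_def nsets_def)
  finally show ?thesis
    by simp
qed

lemma Union_matching_subset: "M \<in> matchings (complete_edges n) \<Longrightarrow> \<Union>M \<subseteq> {1..n}"
  by (auto simp: matchings_def complete_edges_def nsets_def)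

lemma card_matching_le:
  assumes "M \<in> matchings (complete_edges n)"
  shows "2 * card M \<le> n"
proof -
  have "card (\<Union>M) \<le> card {1..n}"
    by (intro card_mono Union_matching_subset assms) simp
  then show ?thesis
    by (simp add: card_Union_matching[OF assms])
qed

lemma card_free_edges:
  assumes M: "M \<in> matchings (complete_edges n)"
  shows "real (card (nsets ({1..n} - \<Union>M) 2)) =
    (real n - 2 * real (card M)) * (real n - 2 * real (card M) - 1) / 2"
proof -
  have "finite (\<Union>M)"
    using Union_matching_subset[OF M] by (rule finite_subset) simp
  then have "card ({1..n} - \<Union>M) = n - 2 * card M"
    using Union_matching_subset[OF M] by (simp add: card_Diff_subset card_Union_matching[OF M])
  then show ?thesis
    using card_matching_le[OF M] by (simp add: card_nsets real_choose_2 of_nat_diff)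
qed

lemma insert_free_edge_matching:
  assumes M: "M \<in> matchings (complete_edges n)" and e: "e \<in> nsets ({1..n} - \<Union>M) 2"
  shows "insert e M \<in> matchings (complete_edges n)" "e \<notin> M"
proof -
  have "e \<inter> \<Union>M = {}" "e \<in> complete_edges n" "e \<noteq> {}"
    using e by (auto simp: complete_edges_def nsets_def)
  then show "insert e M \<in> matchings (complete_edges n)" "e \<notin> M"
    using M unfolding matchings_def disjoint_def by blast+
qed

lemma remove_edge_matching:
  assumes M: "M \<in> matchings (complete_edges n)" and e: "e \<in> M"
  shows "e \<in> nsets ({1..n} - \<Union>(M - {e})) 2"
proof -
  have "e \<in> nsets {1..n} 2"
    using M e by (auto simp: matchings_def complete_edges_def)
  moreover have "e \<inter> \<Union>(M - {e}) = {}"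
    using M e unfolding matchings_def disjoint_def by blast
  ultimately show ?thesis
    by (auto simp: nsets_def)
qed

text \<open>Deleting \<open>e\<close> is a bijection from the pairs with \<open>e \<in> M\<close>
  onto the pairs in which both ends of \<open>e\<close> are left uncovered by \<open>M\<close>; its
  inverse inserts \<open>e\<close>. The deletion lowers the size by one, which accounts for
  \<open>Suc\<close> on the right.\<close>

lemma sum_matchings_remove_edge:
  fixes w :: "nat \<Rightarrow> real"
  shows "(\<Sum>M\<in>matchings (complete_edges n). real (card M) * w (card M)) =
    (\<Sum>M\<in>matchings (complete_edges n). real (card (nsets ({1..n} - \<Union>M) 2)) * w (Suc (card M)))"
proof -
  let ?X = "matchings (complete_edges n)" and ?F = "\<lambda>M. nsets ({1..n} - \<Union>M) 2"
  have fX: "finite ?X"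
    by (simp add: finite_matchings)
  have fM: "finite M" if "M \<in> ?X" for M
    using that finite_subset[of M "complete_edges n"] by (auto simp: matchings_def)
  have fF: "finite (?F M)" for M
    by (rule finite_imp_finite_nsets) simp
  have "(\<Sum>M\<in>?X. real (card M) * w (card M)) = (\<Sum>z\<in>Sigma ?X (\<lambda>M. M). w (card (fst z)))"
  proof -
    have "(\<Sum>z\<in>Sigma ?X (\<lambda>M. M). w (card (fst z))) = (\<Sum>M\<in>?X. \<Sum>e\<in>M. w (card M))"
      using fX fM by (subst sum.Sigma) (auto simp: split_def)
    then show ?thesis by simp
  qed
  also have "\<dots> = (\<Sum>z\<in>Sigma ?X ?F. w (Suc (card (fst z))))"
  proof (rule sum.reindex_bij_witness[where i = "\<lambda>(M, e). (insert e M, e)" and j = "\<lambda>(M, e). (M - {e}, e)"])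
    fix z assume "z \<in> Sigma ?X (\<lambda>M. M)"
    then obtain M e where z: "z = (M, e)" "M \<in> ?X" "e \<in> M"
      by auto
    show "(case case z of (M, e) \<Rightarrow> (M - {e}, e) of (M, e) \<Rightarrow> (insert e M, e)) = z"
      using z by auto
    show "(case z of (M, e) \<Rightarrow> (M - {e}, e)) \<in> Sigma ?X ?F"
      using z remove_edge_matching[of M n e] matching_subset[of M _ "M - {e}"] by auto
    show "w (Suc (card (fst (case z of (M, e) \<Rightarrow> (M - {e}, e))))) = w (card (fst z))"
      using z fM card.remove[of M e] by simp
  next
    fix z assume "z \<in> Sigma ?X ?F"
    then obtain M e where z: "z = (M, e)" "M \<in> ?X" "e \<in> ?F M"
      by auto
    show "(case case z of (M, e) \<Rightarrow> (insert e M, e) of (M, e) \<Rightarrow> (M - {e}, e)) = z"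
      using z insert_free_edge_matching[of M n e] by auto
    show "(case z of (M, e) \<Rightarrow> (insert e M, e)) \<in> Sigma ?X (\<lambda>M. M)"
      using z insert_free_edge_matching[of M n e] by auto
  qed
  also have "\<dots> = (\<Sum>M\<in>?X. real (card (?F M)) * w (Suc (card M)))"
  proof -
    have "(\<Sum>z\<in>Sigma ?X ?F. w (Suc (card (fst z)))) = (\<Sum>M\<in>?X. \<Sum>e\<in>?F M. w (Suc (card M)))"
      using fX fF by (subst sum.Sigma) (auto simp: split_def)
    then show ?thesis by simp
  qed
  finally show ?thesis .
qed

text \<open>The double count with weight \<open>lam ^ k * \<psi> k\<close>: the added edge gives the
  factor \<open>lam\<close>, and the number of edges free to be added depends on the matching only
  through its size. The result is a Stein identity for the matching size.\<close>

lemma monomer_dimer_identity: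
  fixes \<psi> :: "nat \<Rightarrow> real" and n :: nat
  assumes "lam \<ge> 0"
  defines "\<mu> \<equiv> monomer_dimer lam (complete_edges n)"
  shows "measure_pmf.expectation \<mu> (\<lambda>M. real (card M) * \<psi> (card M)) =
    measure_pmf.expectation \<mu> (\<lambda>M. lam * (real n - 2 * real (card M)) * (real n - 2 * real (card M) - 1) / 2 * \<psi> (Suc (card M)))"
proof -
  let ?X = "matchings (complete_edges n)"
  have "(\<Sum>M\<in>?X. lam ^ card M * (real (card M) * \<psi> (card M))) =
      (\<Sum>M\<in>?X. real (card M) * (lam ^ card M * \<psi> (card M)))"
    by (simp add: mult_ac)
  also have "\<dots> = (\<Sum>M\<in>?X. real (card (nsets ({1..n} - \<Union>M) 2)) * (lam ^ Suc (card M) * \<psi> (Suc (card M))))"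
    by (rule sum_matchings_remove_edge)
  also have "\<dots> = (\<Sum>M\<in>?X. lam ^ card M * (lam * (real n - 2 * real (card M)) * (real n - 2 * real (card M) - 1) / 2 * \<psi> (Suc (card M))))"
    by (intro sum.cong refl) (subst card_free_edges, simp_all)
  finally show ?thesis
    unfolding \<mu>_def expectation_monomer_dimer[OF finite_complete_edges assms(1)] by simp
qed

text \<open>
  The identity \<open>E (K \<psi> K) = E (h K \<psi> (K + 1))\<close> for the matching size \<open>K\<close> is used with \<open>\<psi> k = k - a\<close>, where
  \<open>a = c n / 2\<close> is almost a fixed point of the decreasing function \<open>h\<close>; the equation
  \<open>(1 - c)\<^sup>2 = \<zeta> c\<close> is the fixed-point equation to leading order.
\<close>

lemma matching_size_variance:
  fixes \<zeta> c :: real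
  assumes \<zeta>: "\<zeta> \<ge> 1" and c: "0 < c" "c < 1" "(1 - c)\<^sup>2 = \<zeta> * c"
    and n: "real n * (1 - c) \<ge> 1"
  shows "measure_pmf.expectation (monomer_dimer (1 / (\<zeta> * real n)) (complete_edges n))
    (\<lambda>M. (real (card M) - c * real n / 2)\<^sup>2) \<le> real n"
proof -
  define lam where "lam = 1 / (\<zeta> * real n)"
  define \<mu> where "\<mu> = monomer_dimer lam (complete_edges n)"
  define a where "a = c * real n / 2"
  define h where "h x = lam * (real n - 2 * x) * (real n - 2 * x - 1) / 2" for x
  let ?K = "\<lambda>M :: nat set set. real (card M)"
  have n0: "real n > 0"
    using n c by (cases n) auto
  have lam: "lam \<ge> 0"
    using \<zeta> by (simp add: lam_def)
  note supp = set_monomer_dimer[OF finite_complete_edges lam, of n, folded \<mu>_def]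
  have fin: "finite (set_pmf \<mu>)"
    by (rule finite_subset[OF supp]) (simp add: finite_matchings)
  have int [simp]: "integrable (measure_pmf \<mu>) F" for F :: "_ \<Rightarrow> real"
    by (rule integrable_measure_pmf_finite[OF fin])
  have K: "2 * ?K M \<le> real n" if "M \<in> set_pmf \<mu>" for M
    using card_matching_le[of M n] supp that by (simp add: of_nat_le_iff[symmetric, where 'a = real] subset_iff)
  have EK: "0 \<le> measure_pmf.expectation \<mu> ?K" "measure_pmf.expectation \<mu> ?K \<le> real n / 2"
  proof -
    have "measure_pmf.expectation \<mu> ?K \<le> measure_pmf.expectation \<mu> (\<lambda>_. real n / 2)"
      by (intro integral_mono_AE) (auto simp: AE_measure_pmf_iff dest!: K)
    then show "measure_pmf.expectation \<mu> ?K \<le> real n / 2"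
      by simp
  qed simp
  have id1: "measure_pmf.expectation \<mu> ?K = measure_pmf.expectation \<mu> (\<lambda>M. h (?K M))"
    using monomer_dimer_identity[OF lam, of n "\<lambda>_. 1"] by (simp add: \<mu>_def h_def)
  \<comment> \<open>Evaluating \<psi> at the successor leaves one extra \<open>h K\<close>, whose
    mean equals that of \<open>K\<close> by \<open>id1\<close>.\<close>
  have "measure_pmf.expectation \<mu> (\<lambda>M. ?K M * (?K M - a)) = measure_pmf.expectation \<mu> (\<lambda>M. h (?K M) * (?K M - a) + h (?K M))"
  proof -
    have "h y * (1 + y - a) = h y * (y - a) + h y" for y
      by (simp add: algebra_simps)
    then show ?thesis
      using monomer_dimer_identity[OF lam, of n "\<lambda>k. real k - a", folded \<mu>_def, folded h_def] by simp
  qed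
  then have id2: "measure_pmf.expectation \<mu> (\<lambda>M. (?K M - h (?K M)) * (?K M - a)) = measure_pmf.expectation \<mu> ?K"
    unfolding id1 by (simp add: left_diff_distrib)
  \<comment> \<open>The leading terms cancel by \<open>c(3)\<close>. The bounded rest comes from the
    \<open>- 1\<close> in the count of free edges.\<close>
  have ah: "a - h a = (1 - c) / (2 * \<zeta>)"
  proof -
    have "h a = (1 - c) * (real n * (1 - c) - 1) / (2 * \<zeta>)"
      using n0 \<zeta> by (simp add: h_def a_def lam_def field_simps)
    also have "\<dots> = (real n * (1 - c)\<^sup>2 - (1 - c)) / (2 * \<zeta>)"
      by (simp add: power2_eq_square algebra_simps)
    also have "\<dots> = a - (1 - c) / (2 * \<zeta>)"
      unfolding c(3) using \<zeta> by (simp add: a_def field_simps)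
    finally show ?thesis by simp
  qed
  \<comment> \<open>The secant slope of \<open>x - h x\<close> between \<open>a\<close> and
    \<open>K\<close> is at least 1. The difference \<open>h a - h K\<close> has the sign of
    \<open>K - a\<close> because \<open>K \<le> n / 2\<close> and the assumption \<open>n\<close>
    gives \<open>2 a + 1 \<le> n\<close>.\<close>
  have "measure_pmf.expectation \<mu> (\<lambda>M. (?K M - a)\<^sup>2) \<le>
      measure_pmf.expectation \<mu> (\<lambda>M. (?K M - h (?K M)) * (?K M - a) - (a - h a) * (?K M - a))"
  proof (intro integral_mono_AE int AE_pmfI)
    fix M assume M: "M \<in> set_pmf \<mu>"
    have "(?K M - h (?K M)) * (?K M - a) - (a - h a) * (?K M - a) - (?K M - a)\<^sup>2 = (h a - h (?K M)) * (?K M - a)"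
      by (simp add: power2_eq_square algebra_simps)
    also have "\<dots> = lam * (?K M - a)\<^sup>2 * ((real n - 2 * a - 1) + (real n - 2 * ?K M))"
      by (simp add: h_def power2_eq_square field_simps)
    also have "\<dots> \<ge> 0"
      using K[OF M] n lam by (intro mult_nonneg_nonneg add_nonneg_nonneg) (auto simp: a_def algebra_simps)
    finally show "(?K M - a)\<^sup>2 \<le> (?K M - h (?K M)) * (?K M - a) - (a - h a) * (?K M - a)"
      by simp
  qed
  also have "\<dots> = measure_pmf.expectation \<mu> ?K - (a - h a) * (measure_pmf.expectation \<mu> ?K - a)"
    using id2 by simp
  \<comment> \<open>The mean size is at most \<open>n / 2\<close>, and the defect
    \<open>a - h a\<close>, at most 1/2, multiplies a quantity that is at most
    \<open>n / 2\<close>.\<close>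
  also have "\<dots> \<le> real n / 2 + 1 / 2 * (real n / 2)"
  proof -
    have ah_le: "0 \<le> a - h a" "a - h a \<le> 1 / 2"
      using c \<zeta> by (auto simp: ah field_simps)
    have "a - measure_pmf.expectation \<mu> ?K \<le> real n / 2"
      using EK c n0 mult_right_mono[of c 1 "real n"] unfolding a_def by linarith
    then have "(a - h a) * (a - measure_pmf.expectation \<mu> ?K) \<le> (a - h a) * (real n / 2)"
      using ah_le by (intro mult_left_mono)
    also have "\<dots> \<le> 1 / 2 * (real n / 2)"
      using ah_le by (intro mult_right_mono) auto
    finally have "(a - h a) * (a - measure_pmf.expectation \<mu> ?K) \<le> 1 / 2 * (real n / 2)" .
    then show ?thesis
      using EK by (simp add: algebra_simps)
  qed
  finally show ?thesis
    using n0 by (simp add: \<mu>_def lam_def a_def)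
qed

section \<open>The planted model\<close>

text \<open>Coupling by superposition: on an edge of \<open>M\<close> the Bernoulli variable is
  drawn but overridden. This makes the noise independent of the matching.\<close>

lemma planted_matching_eq:
  assumes "lam \<ge> 0" and p: "0 \<le> p" "p \<le> 1"
  shows "planted_matching n p lam =
    map_pmf (\<lambda>(M, A) e. A e \<or> e \<in> M) (pair_pmf (monomer_dimer lam (complete_edges n)) (erdos_renyi n p))"
proof -
  let ?E = "complete_edges n"
  have "Pi_pmf ?E False (\<lambda>e. if e \<in> M then return_pmf True else bernoulli_pmf p) =
      map_pmf (\<lambda>A e. A e \<or> e \<in> M) (erdos_renyi n p)" if M: "M \<subseteq> ?E" for M
  proof -
    have "Pi_pmf ?E False (\<lambda>e. if e \<in> M then return_pmf True else bernoulli_pmf p) =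
        Pi_pmf ?E False (\<lambda>e. bind_pmf (bernoulli_pmf p) (\<lambda>b. return_pmf (b \<or> e \<in> M)))"
      by (intro Pi_pmf_cong) (auto simp: bind_return_pmf')
    also have "\<dots> = bind_pmf (erdos_renyi n p) (\<lambda>A. Pi_pmf ?E False (\<lambda>e. return_pmf (A e \<or> e \<in> M)))"
      unfolding erdos_renyi_def by (rule Pi_pmf_bind) simp
    also have "\<dots> = bind_pmf (erdos_renyi n p) (\<lambda>A. return_pmf (\<lambda>e. A e \<or> e \<in> M))"
    \<comment> \<open>Outside \<open>complete_edges n\<close> the default value \<open>False\<close>
      must agree with the superposed graph, which holds because both \<open>A\<close> and
      \<open>M\<close> are empty there.\<close>
    proof (intro bind_pmf_cong refl)
      fix A assume "A \<in> set_pmf (erdos_renyi n p)"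
      then have "A e = False" if "e \<notin> ?E" for e
        using that set_Pi_pmf_subset[of ?E False "\<lambda>_. bernoulli_pmf p"] by (auto simp: erdos_renyi_def)
      then show "Pi_pmf ?E False (\<lambda>e. return_pmf (A e \<or> e \<in> M)) = return_pmf (\<lambda>e. A e \<or> e \<in> M)"
        using M by (subst Pi_pmf_return_pmf) (auto intro!: arg_cong[where f = return_pmf])
    qed
    finally show ?thesis
      by (simp add: map_pmf_def)
  qed
  moreover have "M \<subseteq> ?E" if "M \<in> set_pmf (monomer_dimer lam ?E)" for M
    using set_monomer_dimer[OF finite_complete_edges assms(1)] that by (auto simp: matchings_def)
  ultimately show ?thesis
    unfolding planted_matching_def pair_pmf_def map_bind_pmf
    by (intro bind_pmf_cong refl) (simp add: map_pmf_def bind_assoc_pmf bind_return_pmf)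
qed

lemma matching_not_adjacent:
  assumes "M \<in> matchings E" "e \<in> M" "f \<in> M"
  shows "adj_mat e f = 0"
  using assms by (auto simp: matchings_def adj_mat_def adjacent_def disjoint_def)

text \<open>After expanding the square, distinct edges of \<open>M\<close> are not adjacent and thus
  have codegree at most 4, while the diagonal terms are degrees, at most \<open>2 n\<close>. As
  \<open>M\<close> has at most \<open>n / 2\<close> edges, both parts are at most
  \<open>n^2\<close>.\<close>

lemma sum_matching_neighbours_square:
  assumes n: "n \<ge> 3" and M: "M \<in> matchings (complete_edges n)"
  shows "(\<Sum>e\<in>complete_edges n. (\<Sum>f\<in>M. adj_mat e f)\<^sup>2) \<le> 2 * real n ^ 2"
proof -
  let ?E = "complete_edges n"
  have ME: "M \<subseteq> ?E" and fM: "finite M"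
    using M finite_subset[of M ?E] by (auto simp: matchings_def)
  have K: "2 * real (card M) \<le> real n"
    using card_matching_le[OF M] by (simp add: of_nat_le_iff[symmetric, where 'a = real])
  have "(\<Sum>e\<in>?E. (\<Sum>f\<in>M. adj_mat e f)\<^sup>2) = (\<Sum>e\<in>?E. \<Sum>f\<in>M. \<Sum>g\<in>M. adj_mat e f * adj_mat e g)"
    by (simp add: power2_eq_square sum_product)
  also have "\<dots> = (\<Sum>f\<in>M. \<Sum>e\<in>?E. \<Sum>g\<in>M. adj_mat e f * adj_mat e g)"
    by (rule sum.swap)
  also have "\<dots> = (\<Sum>f\<in>M. \<Sum>g\<in>M. \<Sum>e\<in>?E. adj_mat e f * adj_mat e g)"
    by (intro sum.cong refl sum.swap)
  also have "\<dots> \<le> (\<Sum>f\<in>M. \<Sum>g\<in>M. 4 + (if f = g then 2 * real n else 0))"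
  proof (intro sum_mono)
    fix f g assume fg: "f \<in> M" "g \<in> M"
    show "(\<Sum>e\<in>?E. adj_mat e f * adj_mat e g) \<le> 4 + (if f = g then 2 * real n else 0)"
    proof (cases "f = g")
      case True
      have "(\<Sum>e\<in>?E. adj_mat e f * adj_mat e f) = (\<Sum>e\<in>?E. adj_mat f e)"
        by (simp add: adj_mat_sym[of _ f] flip: power2_eq_square)
      then show ?thesis
        using True fg ME n degree_edge[of n f] by auto
    next
      case False
      then show ?thesis
        using codegree_le[of f n g] fg ME matching_not_adjacent[OF M fg] by auto
    qed
  qed
  also have "\<dots> = 4 * real (card M) ^ 2 + 2 * real n * real (card M)"
    using fM by (simp add: sum.distrib power2_eq_square algebra_simps)
  also have "\<dots> = (2 * real (card M))\<^sup>2 + real n * (2 * real (card M))"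
    by (simp add: power_mult_distrib)
  also have "\<dots> \<le> (real n)\<^sup>2 + real n * real n"
    using K by (intro add_mono power_mono mult_left_mono) auto
  finally show ?thesis
    by (simp add: power2_eq_square)
qed

text \<open>
  Since \<open>q = p + m (1 - p)\<close>, one has \<open>A\<^sub>e - q = x\<^sub>e (1 - B\<^sub>e) + (1 - p) (B\<^sub>e - m)\<close>. The deterministic
  part depends on the matching only through its size, because two edges of a matching are never adjacent.
\<close>

lemma planted_wedge_decomposition:
  fixes A :: "nat set \<Rightarrow> bool" and p m :: real
  assumes n: "n \<ge> 3" and M: "M \<in> matchings (complete_edges n)" and q: "q = p + m * (1 - p)"
  defines "E \<equiv> complete_edges n"
  defines "x \<equiv> \<lambda>e. of_bool (A e) - p"
    and "B \<equiv> \<lambda>e. of_bool (e \<in> M)"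
    and "\<beta> \<equiv> \<lambda>e. (1 - p) * (of_bool (e \<in> M) - m)"
  shows "signed_wedge_count n q (\<lambda>e. A e \<or> e \<in> M) =
    signed_wedge_count n p A
    + (\<Sum>e\<in>E. \<Sum>f\<in>E. adj_mat e f * ((1 - B e) * (1 - B f) - 1) / 2 * x e * x f)
    + (\<Sum>e\<in>E. (1 - B e) * (\<Sum>f\<in>E. adj_mat e f * \<beta> f) * x e)
    + (1 - p)\<^sup>2 * (m\<^sup>2 * wedges n - 2 * m * (real n - 2) * real (card M))"
proof -
  have ME: "M \<subseteq> E"
    using M by (auto simp: matchings_def E_def)
  have \<beta>B: "\<beta> e = (1 - p) * (B e - m)" for e
    by (simp add: \<beta>_def B_def)
  have z: "of_bool (A e \<or> e \<in> M) - q = (1 - B e) * x e + \<beta> e" for e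
    by (auto simp: x_def B_def \<beta>_def q algebra_simps)
  \<comment> \<open>The factor \<open>(1 - B e) * (1 - B f) - 1\<close> corrects for the products in
    which an edge of \<open>M\<close> overrides the noise; separating it leaves the wedge count of
    \<open>A\<close> intact. The cross terms occur once for each order of \<open>e\<close> and
    \<open>f\<close>.\<close>
  have "signed_wedge_count n q (\<lambda>e. A e \<or> e \<in> M) =
      (\<Sum>e\<in>E. \<Sum>f\<in>E. adj_mat e f * x e * x f / 2
        + adj_mat e f * ((1 - B e) * (1 - B f) - 1) / 2 * x e * x f
        + (1 - B e) * (adj_mat e f * \<beta> f) * x e / 2 + (1 - B f) * (adj_mat e f * \<beta> e) * x f / 2
        + adj_mat e f * \<beta> e * \<beta> f / 2)"
    unfolding signed_wedge_count_eq z E_def[symmetric] sum_divide_distrib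
    by (intro sum.cong refl) (simp add: field_simps)
  also have "\<dots> = (\<Sum>e\<in>E. \<Sum>f\<in>E. adj_mat e f * x e * x f / 2)
      + (\<Sum>e\<in>E. \<Sum>f\<in>E. adj_mat e f * ((1 - B e) * (1 - B f) - 1) / 2 * x e * x f)
      + (\<Sum>e\<in>E. \<Sum>f\<in>E. (1 - B e) * (adj_mat e f * \<beta> f) * x e / 2)
      + (\<Sum>e\<in>E. \<Sum>f\<in>E. (1 - B f) * (adj_mat e f * \<beta> e) * x f / 2)
      + (\<Sum>e\<in>E. \<Sum>f\<in>E. adj_mat e f * \<beta> e * \<beta> f / 2)"
    by (simp only: sum.distrib)
  also have "(\<Sum>e\<in>E. \<Sum>f\<in>E. adj_mat e f * x e * x f / 2) = signed_wedge_count n p A"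
    unfolding signed_wedge_count_eq x_def E_def by (simp add: sum_divide_distrib)
  also have "(\<Sum>e\<in>E. \<Sum>f\<in>E. (1 - B f) * (adj_mat e f * \<beta> e) * x f / 2) =
      (\<Sum>e\<in>E. \<Sum>f\<in>E. (1 - B e) * (adj_mat e f * \<beta> f) * x e / 2)"
    by (subst sum.swap) (simp only: adj_mat_sym)
  also have "(\<Sum>e\<in>E. \<Sum>f\<in>E. (1 - B e) * (adj_mat e f * \<beta> f) * x e / 2) =
      (\<Sum>e\<in>E. (1 - B e) * (\<Sum>f\<in>E. adj_mat e f * \<beta> f) * x e) / 2"
    by (simp add: sum_distrib_left sum_distrib_right sum_divide_distrib)
  also have "(\<Sum>e\<in>E. \<Sum>f\<in>E. adj_mat e f * \<beta> e * \<beta> f / 2) =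
      (1 - p)\<^sup>2 * (m\<^sup>2 * wedges n - 2 * m * (real n - 2) * real (card M))"
  proof -
    have pointwise: "adj_mat e f * \<beta> e * \<beta> f / 2 = (1 - p)\<^sup>2 * (m\<^sup>2 / 2 * adj_mat e f - m / 2 * (B e * adj_mat e f) - m / 2 * (B f * adj_mat f e))" for e f
    proof -
      have "adj_mat e f * B e * B f = 0"
        using matching_not_adjacent[OF M, of e f] by (auto simp: B_def)
      moreover have "adj_mat e f * \<beta> e * \<beta> f / 2 = (1 - p)\<^sup>2 * (m\<^sup>2 / 2 * adj_mat e f - m / 2 * (B e * adj_mat e f) - m / 2 * (B f * adj_mat e f))
          + (1 - p)\<^sup>2 / 2 * (adj_mat e f * B e * B f)"
        unfolding \<beta>B power2_eq_square by (simp add: field_simps)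
      ultimately show ?thesis
        by (simp add: adj_mat_sym)
    qed
    have "(\<Sum>e\<in>E. \<Sum>f\<in>E. adj_mat e f * \<beta> e * \<beta> f / 2) =
        (1 - p)\<^sup>2 * (m\<^sup>2 / 2 * (\<Sum>e\<in>E. \<Sum>f\<in>E. adj_mat e f) - m / 2 * (\<Sum>e\<in>E. \<Sum>f\<in>E. B e * adj_mat e f)
          - m / 2 * (\<Sum>e\<in>E. \<Sum>f\<in>E. B f * adj_mat f e))"
      by (simp only: pointwise sum_subtractf sum_distrib_left[symmetric])
    also have "(\<Sum>e\<in>E. \<Sum>f\<in>E. B f * adj_mat f e) = (\<Sum>e\<in>E. \<Sum>f\<in>E. B e * adj_mat e f)"
      by (rule sum.swap)
    also have "(\<Sum>e\<in>E. \<Sum>f\<in>E. B e * adj_mat e f) = (\<Sum>e\<in>E. B e * (2 * (real n - 2)))"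
      unfolding sum_distrib_left[symmetric] using n by (intro sum.cong refl) (simp add: E_def degree_edge)
    also have "\<dots> = real (card M) * (2 * (real n - 2))"
    proof -
      have "(\<Sum>e\<in>E. B e) = real (card M)"
        using ME by (simp add: B_def E_def of_bool_def sum.If_cases Int_absorb1 Int_absorb2)
      then show ?thesis
        by (simp only: sum_distrib_right[symmetric])
    qed
    finally show ?thesis
      using n by (simp add: E_def sum_sum_adj_mat field_simps)
  qed
  finally show ?thesis
    by simp
qed

text \<open>The three terms are the pairs of edges overridden by \<open>M\<close>, the linear form
  left by the planted mean, and the fluctuation of the matching size around \<kappa>. When
  \<open>v\<close> is of order \<open>1 / \<surd>n\<close>, \<open>m n\<close> is bounded and the
  squared size deviation has mean of order \<open>n\<close>, each is negligible against
  \<open>n^2\<close>.\<close>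

lemma planted_remainder:
  fixes p m \<kappa> :: real
  assumes n: "n \<ge> 3" and p: "0 < p" "p < 1" and m: "m \<ge> 0"
    and M: "M \<in> matchings (complete_edges n)" and q: "q = p + m * (1 - p)"
  defines "v \<equiv> p * (1 - p)"
  shows "measure_pmf.expectation (erdos_renyi n p) (\<lambda>A. (signed_wedge_count n q (\<lambda>e. A e \<or> e \<in> M)
      - signed_wedge_count n p A - (1 - p)\<^sup>2 * (m\<^sup>2 * wedges n - 2 * m * (real n - 2) * \<kappa>))\<^sup>2)
    \<le> 3 * (v\<^sup>2 * real n ^ 2 + 4 * v * real n ^ 2 * (1 + (m * real n)\<^sup>2) + 4 * (m * real n)\<^sup>2 * (real (card M) - \<kappa>)\<^sup>2)"
proof -
  let ?E = "complete_edges n"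
  let ?u = "\<lambda>b. of_bool b - p"
  let ?B = "\<lambda>e. of_bool (e \<in> M) :: real"
  define \<beta> where "\<beta> e = (1 - p) * (?B e - m)" for e
  define r where "r e f = adj_mat e f * ((1 - ?B e) * (1 - ?B f) - 1) / 2" for e f
  define d where "d e = (1 - ?B e) * (\<Sum>f\<in>?E. adj_mat e f * \<beta> f)" for e
  define l where "l = 2 * (1 - p)\<^sup>2 * m * (real n - 2) * (\<kappa> - real (card M))"
  have v: "v \<ge> 0"
    using p by (simp add: v_def)
  have ME: "M \<subseteq> ?E"
    using M by (auto simp: matchings_def)
  have K: "2 * real (card M) \<le> real n"
    using card_matching_le[OF M] by (simp add: of_nat_le_iff[symmetric, where 'a = real])
  interpret iid_coordinates ?E False "bernoulli_pmf p"
    by unfold_locales auto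
  have mean: "measure_pmf.expectation (bernoulli_pmf p) ?u = 0"
    using p by (simp add: algebra_simps)
  have var: "measure_pmf.expectation (bernoulli_pmf p) (\<lambda>b. (?u b)\<^sup>2) = v"
    using p by (simp add: v_def power2_eq_square algebra_simps)
  let ?D1 = "\<lambda>A. \<Sum>e\<in>?E. \<Sum>f\<in>?E. r e f * ?u (A e) * ?u (A f)" and ?D2 = "\<lambda>A. \<Sum>e\<in>?E. d e * ?u (A e)"
  have D1: "expec (\<lambda>A. (?D1 A)\<^sup>2) \<le> v\<^sup>2 * real n ^ 2"
  proof -
    have "expec (\<lambda>A. (?D1 A)\<^sup>2) = 2 * v\<^sup>2 * (\<Sum>e\<in>?E. \<Sum>f\<in>?E. (r e f)\<^sup>2)"
      unfolding var[symmetric] by (rule expec_quadratic_square) (auto simp: mean r_def adj_mat_sym)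
    \<comment> \<open>The coefficient \<open>r e f\<close> vanishes unless \<open>e\<close> or
      \<open>f\<close> lies in \<open>M\<close>, and its square is at most 1/4 of the adjacency
      entry; only the edges adjacent to \<open>M\<close> have to be counted.\<close>
    also have "(\<Sum>e\<in>?E. \<Sum>f\<in>?E. (r e f)\<^sup>2) \<le> (\<Sum>e\<in>?E. \<Sum>f\<in>?E. (?B e * adj_mat e f + ?B f * adj_mat f e) / 4)"
      by (intro sum_mono) (auto simp: r_def adj_mat_def adjacent_sym power_divide)
    also have "\<dots> = (\<Sum>e\<in>?E. \<Sum>f\<in>?E. ?B e * adj_mat e f) / 2"
    proof -
      have "(\<Sum>e\<in>?E. \<Sum>f\<in>?E. (?B e * adj_mat e f + ?B f * adj_mat f e) / 4) =
          ((\<Sum>e\<in>?E. \<Sum>f\<in>?E. ?B e * adj_mat e f) + (\<Sum>e\<in>?E. \<Sum>f\<in>?E. ?B f * adj_mat f e)) / 4"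
        by (simp only: sum_divide_distrib[symmetric] sum.distrib)
      also have "(\<Sum>e\<in>?E. \<Sum>f\<in>?E. ?B f * adj_mat f e) = (\<Sum>e\<in>?E. \<Sum>f\<in>?E. ?B e * adj_mat e f)"
        by (rule sum.swap)
      finally show ?thesis by simp
    qed
    also have "(\<Sum>e\<in>?E. \<Sum>f\<in>?E. ?B e * adj_mat e f) = (\<Sum>e\<in>?E. ?B e * (2 * (real n - 2)))"
      unfolding sum_distrib_left[symmetric] using n by (intro sum.cong refl) (simp add: degree_edge)
    also have "\<dots> = real (card M) * (2 * (real n - 2))"
    proof -
      have "(\<Sum>e\<in>?E. ?B e) = real (card M)"
        using ME by (simp add: of_bool_def sum.If_cases Int_absorb1 Int_absorb2)
      then show ?thesis
        by (simp only: sum_distrib_right[symmetric])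
    qed
    also have "2 * v\<^sup>2 * (real (card M) * (2 * (real n - 2)) / 2) = v\<^sup>2 * ((2 * real (card M)) * (real n - 2))"
      by simp
    also have "\<dots> \<le> v\<^sup>2 * (real n * real n)"
      using K n by (intro mult_left_mono mult_mono) auto
    finally show ?thesis
      by (simp add: power2_eq_square mult_left_mono)
  qed
  have D2: "expec (\<lambda>A. (?D2 A)\<^sup>2) \<le> 4 * v * real n ^ 2 * (1 + (m * real n)\<^sup>2)"
  proof -
    have "(d e)\<^sup>2 \<le> 2 * (\<Sum>f\<in>M. adj_mat e f)\<^sup>2 + 8 * (m * real n)\<^sup>2" if e: "e \<in> ?E" for e
    proof -
      let ?S = "\<Sum>f\<in>M. adj_mat e f"
      have "(\<Sum>f\<in>?E. adj_mat e f * ?B f) = (\<Sum>f\<in>?E. if f \<in> M then adj_mat e f else 0)"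
        by (intro sum.cong) auto
      also have "\<dots> = ?S"
        using ME by (simp add: sum.If_cases Int_absorb1)
      finally have S: "(\<Sum>f\<in>?E. adj_mat e f * ?B f) = ?S" .
      have "(\<Sum>f\<in>?E. adj_mat e f * \<beta> f) = (\<Sum>f\<in>?E. (1 - p) * (adj_mat e f * ?B f) - (1 - p) * m * adj_mat e f)"
        by (intro sum.cong refl) (simp add: \<beta>_def algebra_simps)
      also have "\<dots> = (1 - p) * ?S - (1 - p) * m * (2 * (real n - 2))"
        using n e by (simp only: sum_subtractf sum_distrib_left[symmetric] S degree_edge)
      finally have "d e = ((1 - ?B e) * (1 - p)) * (?S - 2 * m * (real n - 2))"
        by (simp add: d_def algebra_simps)
      then have "(d e)\<^sup>2 = ((1 - ?B e) * (1 - p))\<^sup>2 * (?S - 2 * m * (real n - 2))\<^sup>2"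
        by (simp only: power_mult_distrib)
      also have "\<dots> \<le> 1 * (?S - 2 * m * (real n - 2))\<^sup>2"
        using p by (intro mult_right_mono) (auto simp: abs_square_le_1)
      also have "\<dots> \<le> 2 * ?S\<^sup>2 + 2 * (2 * m * (real n - 2))\<^sup>2"
        using zero_le_power2[of "?S + 2 * m * (real n - 2)"] by (simp add: power2_eq_square algebra_simps)
      also have "(2 * m * (real n - 2))\<^sup>2 \<le> (2 * m * real n)\<^sup>2"
        using m n by (intro power_mono mult_left_mono mult_nonneg_nonneg) auto
      finally show ?thesis
        by (simp add: power_mult_distrib)
    qed
    then have "(\<Sum>e\<in>?E. (d e)\<^sup>2) \<le> (\<Sum>e\<in>?E. 2 * (\<Sum>f\<in>M. adj_mat e f)\<^sup>2 + 8 * (m * real n)\<^sup>2)"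
      by (rule sum_mono)
    also have "\<dots> = 2 * (\<Sum>e\<in>?E. (\<Sum>f\<in>M. adj_mat e f)\<^sup>2) + real (n choose 2) * (8 * (m * real n)\<^sup>2)"
      by (simp add: sum.distrib card_complete_edges flip: sum_distrib_left)
    also have "\<dots> \<le> 2 * (2 * real n ^ 2) + real n ^ 2 / 2 * (8 * (m * real n)\<^sup>2)"
    proof (intro add_mono mult_left_mono mult_right_mono sum_matching_neighbours_square n M)
      show "real (n choose 2) \<le> real n ^ 2 / 2"
        by (simp add: real_choose_2 power2_eq_square algebra_simps)
    qed auto
    also have "\<dots> = 4 * real n ^ 2 * (1 + (m * real n)\<^sup>2)"
      by (simp add: algebra_simps)
    finally have "v * (\<Sum>e\<in>?E. (d e)\<^sup>2) \<le> v * (4 * real n ^ 2 * (1 + (m * real n)\<^sup>2))"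
      using v by (rule mult_left_mono)
    then show ?thesis
      using expec_linear_square[of ?E ?u d, OF _ mean] by (simp add: var mult_ac)
  qed
  have l: "l\<^sup>2 \<le> 4 * (m * real n)\<^sup>2 * (real (card M) - \<kappa>)\<^sup>2"
  proof -
    have "l\<^sup>2 = 4 * ((1 - p)\<^sup>2 * (m * (real n - 2)))\<^sup>2 * (real (card M) - \<kappa>)\<^sup>2"
      by (simp add: l_def power_mult_distrib power2_commute)
    also have "\<dots> \<le> 4 * (1 * (m * real n))\<^sup>2 * (real (card M) - \<kappa>)\<^sup>2"
      using p m n by (intro mult_left_mono mult_right_mono power_mono mult_mono) (auto simp: abs_square_le_1)
    finally show ?thesis by simp
  qed
  have "signed_wedge_count n q (\<lambda>e. A e \<or> e \<in> M) - signed_wedge_count n p A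
      - (1 - p)\<^sup>2 * (m\<^sup>2 * wedges n - 2 * m * (real n - 2) * \<kappa>) = ?D1 A + ?D2 A + l" for A
    unfolding planted_wedge_decomposition[OF n M q] r_def d_def \<beta>_def l_def by (simp add: algebra_simps)
  then have "measure_pmf.expectation (erdos_renyi n p) (\<lambda>A. (signed_wedge_count n q (\<lambda>e. A e \<or> e \<in> M)
      - signed_wedge_count n p A - (1 - p)\<^sup>2 * (m\<^sup>2 * wedges n - 2 * m * (real n - 2) * \<kappa>))\<^sup>2)
      = expec (\<lambda>A. (?D1 A + ?D2 A + l)\<^sup>2)"
    by (simp add: erdos_renyi_def)
  also have "\<dots> \<le> expec (\<lambda>A. 3 * ((?D1 A)\<^sup>2 + (?D2 A)\<^sup>2 + l\<^sup>2))"
  proof (intro integral_mono integrable_Om)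
    have "(x + y + z)\<^sup>2 \<le> 3 * (x\<^sup>2 + y\<^sup>2 + z\<^sup>2)" for x y z :: real
    proof -
      have "0 \<le> (x - y)\<^sup>2 + (y - z)\<^sup>2 + (x - z)\<^sup>2"
        by simp
      then show ?thesis
        by (simp add: power2_eq_square algebra_simps)
    qed
    then show "(?D1 A + ?D2 A + l)\<^sup>2 \<le> 3 * ((?D1 A)\<^sup>2 + (?D2 A)\<^sup>2 + l\<^sup>2)" for A .
  qed
  also have "\<dots> = 3 * (expec (\<lambda>A. (?D1 A)\<^sup>2) + expec (\<lambda>A. (?D2 A)\<^sup>2) + l\<^sup>2)"
    by (subst integral_mult_right_zero, subst Bochner_Integration.integral_add, simp, simp,
        subst Bochner_Integration.integral_add) auto
  also have "\<dots> \<le> 3 * (v\<^sup>2 * real n ^ 2 + 4 * v * real n ^ 2 * (1 + (m * real n)\<^sup>2) + 4 * (m * real n)\<^sup>2 * (real (card M) - \<kappa>)\<^sup>2)"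
    by (intro mult_left_mono add_mono D1 D2 l) simp
  finally show ?thesis .
qed

section \<open>Passing from small second moments to limits of probabilities\<close>

lemma prob_abs_gt_le:
  fixes R :: "'a \<Rightarrow> real"
  assumes "finite (set_pmf N)" and "\<epsilon> > 0"
  shows "measure_pmf.prob N {\<omega>. \<bar>R \<omega>\<bar> > \<epsilon>} \<le> measure_pmf.expectation N (\<lambda>\<omega>. (R \<omega>)\<^sup>2) / \<epsilon>\<^sup>2"
proof -
  have "measure_pmf.prob N {\<omega>. \<bar>R \<omega>\<bar> > \<epsilon>} \<le> measure_pmf.prob N {\<omega>\<in>space (measure_pmf N). (R \<omega>)\<^sup>2 \<ge> \<epsilon>\<^sup>2}"
    using assms(2) by (intro measure_pmf.finite_measure_mono) (auto simp: abs_le_square_iff[symmetric])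
  also have "\<dots> \<le> measure_pmf.expectation N (\<lambda>\<omega>. (R \<omega>)\<^sup>2) / \<epsilon>\<^sup>2"
    using assms by (intro integral_Markov_inequality_measure[where A = "{}"] integrable_measure_pmf_finite) auto
  finally show ?thesis .
qed

text \<open>The threshold is allowed to move with \<open>n\<close>: it absorbs both the
  deterministic shift and the ratio of the two normalisations. Off the event that \<open>R\<close>
  is large, the event is sandwiched between two events for \<open>G\<close> alone.\<close>

lemma slutsky_prob:
  fixes N :: "nat \<Rightarrow> 'a pmf" and G R :: "nat \<Rightarrow> 'a \<Rightarrow> real" and F :: "real \<Rightarrow> real"
  assumes conv: "\<And>y. (\<lambda>n. measure_pmf.prob (N n) {\<omega>. G n \<omega> \<le> y}) \<longlonglongrightarrow> F y"
    and cont: "isCont F z" and x: "x \<longlonglongrightarrow> z"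
    and R: "\<And>\<epsilon>. \<epsilon> > 0 \<Longrightarrow> (\<lambda>n. measure_pmf.prob (N n) {\<omega>. \<bar>R n \<omega>\<bar> > \<epsilon>}) \<longlonglongrightarrow> 0"
  shows "(\<lambda>n. measure_pmf.prob (N n) {\<omega>. G n \<omega> + R n \<omega> \<le> x n}) \<longlonglongrightarrow> F z"
proof (rule tendstoI)
  fix e :: real assume e: "e > 0"
  then have "e / 3 > 0" by simp
  then have "\<exists>s>0. \<forall>y. \<bar>y - z\<bar> < s \<longrightarrow> \<bar>F y - F z\<bar> < e / 3"
    using cont unfolding continuous_at_eps_delta dist_real_def by blast
  then obtain s where s: "s > 0" "\<And>y. \<bar>y - z\<bar> < s \<Longrightarrow> \<bar>F y - F z\<bar> < e / 3"
    by blast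
  \<comment> \<open>One \<delta> is spent on \<open>R n\<close> and one on \<open>x n - z\<close>,
    and \<open>2 * \<delta>\<close> must remain below \<open>s\<close>.\<close>
  define \<delta> where "\<delta> = s / 3"
  have \<delta>: "\<delta> > 0" using s by (simp add: \<delta>_def)
  have F: "\<bar>F (z + 2 * \<delta>) - F z\<bar> < e / 3" "\<bar>F (z - 2 * \<delta>) - F z\<bar> < e / 3"
    using s by (auto simp: \<delta>_def)
  let ?P = "\<lambda>n y. measure_pmf.prob (N n) {\<omega>. G n \<omega> \<le> y}"
  let ?Q = "\<lambda>n. measure_pmf.prob (N n) {\<omega>. \<bar>R n \<omega>\<bar> > \<delta>}"
  let ?S = "\<lambda>n. measure_pmf.prob (N n) {\<omega>. G n \<omega> + R n \<omega> \<le> x n}"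
  have "eventually (\<lambda>n. dist (?P n y) (F y) < e / 3) sequentially" for y
    using conv[of y] \<open>e / 3 > 0\<close> by (rule tendstoD)
  note ev = this[of "z + 2 * \<delta>"] this[of "z - 2 * \<delta>"]
    tendstoD[OF R[OF \<delta>] \<open>e / 3 > 0\<close>] tendstoD[OF x \<delta>]
  show "eventually (\<lambda>n. dist (?S n) (F z) < e) sequentially"
    using ev
  proof eventually_elim
    case (elim n)
    have "?S n \<le> measure_pmf.prob (N n) ({\<omega>. G n \<omega> \<le> z + 2 * \<delta>} \<union> {\<omega>. \<bar>R n \<omega>\<bar> > \<delta>})"
      using elim(4) by (intro measure_pmf.finite_measure_mono) (auto simp: dist_real_def)
    also have "\<dots> \<le> ?P n (z + 2 * \<delta>) + ?Q n"
      by (rule measure_Un_le) auto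
    finally have upper: "?S n \<le> ?P n (z + 2 * \<delta>) + ?Q n" .
    have "?P n (z - 2 * \<delta>) \<le> measure_pmf.prob (N n) ({\<omega>. G n \<omega> + R n \<omega> \<le> x n} \<union> {\<omega>. \<bar>R n \<omega>\<bar> > \<delta>})"
      using elim(4) by (intro measure_pmf.finite_measure_mono) (auto simp: dist_real_def)
    also have "\<dots> \<le> ?S n + ?Q n"
      by (rule measure_Un_le) auto
    finally show ?case
      using upper elim(1-3) F unfolding dist_real_def by linarith
  qed
qed

text \<open>The normaliser of the test, with \<open>sqrt (1 - q\<^sup>2)\<close> in place of the
  factor \<open>1 - q\<close> of the standard deviation; both tend to 1 when \<open>q\<close> tends
  to 0.\<close>

definition wedge_norm :: "nat \<Rightarrow> real \<Rightarrow> real" where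
  "wedge_norm n q = sqrt (3 * real (n choose 3) * q\<^sup>2 * (1 - q\<^sup>2))"

lemma wedge_norm_eq: "q \<ge> 0 \<Longrightarrow> wedge_norm n q = sqrt (wedges n) * q * sqrt (1 - q\<^sup>2)"
  by (simp add: wedge_norm_def wedges_def real_sqrt_mult)

lemma wedges_pos: "n \<ge> 3 \<Longrightarrow> wedges n > 0"
  by (rule less_le_trans[OF _ wedges_ge]) simp_all

lemma wedge_sd_pos: "n \<ge> 3 \<Longrightarrow> 0 < p \<Longrightarrow> p < 1 \<Longrightarrow> wedge_sd n p > 0"
  by (simp add: wedge_sd_def wedges_pos)

lemma wedge_norm_pos:
  assumes "n \<ge> 3" "0 < q" "q < 1"
  shows "wedge_norm n q > 0"
proof -
  have "q\<^sup>2 < 1"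
    using assms by (simp add: power_less_one_iff)
  then show ?thesis
    using assms by (simp add: wedge_norm_eq wedges_pos)
qed

text \<open>Both densities are asymptotic to \<theta>/\<surd>n, so the normaliser at
  \<open>q\<close> may be exchanged for the standard deviation at \<open>p\<close>, the density of
  the noise in the planted model.\<close>

lemma wedge_norm_ratio:
  assumes \<theta>: "\<theta> > 0"
    and limp: "(\<lambda>n. p n * sqrt (real n)) \<longlonglongrightarrow> \<theta>" and limq: "(\<lambda>n. q n * sqrt (real n)) \<longlonglongrightarrow> \<theta>"
    and p: "eventually (\<lambda>n. 0 < p n \<and> p n < 1) sequentially"
    and q: "eventually (\<lambda>n. 0 < q n \<and> q n < 1) sequentially"
  shows "(\<lambda>n. wedge_norm n (q n) / wedge_sd n (p n)) \<longlonglongrightarrow> 1"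
proof -
  have p0: "p \<longlonglongrightarrow> 0" and q0: "q \<longlonglongrightarrow> 0"
    using tendsto_zero_of_sqrt_scaling limp limq by blast+
  have "(\<lambda>n. (q n * sqrt (real n)) / (p n * sqrt (real n)) * (sqrt (1 - (q n)\<^sup>2) / (1 - p n)))
      \<longlonglongrightarrow> \<theta> / \<theta> * (sqrt (1 - 0\<^sup>2) / (1 - 0))"
    using \<theta> by (intro tendsto_intros limp limq p0 q0) auto
  then have lim: "(\<lambda>n. (q n * sqrt (real n)) / (p n * sqrt (real n)) * (sqrt (1 - (q n)\<^sup>2) / (1 - p n))) \<longlonglongrightarrow> 1"
    using \<theta> by simp
  have "eventually (\<lambda>n. (q n * sqrt (real n)) / (p n * sqrt (real n)) * (sqrt (1 - (q n)\<^sup>2) / (1 - p n))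
      = wedge_norm n (q n) / wedge_sd n (p n)) sequentially"
    using p q eventually_ge_at_top[of 3]
  proof eventually_elim
    case (elim n)
    have "sqrt (real n) > 0" "sqrt (wedges n) > 0"
      using elim wedges_pos[of n] by auto
    then show ?case
      using elim by (simp add: wedge_norm_eq wedge_sd_def)
  qed
  with lim show ?thesis
    by (simp add: tendsto_cong)
qed

lemma wedge_test_eq_1: "wedge_test n q t A = 1 \<longleftrightarrow> signed_wedge_count n q A / wedge_norm n q \<le> t"
  by (simp add: wedge_test_def wedge_norm_def)

lemma wedge_test_eq_0: "wedge_test n q t A = 0 \<longleftrightarrow> \<not> signed_wedge_count n q A / wedge_norm n q \<le> t"
  by (simp add: wedge_test_def wedge_norm_def)

lemma finite_set_erdos_renyi: "finite (set_pmf (erdos_renyi n p))"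
proof -
  interpret iid_coordinates "complete_edges n" False "bernoulli_pmf p"
    by unfold_locales auto
  show ?thesis
    using finite_set_Om by (simp add: erdos_renyi_def)
qed

lemma false_positive_limit:
  assumes \<theta>: "\<theta> > 0" and lim: "(\<lambda>n. q n * sqrt (real n)) \<longlonglongrightarrow> \<theta>"
    and q: "eventually (\<lambda>n. 0 < q n \<and> q n < 1) sequentially"
  shows "(\<lambda>n. measure_pmf.prob (erdos_renyi n (q n)) {A. wedge_test n (q n) t A = 1})
    \<longlonglongrightarrow> cdf std_normal_distribution t"
proof -
  have x: "(\<lambda>n. t * (wedge_norm n (q n) / wedge_sd n (q n))) \<longlonglongrightarrow> t * 1"
    by (intro tendsto_intros wedge_norm_ratio[OF \<theta> lim lim q q])
  have "(\<lambda>n. measure_pmf.prob (erdos_renyi n (q n)) {A. signed_wedge_count n (q n) A / wedge_sd n (q n) + 0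
      \<le> t * (wedge_norm n (q n) / wedge_sd n (q n))}) \<longlonglongrightarrow> cdf std_normal_distribution t"
    by (rule slutsky_prob[where N = "\<lambda>n. erdos_renyi n (q n)" and R = "\<lambda>_ _. 0"
          and G = "\<lambda>n A. signed_wedge_count n (q n) A / wedge_sd n (q n)"])
      (use signed_wedge_count_CLT[OF \<theta> lim q] isCont_cdf_std_normal x in simp_all)
  moreover have "eventually (\<lambda>n. measure_pmf.prob (erdos_renyi n (q n)) {A. signed_wedge_count n (q n) A / wedge_sd n (q n) + 0
      \<le> t * (wedge_norm n (q n) / wedge_sd n (q n))} = measure_pmf.prob (erdos_renyi n (q n)) {A. wedge_test n (q n) t A = 1}) sequentially"
    using q eventually_ge_at_top[of 3]
  proof eventually_elim
    case (elim n)
    then have "wedge_norm n (q n) > 0" "wedge_sd n (q n) > 0"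
      using wedge_norm_pos wedge_sd_pos by auto
    then show ?case
      unfolding wedge_test_eq_1 by (intro arg_cong[where f = "measure_pmf.prob _"]) (auto simp: field_simps)
  qed
  ultimately show ?thesis
    by (simp add: tendsto_cong)
qed

text \<open>The square of a mean is at most the mean square, so
  \<open>matching_size_variance\<close> puts the expected size within \<surd>n of
  \<open>c n / 2\<close>. Division by about \<open>n^2 / 2\<close> and multiplication by
  \<open>n\<close> give \<open>c\<close>.\<close>

lemma planted_edge_density:
  fixes \<zeta> c :: real
  assumes \<zeta>: "\<zeta> \<ge> 1" and c: "0 < c" "c < 1" "(1 - c)\<^sup>2 = \<zeta> * c"
    and lam: "\<And>n. n \<ge> 1 \<Longrightarrow> lam n = 1 / (\<zeta> * real n)"
  shows "(\<lambda>n. expected_matching_size (lam n) n / real (n choose 2) * real n) \<longlonglongrightarrow> c"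
proof -
  let ?k = "\<lambda>n. expected_matching_size (lam n) n"
  have large: "eventually (\<lambda>n. real n * (1 - c) \<ge> 1) sequentially"
    using c by real_asymp
  have dev: "eventually (\<lambda>n. norm (?k n / real n - c / 2) \<le> 1 / sqrt (real n)) sequentially"
    using large eventually_ge_at_top[of 1]
  proof eventually_elim
    case (elim n)
    let ?\<mu> = "monomer_dimer (lam n) (complete_edges n)"
    have lam_eq: "lam n = 1 / (\<zeta> * real n)" and lam0: "lam n \<ge> 0"
      using lam[of n] elim \<zeta> by auto
    have int: "integrable (measure_pmf ?\<mu>) F" for F :: "_ \<Rightarrow> real"
      by (rule integrable_measure_pmf_finite[OF finite_subset[OF set_monomer_dimer[OF finite_complete_edges lam0]]])
        (simp add: finite_matchings)
    let ?X = "\<lambda>M. real (card M) - c * real n / 2"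
    have "measure_pmf.variance ?\<mu> ?X = measure_pmf.expectation ?\<mu> (\<lambda>M. (?X M)\<^sup>2) - (measure_pmf.expectation ?\<mu> ?X)\<^sup>2"
      by (rule measure_pmf.variance_eq) (rule int)+
    then have "(measure_pmf.expectation ?\<mu> ?X)\<^sup>2 \<le> measure_pmf.expectation ?\<mu> (\<lambda>M. (?X M)\<^sup>2)"
      using measure_pmf.variance_positive[of ?\<mu> ?X] by linarith
    also have "\<dots> \<le> real n"
      unfolding lam_eq by (rule matching_size_variance[OF \<zeta> c elim(1)])
    finally have "(?k n - c * real n / 2)\<^sup>2 \<le> real n"
      using int by (simp add: expected_matching_size_def)
    then have "\<bar>?k n - c * real n / 2\<bar> \<le> sqrt (real n)"
      by (metis real_sqrt_abs real_sqrt_le_mono)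
    then have "\<bar>?k n - c * real n / 2\<bar> / real n \<le> sqrt (real n) / real n"
      by (rule divide_right_mono) simp
    also have "\<bar>?k n - c * real n / 2\<bar> / real n = \<bar>?k n / real n - c / 2\<bar>"
    proof -
      have "?k n / real n - c / 2 = (?k n - c * real n / 2) / real n"
        using elim by (simp add: field_simps)
      then show ?thesis
        by simp
    qed
    also have "sqrt (real n) / real n = 1 / sqrt (real n)"
      using elim by (simp add: field_simps)
    finally show ?case
      by simp
  qed
  have "(\<lambda>n. 1 / sqrt (real n)) \<longlonglongrightarrow> 0"
    by real_asymp
  then have "(\<lambda>n. ?k n / real n - c / 2) \<longlonglongrightarrow> 0"
    by (rule Lim_null_comparison[OF dev])
  then have k: "(\<lambda>n. ?k n / real n) \<longlonglongrightarrow> c / 2"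
    by (rule Lim_null[THEN iffD2])
  have r: "(\<lambda>n. 2 * real n / (real n - 1)) \<longlonglongrightarrow> 2"
    by real_asymp
  have "(\<lambda>n. ?k n / real n * (2 * real n / (real n - 1))) \<longlonglongrightarrow> c / 2 * 2"
    by (intro tendsto_mult k r)
  moreover have "eventually (\<lambda>n. ?k n / real n * (2 * real n / (real n - 1)) = ?k n / real (n choose 2) * real n) sequentially"
    using eventually_ge_at_top[of 2] by eventually_elim (simp add: real_choose_2 field_simps)
  ultimately show ?thesis
    by (simp add: tendsto_cong)
qed

text \<open>On the coupling, the planted count is the noise count plus \<open>D n\<close> plus a
  remainder. After standardisation the mean moves by \<open>- 2 * \<tau>\<close>, so the test
  accepts the planted hypothesis when an asymptotically Gaussian variable is at most about
  \<open>- \<tau> + 2 * \<tau>\<close>; the complement has the limit stated.\<close>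

lemma false_negative_limit:
  fixes \<zeta> \<theta> c :: real
  assumes \<theta>: "\<theta> > 0" and lim: "(\<lambda>n. p n * sqrt (real n)) \<longlonglongrightarrow> \<theta>"
    and p: "\<And>n. n \<ge> 1 \<Longrightarrow> 0 < p n \<and> p n < 1"
    and \<zeta>: "\<zeta> \<ge> 1" and c: "0 < c" "c < 1" "(1 - c)\<^sup>2 = \<zeta> * c"
    and lam: "\<And>n. n \<ge> 1 \<Longrightarrow> lam n = 1 / (\<zeta> * real n)"
    and limq: "(\<lambda>n. q n * sqrt (real n)) \<longlonglongrightarrow> \<theta>"
    and q01: "eventually (\<lambda>n. 0 < q n \<and> q n < 1) sequentially"
    and m: "(\<lambda>n. m n * real n) \<longlonglongrightarrow> c" "\<And>n. m n \<ge> 0"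
    and q: "\<And>n. n \<ge> 1 \<Longrightarrow> q n = p n + m n * (1 - p n)"
  defines "\<tau> \<equiv> c\<^sup>2 / (2 * sqrt 2 * \<theta>)"
  shows "(\<lambda>n. measure_pmf.prob (planted_matching n (p n) (lam n)) {A. wedge_test n (q n) (- \<tau>) A = 0})
    \<longlonglongrightarrow> cdf std_normal_distribution (- \<tau>)"
proof -
  let ?\<mu> = "\<lambda>n. monomer_dimer (lam n) (complete_edges n)"
  define N where "N n = pair_pmf (?\<mu> n) (erdos_renyi n (p n))" for n
  define \<kappa> where "\<kappa> n = c * real n / 2" for n
  define D where "D n = (1 - p n)\<^sup>2 * ((m n)\<^sup>2 * wedges n - 2 * m n * (real n - 2) * \<kappa> n)" for n
  define G where "G n \<omega> = signed_wedge_count n (p n) (snd \<omega>) / wedge_sd n (p n)" for n and \<omega> :: "nat set set \<times> (nat set \<Rightarrow> bool)"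
  define Rm where "Rm n M A = signed_wedge_count n (q n) (\<lambda>e. A e \<or> e \<in> M) - signed_wedge_count n (p n) A - D n" for n M A
  define R where "R n \<omega> = Rm n (fst \<omega>) (snd \<omega>) / wedge_sd n (p n)" for n and \<omega> :: "nat set set \<times> (nat set \<Rightarrow> bool)"
  \<comment> \<open>The threshold \<open>- \<tau>\<close> of the test, after subtraction of the
    deterministic shift and conversion from \<open>wedge_norm\<close> at \<open>q n\<close> to
    \<open>wedge_sd\<close> at \<open>p n\<close>.\<close>
  define x where "x n = (- \<tau> - D n / wedge_norm n (q n)) * (wedge_norm n (q n) / wedge_sd n (p n))" for n
  have p01: "eventually (\<lambda>n. 0 < p n \<and> p n < 1) sequentially"
    using eventually_ge_at_top[of 1] by eventually_elim (rule p)
  have p0: "p \<longlonglongrightarrow> 0" and q0: "q \<longlonglongrightarrow> 0"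
    using tendsto_zero_of_sqrt_scaling lim limq by blast+
  have lam0: "lam n \<ge> 0" if "n \<ge> 1" for n
    using lam[OF that] \<zeta> by simp
  have fin\<mu>: "finite (set_pmf (?\<mu> n))" if "n \<ge> 1" for n
    using set_monomer_dimer[OF finite_complete_edges lam0[OF that]]
    by (rule finite_subset) (simp add: finite_matchings)
  have T: "(\<lambda>n. wedges n / real n ^ 3) \<longlonglongrightarrow> 1 / 2"
    unfolding wedges_eq by real_asymp
  have D_lim: "(\<lambda>n. D n / real n) \<longlonglongrightarrow> - c\<^sup>2 / 2"
  proof -
    have "(\<lambda>n. (real n - 2) / real n) \<longlonglongrightarrow> 1"
      by real_asymp
    \<comment> \<open>The term quadratic in \<open>m n\<close> gives \<open>c^2 / 2\<close>; the
      term linear in the matching size gives \<open>c^2\<close>, since \<kappa> is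
      \<open>c n / 2\<close>.\<close>
    then have "(\<lambda>n. (1 - p n)\<^sup>2 * ((m n * real n)\<^sup>2 * (wedges n / real n ^ 3) - m n * real n * ((real n - 2) / real n) * c))
        \<longlonglongrightarrow> (1 - 0)\<^sup>2 * (c\<^sup>2 * (1 / 2) - c * 1 * c)"
      by (intro tendsto_intros p0 m T)
    then have "(\<lambda>n. (1 - p n)\<^sup>2 * ((m n * real n)\<^sup>2 * (wedges n / real n ^ 3) - m n * real n * ((real n - 2) / real n) * c))
        \<longlonglongrightarrow> - c\<^sup>2 / 2"
      by (simp add: power2_eq_square)
    moreover have "eventually (\<lambda>n. (1 - p n)\<^sup>2 * ((m n * real n)\<^sup>2 * (wedges n / real n ^ 3) - m n * real n * ((real n - 2) / real n) * c)
        = D n / real n) sequentially"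
      using eventually_ge_at_top[of 1]
      by eventually_elim (simp add: D_def \<kappa>_def power2_eq_square power3_eq_cube field_simps)
    ultimately show ?thesis
      by (simp add: tendsto_cong)
  qed
  have norm_lim: "(\<lambda>n. wedge_norm n (q n) / real n) \<longlonglongrightarrow> sqrt (1 / 2) * \<theta>"
  proof -
    have "(\<lambda>n. sqrt (wedges n / real n ^ 3) * (q n * sqrt (real n)) * sqrt (1 - (q n)\<^sup>2)) \<longlonglongrightarrow> sqrt (1 / 2) * \<theta> * sqrt (1 - 0\<^sup>2)"
      by (intro tendsto_intros T limq q0)
    then have "(\<lambda>n. sqrt (wedges n / real n ^ 3) * (q n * sqrt (real n)) * sqrt (1 - (q n)\<^sup>2)) \<longlonglongrightarrow> sqrt (1 / 2) * \<theta>"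
      by simp
    moreover have "eventually (\<lambda>n. sqrt (wedges n / real n ^ 3) * (q n * sqrt (real n)) * sqrt (1 - (q n)\<^sup>2)
        = wedge_norm n (q n) / real n) sequentially"
      using q01 eventually_ge_at_top[of 1]
    proof eventually_elim
      case (elim n)
      have "sqrt (real n ^ 3) = real n * sqrt (real n)"
        by (simp add: power3_eq_cube real_sqrt_mult)
      then show ?case
        using elim by (simp add: wedge_norm_eq real_sqrt_divide)
    qed
    ultimately show ?thesis
      by (simp add: tendsto_cong)
  qed
  have "x \<longlonglongrightarrow> \<tau>"
  proof -
    have s2: "sqrt (1 / 2 :: real) \<noteq> 0"
      by simp
    have "(\<lambda>n. (- \<tau> - (D n / real n) / (wedge_norm n (q n) / real n)) * (wedge_norm n (q n) / wedge_sd n (p n)))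
        \<longlonglongrightarrow> (- \<tau> - (- c\<^sup>2 / 2) / (sqrt (1 / 2) * \<theta>)) * 1"
      using \<theta> s2 by (intro tendsto_intros D_lim norm_lim wedge_norm_ratio[OF \<theta> lim limq p01 q01]) auto
    moreover have "(- \<tau> - (- c\<^sup>2 / 2) / (sqrt (1 / 2) * \<theta>)) * 1 = \<tau>"
    proof -
      have "sqrt (1 / 2 :: real) = sqrt 2 / 2"
        by (simp add: real_sqrt_divide field_simps)
      then show ?thesis
        using \<theta> by (simp add: \<tau>_def field_simps)
    qed
    moreover have "eventually (\<lambda>n. (- \<tau> - (D n / real n) / (wedge_norm n (q n) / real n)) * (wedge_norm n (q n) / wedge_sd n (p n)) = x n) sequentially"
      using eventually_ge_at_top[of 1] by eventually_elim (simp add: x_def)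
    ultimately show ?thesis
      by (simp add: tendsto_cong)
  qed
  \<comment> \<open>The bound of \<open>planted_remainder\<close> is averaged over the matching,
    where the size variance is at most \<open>n\<close>, and divided by the squared standard
    deviation; 27 is its constant 3 times the 9 of \<open>wedges_ge\<close>.\<close>
  have R_bound: "eventually (\<lambda>n. measure_pmf.expectation (N n) (\<lambda>\<omega>. (R n \<omega>)\<^sup>2) \<le>
      27 * (1 / real n + 4 * (1 + (m n * real n)\<^sup>2) / (p n * (1 - p n) * real n) + 4 * (m n * real n)\<^sup>2 / ((p n * (1 - p n))\<^sup>2 * real n ^ 2))) sequentially"
  proof -
    have "eventually (\<lambda>n. real n * (1 - c) \<ge> 1) sequentially"
      using c by real_asymp
    then show ?thesis
      using eventually_ge_at_top[of 3]
    proof eventually_elim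
      case (elim n)
      define v where "v = p n * (1 - p n)"
      have pn: "0 < p n" "p n < 1" and n1: "n \<ge> 1"
        using p[of n] elim by auto
      have v: "v > 0"
        using pn by (simp add: v_def)
      have sd2: "(wedge_sd n (p n))\<^sup>2 = v\<^sup>2 * wedges n"
        using wedges_pos[of n] elim by (simp add: wedge_sd_def v_def power_mult_distrib)
      have int: "integrable (measure_pmf (?\<mu> n)) F" for F :: "_ \<Rightarrow> real"
        by (rule integrable_measure_pmf_finite[OF fin\<mu>[OF n1]])
      let ?b = "v\<^sup>2 * real n ^ 2 + 4 * v * real n ^ 2 * (1 + (m n * real n)\<^sup>2)"
      have "measure_pmf.expectation (N n) (\<lambda>\<omega>. (Rm n (fst \<omega>) (snd \<omega>))\<^sup>2) =
          measure_pmf.expectation (?\<mu> n) (\<lambda>M. measure_pmf.expectation (erdos_renyi n (p n)) (\<lambda>A. (Rm n M A)\<^sup>2))"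
        unfolding N_def by (subst expectation_pair_pmf_finite[OF fin\<mu>[OF n1] finite_set_erdos_renyi]) simp
      also have "\<dots> \<le> measure_pmf.expectation (?\<mu> n) (\<lambda>M. 3 * (?b + 4 * (m n * real n)\<^sup>2 * (real (card M) - \<kappa> n)\<^sup>2))"
      proof (intro integral_mono_AE int AE_pmfI)
        fix M assume "M \<in> set_pmf (?\<mu> n)"
        then have "M \<in> matchings (complete_edges n)"
          using set_monomer_dimer[OF finite_complete_edges lam0[OF n1]] by auto
        then show "measure_pmf.expectation (erdos_renyi n (p n)) (\<lambda>A. (Rm n M A)\<^sup>2) \<le>
            3 * (?b + 4 * (m n * real n)\<^sup>2 * (real (card M) - \<kappa> n)\<^sup>2)"
          unfolding Rm_def D_def v_def
          by (intro planted_remainder elim(2) pn m(2) q[OF n1])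
      qed
      also have "\<dots> = 3 * (?b + 4 * (m n * real n)\<^sup>2 * measure_pmf.expectation (?\<mu> n) (\<lambda>M. (real (card M) - \<kappa> n)\<^sup>2))"
        by (subst integral_mult_right_zero, subst Bochner_Integration.integral_add[OF int int]) simp
      also have "\<dots> \<le> 3 * (?b + 4 * (m n * real n)\<^sup>2 * real n)"
        unfolding \<kappa>_def lam[OF n1]
        by (intro mult_left_mono add_mono order_refl matching_size_variance[OF \<zeta> c elim(1)]) auto
      finally have E: "measure_pmf.expectation (N n) (\<lambda>\<omega>. (Rm n (fst \<omega>) (snd \<omega>))\<^sup>2) \<le> 3 * (?b + 4 * (m n * real n)\<^sup>2 * real n)" .
      have "measure_pmf.expectation (N n) (\<lambda>\<omega>. (R n \<omega>)\<^sup>2) = measure_pmf.expectation (N n) (\<lambda>\<omega>. (Rm n (fst \<omega>) (snd \<omega>))\<^sup>2) / (v\<^sup>2 * wedges n)"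
        by (simp add: R_def power_divide sd2)
      also have "\<dots> \<le> 3 * (?b + 4 * (m n * real n)\<^sup>2 * real n) / (v\<^sup>2 * wedges n)"
        using v wedges_pos[of n] elim by (intro divide_right_mono E) simp
      also have "\<dots> \<le> 3 * (?b + 4 * (m n * real n)\<^sup>2 * real n) / (v\<^sup>2 * (real n ^ 3 / 9))"
        using v wedges_pos[of n] wedges_ge[of n] elim
        by (intro divide_left_mono mult_left_mono mult_pos_pos mult_nonneg_nonneg add_nonneg_nonneg) auto
      also have "\<dots> = 27 * (1 / real n + 4 * (1 + (m n * real n)\<^sup>2) / (v * real n) + 4 * (m n * real n)\<^sup>2 / (v\<^sup>2 * real n ^ 2))"
        using v elim by (simp add: field_simps power2_eq_square power3_eq_cube)
      finally show ?case
        unfolding v_def .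
    qed
  qed
  have b_lim: "(\<lambda>n. 27 * (1 / real n + 4 * (1 + (m n * real n)\<^sup>2) / (p n * (1 - p n) * real n) + 4 * (m n * real n)\<^sup>2 / ((p n * (1 - p n))\<^sup>2 * real n ^ 2))) \<longlonglongrightarrow> 0"
  proof -
    have "(\<lambda>n. p n * sqrt (real n) * (1 - p n)) \<longlonglongrightarrow> \<theta> * (1 - 0)"
      by (intro tendsto_intros lim p0)
    then have v: "(\<lambda>n. p n * (1 - p n) * sqrt (real n)) \<longlonglongrightarrow> \<theta>"
      by (simp add: mult_ac)
    have r: "(\<lambda>n. 1 / sqrt (real n)) \<longlonglongrightarrow> 0" "(\<lambda>n. 1 / real n) \<longlonglongrightarrow> 0"
      by real_asymp+
    have "(\<lambda>n. 27 * (1 / real n + 4 * (1 + (m n * real n)\<^sup>2) / (p n * (1 - p n) * sqrt (real n)) * (1 / sqrt (real n))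
        + 4 * (m n * real n)\<^sup>2 / (p n * (1 - p n) * sqrt (real n))\<^sup>2 * (1 / real n)))
        \<longlonglongrightarrow> 27 * (0 + 4 * (1 + c\<^sup>2) / \<theta> * 0 + 4 * c\<^sup>2 / \<theta>\<^sup>2 * 0)"
      using \<theta> by (intro tendsto_intros m v r) auto
    moreover have "(4 * (1 + (m n * real n)\<^sup>2) / (p n * (1 - p n) * sqrt (real n)) * (1 / sqrt (real n))
        = 4 * (1 + (m n * real n)\<^sup>2) / (p n * (1 - p n) * real n))" for n
      by (simp add: mult.assoc)
    moreover have "4 * (m n * real n)\<^sup>2 / (p n * (1 - p n) * sqrt (real n))\<^sup>2 * (1 / real n)
        = 4 * (m n * real n)\<^sup>2 / ((p n * (1 - p n))\<^sup>2 * real n ^ 2)" for n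
      by (simp add: power_mult_distrib power2_eq_square[of "real n"] mult.assoc)
    ultimately show ?thesis
      by (simp only: mult_zero_right add_0_left)
  qed
  have R_lim: "(\<lambda>n. measure_pmf.prob (N n) {\<omega>. \<bar>R n \<omega>\<bar> > \<epsilon>}) \<longlonglongrightarrow> 0" if \<epsilon>: "\<epsilon> > 0" for \<epsilon>
  proof (rule Lim_null_comparison)
    show "eventually (\<lambda>n. norm (measure_pmf.prob (N n) {\<omega>. \<bar>R n \<omega>\<bar> > \<epsilon>}) \<le>
       27 * (1 / real n + 4 * (1 + (m n * real n)\<^sup>2) / (p n * (1 - p n) * real n) + 4 * (m n * real n)\<^sup>2 / ((p n * (1 - p n))\<^sup>2 * real n ^ 2)) / \<epsilon>\<^sup>2) sequentially"
      using R_bound eventually_ge_at_top[of 1]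
    proof eventually_elim
      case (elim n)
      have "finite (set_pmf (N n))"
        using fin\<mu>[OF elim(2)] finite_set_erdos_renyi by (simp add: N_def)
      from prob_abs_gt_le[OF this \<epsilon>, of "R n"] divide_right_mono[OF elim(1), of "\<epsilon>\<^sup>2"]
      show ?case
        by simp
    qed
    show "(\<lambda>n. 27 * (1 / real n + 4 * (1 + (m n * real n)\<^sup>2) / (p n * (1 - p n) * real n) + 4 * (m n * real n)\<^sup>2 / ((p n * (1 - p n))\<^sup>2 * real n ^ 2)) / \<epsilon>\<^sup>2) \<longlonglongrightarrow> 0"
      using tendsto_divide[OF b_lim tendsto_const[of "\<epsilon>\<^sup>2"]] \<epsilon> by simp
  qed
  have G_lim: "(\<lambda>n. measure_pmf.prob (N n) {\<omega>. G n \<omega> \<le> y}) \<longlonglongrightarrow> cdf std_normal_distribution y" for y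
  proof -
    \<comment> \<open>\<open>G\<close> ignores the matching, so only the noise marginal of the
      coupling enters.\<close>
    have "measure_pmf.prob (N n) {\<omega>. G n \<omega> \<le> y} =
        measure_pmf.prob (map_pmf snd (N n)) {A. signed_wedge_count n (p n) A / wedge_sd n (p n) \<le> y}" for n
      by (simp add: G_def vimage_def)
    then show ?thesis
      using signed_wedge_count_CLT[OF \<theta> lim p01, of y] by (simp add: N_def map_snd_pair_pmf)
  qed
  have "(\<lambda>n. measure_pmf.prob (N n) {\<omega>. G n \<omega> + R n \<omega> \<le> x n}) \<longlonglongrightarrow> cdf std_normal_distribution \<tau>"
    by (rule slutsky_prob[OF G_lim isCont_cdf_std_normal \<open>x \<longlonglongrightarrow> \<tau>\<close> R_lim])
  then have "(\<lambda>n. 1 - measure_pmf.prob (N n) {\<omega>. G n \<omega> + R n \<omega> \<le> x n}) \<longlonglongrightarrow> 1 - cdf std_normal_distribution \<tau>"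
    by (intro tendsto_intros)
  moreover have "eventually (\<lambda>n. 1 - measure_pmf.prob (N n) {\<omega>. G n \<omega> + R n \<omega> \<le> x n} =
      measure_pmf.prob (planted_matching n (p n) (lam n)) {A. wedge_test n (q n) (- \<tau>) A = 0}) sequentially"
    using q01 eventually_ge_at_top[of 3]
  proof eventually_elim
    case (elim n)
    have n1: "n \<ge> 1" and pn: "0 < p n" "p n < 1"
      using elim p[of n] by auto
    have pos: "wedge_norm n (q n) > 0" "wedge_sd n (p n) > 0"
      using elim pn wedge_norm_pos wedge_sd_pos by auto
    have iff: "G n (M, A) + R n (M, A) \<le> x n \<longleftrightarrow>
        signed_wedge_count n (q n) (\<lambda>e. A e \<or> e \<in> M) / wedge_norm n (q n) \<le> - \<tau>" for M A
    proof -
      let ?S = "signed_wedge_count n (q n) (\<lambda>e. A e \<or> e \<in> M)"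
      have "G n (M, A) + R n (M, A) = (?S - D n) / wedge_sd n (p n)"
        by (simp add: G_def R_def Rm_def flip: add_divide_distrib)
      moreover have "x n = (- \<tau> * wedge_norm n (q n) - D n) / wedge_sd n (p n)"
        using pos by (simp add: x_def field_simps)
      ultimately have "G n (M, A) + R n (M, A) \<le> x n \<longleftrightarrow> ?S - D n \<le> - \<tau> * wedge_norm n (q n) - D n"
        using pos by (simp only: divide_le_cancel) simp
      also have "\<dots> \<longleftrightarrow> ?S / wedge_norm n (q n) \<le> - \<tau>"
        using pos by (simp add: pos_divide_le_eq)
      finally show ?thesis .
    qed
    have "measure_pmf.prob (planted_matching n (p n) (lam n)) {A. wedge_test n (q n) (- \<tau>) A = 0} =
        measure_pmf.prob (N n) {\<omega>. \<not> G n \<omega> + R n \<omega> \<le> x n}"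
      unfolding planted_matching_eq[OF lam0[OF n1] less_imp_le[OF pn(1)] less_imp_le[OF pn(2)]] N_def
      by (auto simp: vimage_def wedge_test_eq_0 iff intro!: arg_cong[where f = "measure_pmf.prob _"])
    also have "{\<omega>. \<not> G n \<omega> + R n \<omega> \<le> x n} = UNIV - {\<omega>. G n \<omega> + R n \<omega> \<le> x n}"
      by auto
    finally show ?case
      using measure_pmf.prob_compl[of "{\<omega>. G n \<omega> + R n \<omega> \<le> x n}" "N n"] by simp
  qed
  ultimately show ?thesis
    by (simp add: tendsto_cong cdf_std_normal_minus)
qed

theorem theorem2p10:
  fixes \<zeta> \<theta> c :: real and lam p q :: "nat \<Rightarrow> real"
  assumes "\<zeta> \<ge> 60" and "\<theta> > 0"
    and "\<And>n. n \<ge> 1 \<Longrightarrow> lam n = 1 / (\<zeta> * real n)"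
    and "\<And>n. n \<ge> 1 \<Longrightarrow> 0 < p n \<and> p n < 1"
    and "(\<lambda>n. p n * sqrt (real n)) \<longlonglongrightarrow> \<theta>"
    and "\<And>n. n \<ge> 1 \<Longrightarrow>
           q n = p n + expected_matching_size (lam n) n / real (n choose 2) * (1 - p n)"
    and "c = 1 - (sqrt (\<zeta>\<^sup>2 + 4 * \<zeta>) - \<zeta>) / 2"
  shows "(\<lambda>n. measure_pmf.prob (planted_matching n (p n) (lam n))
                {A. wedge_test n (q n) (- (c\<^sup>2 / (2 * sqrt 2 * \<theta>))) A = 0}
            + measure_pmf.prob (erdos_renyi n (q n))
                {A. wedge_test n (q n) (- (c\<^sup>2 / (2 * sqrt 2 * \<theta>))) A = 1})
         \<longlonglongrightarrow> 2 * cdf std_normal_distribution (- (c\<^sup>2 / (2 * sqrt 2 * \<theta>)))"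
proof -
  note \<theta> = assms(2) and lam = assms(3) and p = assms(4) and lim = assms(5) and q = assms(6)
  define m where "m n = expected_matching_size (lam n) n / real (n choose 2)" for n
  have \<zeta>: "\<zeta> \<ge> 1"
    using assms(1) by simp
  define s where "s = sqrt (\<zeta>\<^sup>2 + 4 * \<zeta>)"
  have s2: "s\<^sup>2 = \<zeta>\<^sup>2 + 4 * \<zeta>"
    using \<zeta> by (simp add: s_def)
  \<comment> \<open>These bounds are \<open>c < 1\<close> and \<open>0 < c\<close>; the upper one
    holds because \<open>\<zeta>^2 + 4 \<zeta>\<close> is \<open>(\<zeta> + 2)^2 - 4\<close>. The
    number \<open>c\<close> is the smaller root of \<open>(1 - c)^2 = \<zeta> c\<close>.\<close>
  have s: "\<zeta> < s" "s < \<zeta> + 2"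
    unfolding s_def using \<zeta> by (auto intro!: real_less_rsqrt real_less_lsqrt simp: power2_eq_square algebra_simps)
  have c_eq: "c = 1 - (s - \<zeta>) / 2"
    using assms(7) by (simp add: s_def)
  have c: "0 < c" "c < 1" "(1 - c)\<^sup>2 = \<zeta> * c"
  proof -
    show "0 < c" "c < 1"
      using s by (simp_all add: c_eq)
    have "(1 - c)\<^sup>2 = (s\<^sup>2 - 2 * s * \<zeta> + \<zeta>\<^sup>2) / 4"
      by (simp add: c_eq power2_eq_square field_simps)
    then show "(1 - c)\<^sup>2 = \<zeta> * c"
      unfolding s2 by (simp add: c_eq power2_eq_square field_simps)
  qed
  have m: "(\<lambda>n. m n * real n) \<longlonglongrightarrow> c"
    unfolding m_def by (rule planted_edge_density[OF \<zeta> c lam])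
  have m0: "m n \<ge> 0" for n
    by (simp add: m_def expected_matching_size_def)
  have qm: "q n = p n + m n * (1 - p n)" if "n \<ge> 1" for n
    using q[OF that] by (simp add: m_def)
  \<comment> \<open>The densities differ by \<open>m n * (1 - p n)\<close>, which is of order
    \<open>1 / n\<close> and disappears at the scale \<open>1 / \<surd>n\<close>.\<close>
  have limq: "(\<lambda>n. q n * sqrt (real n)) \<longlonglongrightarrow> \<theta>"
  proof -
    have "(\<lambda>n. 1 / sqrt (real n)) \<longlonglongrightarrow> 0"
      by real_asymp
    then have "(\<lambda>n. p n * sqrt (real n) + m n * real n * (1 / sqrt (real n)) * (1 - p n)) \<longlonglongrightarrow> \<theta> + c * 0 * (1 - 0)"
      by (intro tendsto_intros lim m tendsto_zero_of_sqrt_scaling[OF lim])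
    moreover have "eventually (\<lambda>n. p n * sqrt (real n) + m n * real n * (1 / sqrt (real n)) * (1 - p n) = q n * sqrt (real n)) sequentially"
      using eventually_ge_at_top[of 1]
    proof eventually_elim
      case (elim n)
      have "real n * (1 / sqrt (real n)) = sqrt (real n)"
        by (simp add: real_div_sqrt)
      then show ?case
        unfolding qm[OF elim] mult.assoc[of "m n"] by (simp add: algebra_simps)
    qed
    ultimately show ?thesis
      by (simp add: tendsto_cong)
  qed
  have "eventually (\<lambda>n. q n < 1) sequentially"
    using order_tendstoD(2)[OF tendsto_zero_of_sqrt_scaling[OF limq], of 1] by simp
  then have q01: "eventually (\<lambda>n. 0 < q n \<and> q n < 1) sequentially"
    using eventually_ge_at_top[of 1]
  proof eventually_elim
    case (elim n)
    then show ?case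
      using p[of n] m0[of n] qm[of n] by (simp add: add_pos_nonneg)
  qed
  show ?thesis
    using tendsto_add[OF false_negative_limit[OF \<theta> lim p \<zeta> c lam limq q01 m m0 qm] false_positive_limit[OF \<theta> limq q01]]
    by (simp only: mult_2)
qed

end
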